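(* Let $(Y^7,\varphi)$ be a torsion-free $G_2$ manifold. With the canonical complexes $(G_0^\bullet,d_0)$ of $T^*Y$-valued cochains and $(E^\bullet,e)$ of $\operatorname{End}_0(TY)$-valued cochains, the curvature insertion $f^k:G_0^k\to E^{k+1}$ and the skew covariant derivative $\mathcal K^k:G_0^k\to E^k$ (as defined in the context), one has on every canonical cochain $$f^k=\mathcal K^{k+1}d_0^k-e^k\mathcal K^k,\qquad k=0,1,2,3,$$ where the outgoing maps at degree $3$ and $\mathcal K^4$ are zero.
   Context: Geometry. $Y$ is a smooth seven-manifold with a positive three-form $\varphi$ (a $G_2$ structure), with associated metric $g$ and orientation, normalized so that locally there is an oriented $g$-orthonormal coframe with $\varphi=e^{123}+e^{145}+e^{167}+e^{246}-e^{257}-e^{347}-e^{356}$; $\psi=*\varphi$. Torsion-free means $\mathrm d\varphi=0$ and $\mathrm d\psi=0$; equivalently the Levi-Civita connection $\nabla$ preserves $\varphi$ and $\psi$. No compactness is assumed. $R(X,Y)=[\nabla_X,\nabla_Y]-\nabla_{[X,Y]}$ is the Riemann curvature, regarded as an $\operatorname{End}(TY)$-valued two-form. $(e_i)$ denotes a local $g$-orthonormal frame with dual coframe $(e^i)$. Canonical complexes. $\Lambda^2=\Lambda^2_7\oplus\Lambda^2_{14}$ with $\Lambda^2_7=\{\iota_X\varphi\}$, $\Lambda^2_{14}=\{\eta:\eta\wedge\psi=0\}$, and $\Lambda^3_1=\mathbb R\varphi\subset\Lambda^3$. Put $\Lambda^0_{\rm can}=\Lambda^0$, $\Lambda^1_{\rm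 can}=\Lambda^1$, $\Lambda^2_{\rm can}=\Lambda^2_7$, $\Lambda^3_{\rm can}=\Lambda^3_1$, and zero in other degrees; $\Pi_k:\Lambda^k\to\Lambda^k_{\rm can}$ is the orthogonal projection ($\Pi_0,\Pi_1$ identities, $\Pi_4=0$). For a bundle $W$ with connection, $\mathcal C^k(W)=\Gamma(\Lambda^k_{\rm can}T^*Y\otimes W)$. With $E=\operatorname{End}_0(TY)$ the trace-free endomorphism bundle, $G_0^\bullet=\mathcal C^\bullet(T^*Y)$ has differential $d_0^k=\Pi_{k+1}\mathrm d_\nabla$ and $E^\bullet=\mathcal C^\bullet(E)$ has differential $e^k=\Pi_{k+1}\mathrm d_E$, where $\mathrm d_\nabla,\mathrm d_E$ are the exterior covariant derivatives induced by $\nabla$. Operators. For a $T^*Y$-valued form $m$ write $m_X=m(\cdot,X)$ for the evaluation of the $T^*Y$ factor on $X$. $\mathfrak f m=\sum_j(\iota_{e_j}R)\wedge m_{e_j}$, where $\iota_ZR$ is the $\operatorname{End}(TY)$-valued one-form $X\mapsto R(Z,X)$, and $f^k=\Pi_{k+1}\mathfrak f:G_0^k\to E^{k+1}$. For $m\in\Omega^p(Y,T^*Y)$, $\mathcal Km\in\Omega^p(Y,\mathfrak{so}(TY))\subset\Omega^p(Y,E)$ is $(\mathcal Km)(X,Y)=(\nabla_Ym)_X-(\nabla_Xm)_Y$, where a two-form $A$ is identified with the skew endomorphism $A^\sharp$ by $g(X,A^\sharp Y)=A(X,Y)$. Since $\nabla\Pi_k=0$, $\mathcal K$ commutes with the $\Pi_k$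 and restricts to $\mathcal K^k:G_0^k\to E^k$. *)

theory Defs
  imports "HOL-Analysis.Analysis"
begin

section \<open>Smooth seven-manifolds\<close>

type_synonym R7 = "real^7"
type_synonym 'y chart = "'y set \<times> ('y \<Rightarrow> R7)"

fun Ck_on :: "nat \<Rightarrow> R7 set \<Rightarrow> (R7 \<Rightarrow> 'b::real_normed_vector) \<Rightarrow> bool" where
  "Ck_on 0 S f \<longleftrightarrow> continuous_on S f"
| "Ck_on (Suc n) S f \<longleftrightarrow>
     (\<forall>x\<in>S. f differentiable (at x)) \<and> (\<forall>v. Ck_on n S (\<lambda>x. frechet_derivative f (at x) v))"

text \<open>Meant for open sets only.\<close>
definition smooth_on :: "R7 set \<Rightarrow> (R7 \<Rightarrow> 'b::real_normed_vector) \<Rightarrow> bool" where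
  "smooth_on S f \<longleftrightarrow> (\<forall>n. Ck_on n S f)"

definition chart_image :: "'y chart \<Rightarrow> R7 set" where
  "chart_image c = snd c ` fst c"

definition transition :: "'y chart \<Rightarrow> 'y chart \<Rightarrow> R7 \<Rightarrow> R7" where
  "transition c c' = snd c' \<circ> inv_into (fst c) (snd c)"

definition smooth_manifold :: "'y topology \<Rightarrow> 'y chart set \<Rightarrow> bool" where
  "smooth_manifold Y \<A> \<longleftrightarrow>
     Hausdorff_space Y \<and> second_countable Y \<and> topspace Y = (\<Union>c\<in>\<A>. fst c) \<and>
     (\<forall>c\<in>\<A>. openin Y (fst c) \<and> open (chart_image c) \<and>
        homeomorphic_map (subtopology Y (fst c)) (top_of_set (chart_image c)) (snd c)) \<and>
     (\<forall>c\<in>\<A>. \<forall>c'\<in>\<A>. smooth_on (snd c ` (fst c \<inter> fst c')) (transition c c'))"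

definition jacobian :: "'y chart \<Rightarrow> 'y chart \<Rightarrow> R7 \<Rightarrow> real^7^7" where
  "jacobian c c' x = matrix (frechet_derivative (transition c c') (at x))"


section \<open>Forms and tensor fields\<close>

text \<open>
  A tensor field is given by its components in every chart of the atlas, related by the tensor
  transformation law. In a chart, tangent vectors are elements of \<^typ>\<open>R7\<close>; a covector \<open>w\<close> is
  the vector of its components, so that it takes the value \<open>w \<bullet> v\<close> on \<open>v\<close>; an endomorphism is a
  matrix acting by \<open>*v\<close>. A \<open>W\<close>-valued \<open>k\<close>-form at a point is a function on lists of tangent
  vectors, by convention zero on lists whose length is not \<open>k\<close>.
\<close>

type_synonym 'w form = "R7 list \<Rightarrow> 'w"
type_synonym ('y, 't) field = "'y chart \<Rightarrow> R7 \<Rightarrow> 't"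
type_synonym bilin = "R7 \<Rightarrow> R7 \<Rightarrow> real"

definition alt_form :: "nat \<Rightarrow> 'w::real_vector form \<Rightarrow> bool" where
  "alt_form k \<alpha> \<longleftrightarrow>
     (\<forall>vs. length vs \<noteq> k \<longrightarrow> \<alpha> vs = 0) \<and>
     (\<forall>vs i. length vs = k \<and> i < k \<longrightarrow> linear (\<lambda>v. \<alpha> (vs[i := v]))) \<and>
     (\<forall>vs i j. length vs = k \<and> i < j \<and> j < k \<and> vs ! i = vs ! j \<longrightarrow> \<alpha> vs = 0)"

text \<open>
  Smooth sections of \<open>\<Lambda>\<^sup>k T\<^sup>*Y \<otimes> W\<close>. The parameter \<open>\<rho>\<close> describes \<open>W\<close>: \<open>\<rho> J\<close> turns components
  with respect to \<open>c'\<close> into components with respect to \<open>c\<close>, where \<open>J\<close> is the Jacobian of the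
  transition from \<open>c\<close> to \<open>c'\<close>.
\<close>
definition form_field ::
  "(real^7^7 \<Rightarrow> 'w \<Rightarrow> 'w) \<Rightarrow> 'y chart set \<Rightarrow> nat \<Rightarrow> ('y, 'w::real_normed_vector form) field \<Rightarrow> bool" where
  "form_field \<rho> \<A> k a \<longleftrightarrow>
     (\<forall>c\<in>\<A>. (\<forall>x\<in>chart_image c. alt_form k (a c x)) \<and>
            (\<forall>vs. smooth_on (chart_image c) (\<lambda>x. a c x vs))) \<and>
     (\<forall>c\<in>\<A>. \<forall>c'\<in>\<A>. \<forall>p\<in>fst c \<inter> fst c'. \<forall>vs.
        (let J = jacobian c c' (snd c p)
         in a c (snd c p) vs = \<rho> J (a c' (snd c' p) (map (\<lambda>v. J *v v) vs))))"

definition pull_scalar :: "real^7^7 \<Rightarrow> real \<Rightarrow> real" where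
  "pull_scalar J t = t"

definition pull_covector :: "real^7^7 \<Rightarrow> R7 \<Rightarrow> R7" where
  "pull_covector J w = transpose J *v w"

definition riemannian_metric :: "'y chart set \<Rightarrow> ('y, bilin) field \<Rightarrow> bool" where
  "riemannian_metric \<A> g \<longleftrightarrow>
     (\<forall>c\<in>\<A>. \<forall>x\<in>chart_image c. bilinear (g c x) \<and>
        (\<forall>u v. g c x u v = g c x v u) \<and> (\<forall>v. v \<noteq> 0 \<longrightarrow> g c x v v > 0)) \<and>
     (\<forall>c\<in>\<A>. \<forall>u v. smooth_on (chart_image c) (\<lambda>x. g c x u v)) \<and>
     (\<forall>c\<in>\<A>. \<forall>c'\<in>\<A>. \<forall>p\<in>fst c \<inter> fst c'. \<forall>u v.
        (let J = jacobian c c' (snd c p)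
         in g c (snd c p) u v = g c' (snd c' p) (J *v u) (J *v v)))"

definition remove_nth :: "nat \<Rightarrow> 'a list \<Rightarrow> 'a list" where
  "remove_nth i vs = take i vs @ drop (Suc i) vs"

text \<open>The form \<open>\<theta>\<^sub>1 \<and> \<dots> \<and> \<theta>\<^sub>k\<close> for covectors \<open>\<theta>\<^sub>1, \<dots>, \<theta>\<^sub>k\<close>.\<close>
definition wedge_covectors :: "R7 list \<Rightarrow> real form" where
  "wedge_covectors \<theta>s vs =
     (if length vs = length \<theta>s
      then \<Sum>\<pi> | \<pi> permutes {..<length \<theta>s}.
             of_int (sign \<pi>) * (\<Prod>i<length \<theta>s. \<theta>s ! i \<bullet> vs ! \<pi> i)
      else 0)"

text \<open>The wedge product of a one-form with a form, \<open>b\<close> being the product of the values.\<close>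
definition wedge_one ::
  "('a \<Rightarrow> 'b \<Rightarrow> 'w::real_vector) \<Rightarrow> (R7 \<Rightarrow> 'a) \<Rightarrow> 'b form \<Rightarrow> 'w form" where
  "wedge_one b \<beta> \<alpha> vs = (\<Sum>i<length vs. (-1) ^ i *\<^sub>R b (\<beta> (vs ! i)) (\<alpha> (remove_nth i vs)))"


section \<open>Metric linear algebra at a point\<close>

text \<open>An orthonormal basis. Everything defined through it is independent of the choice.\<close>
definition onb :: "bilin \<Rightarrow> 7 \<Rightarrow> R7" where
  "onb g = (SOME e. \<forall>i j. g (e i) (e j) = (if i = j then 1 else 0))"

definition form_inner :: "bilin \<Rightarrow> nat \<Rightarrow> real form \<Rightarrow> real form \<Rightarrow> real" where
  "form_inner g k \<alpha> \<beta> =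
     (1 / fact k) * (\<Sum>I | length I = k. \<alpha> (map (onb g) I) * \<beta> (map (onb g) I))"

text \<open>
  The Hodge star of a \<open>k\<close>-form. If \<open>vol = e\<^sup>1 \<and> \<dots> \<and> e\<^sup>7\<close> in an orthonormal coframe, then
  \<open>e\<^sup>1 \<and> \<dots> \<and> e\<^sup>k\<close> is sent to \<open>e\<^sup>k\<^sup>+\<^sup>1 \<and> \<dots> \<and> e\<^sup>7\<close>, i.e. \<open>\<alpha> \<and> *\<alpha> = |\<alpha>|\<^sup>2 vol\<close>.
\<close>
definition hodge_star :: "bilin \<Rightarrow> real form \<Rightarrow> nat \<Rightarrow> real form \<Rightarrow> real form" where
  "hodge_star g vol k \<alpha> ws =
     (1 / fact k) * (\<Sum>I | length I = k. \<alpha> (map (onb g) I) * vol (map (onb g) I @ ws))"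

text \<open>The skew endomorphism \<open>A\<^sup>\<sharp>\<close> of a two-form, \<open>g(X, A\<^sup>\<sharp> Y) = A(X, Y)\<close>.\<close>
definition sharp :: "bilin \<Rightarrow> bilin \<Rightarrow> real^7^7" where
  "sharp g A = (THE B. \<forall>X Y. g X (B *v Y) = A X Y)"


section \<open>The Levi-Civita connection\<close>

text \<open>
  In this section \<open>g\<close> is the metric in a fixed chart. The connection is
  \<open>(\<nabla>\<^sub>X Z)(x) = D Z(x)(X) + \<Gamma>(X, Z)\<close>, with \<open>\<Gamma>\<close> determined by vanishing torsion and \<open>\<nabla>g = 0\<close>.
\<close>
definition levi_civita :: "(R7 \<Rightarrow> bilin) \<Rightarrow> R7 \<Rightarrow> R7 \<Rightarrow> R7 \<Rightarrow> R7" where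
  "levi_civita g x = (THE \<Gamma>. bilinear \<Gamma> \<and> (\<forall>u v. \<Gamma> u v = \<Gamma> v u) \<and>
     (\<forall>u v w. frechet_derivative (\<lambda>y. g y v w) (at x) u = g x (\<Gamma> u v) w + g x v (\<Gamma> u w)))"

definition nabla :: "(R7 \<Rightarrow> bilin) \<Rightarrow> (R7 \<Rightarrow> R7) \<Rightarrow> (R7 \<Rightarrow> R7) \<Rightarrow> R7 \<Rightarrow> R7" where
  "nabla g X Z x = frechet_derivative Z (at x) (X x) + levi_civita g x (X x) (Z x)"

definition lie_bracket :: "(R7 \<Rightarrow> R7) \<Rightarrow> (R7 \<Rightarrow> R7) \<Rightarrow> R7 \<Rightarrow> R7" where
  "lie_bracket X Z x = frechet_derivative Z (at x) (X x) - frechet_derivative X (at x) (Z x)"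

definition curvature_fields ::
  "(R7 \<Rightarrow> bilin) \<Rightarrow> (R7 \<Rightarrow> R7) \<Rightarrow> (R7 \<Rightarrow> R7) \<Rightarrow> (R7 \<Rightarrow> R7) \<Rightarrow> R7 \<Rightarrow> R7" where
  "curvature_fields g X Z W x =
     nabla g X (nabla g Z W) x - nabla g Z (nabla g X W) x - nabla g (lie_bracket X Z) W x"

text \<open>\<open>R(u, v)\<close> as an endomorphism; being tensorial, it is computed on constant extensions.\<close>
definition riemann :: "(R7 \<Rightarrow> bilin) \<Rightarrow> R7 \<Rightarrow> R7 \<Rightarrow> R7 \<Rightarrow> real^7^7" where
  "riemann g x u v = matrix (\<lambda>w. curvature_fields g (\<lambda>_. u) (\<lambda>_. v) (\<lambda>_. w) x)"

text \<open>
  Connections on the coefficient bundles \<open>\<real>\<close>, \<open>T\<^sup>*Y\<close> and \<open>End(TY)\<close>, given by their connection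
  one-forms: \<open>\<nabla>\<^sub>v s = D s(v) + \<theta>(v) s\<close>.
\<close>
definition conn_trivial :: "R7 \<Rightarrow> R7 \<Rightarrow> real \<Rightarrow> real" where
  "conn_trivial x v t = 0"

definition conn_covector :: "(R7 \<Rightarrow> bilin) \<Rightarrow> R7 \<Rightarrow> R7 \<Rightarrow> R7 \<Rightarrow> R7" where
  "conn_covector g x v w = - (transpose (matrix (levi_civita g x v)) *v w)"

definition conn_End :: "(R7 \<Rightarrow> bilin) \<Rightarrow> R7 \<Rightarrow> R7 \<Rightarrow> real^7^7 \<Rightarrow> real^7^7" where
  "conn_End g x v A = matrix (levi_civita g x v) ** A - A ** matrix (levi_civita g x v)"

text \<open>Only the coefficients are differentiated covariantly; the form arguments \<open>vs\<close> are constant.\<close>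
definition coeff_deriv ::
  "(R7 \<Rightarrow> R7 \<Rightarrow> 'w \<Rightarrow> 'w) \<Rightarrow> (R7 \<Rightarrow> 'w::real_normed_vector form) \<Rightarrow> R7 \<Rightarrow> R7 \<Rightarrow> 'w form" where
  "coeff_deriv \<theta> \<alpha> x v vs = frechet_derivative (\<lambda>y. \<alpha> y vs) (at x) v + \<theta> x v (\<alpha> x vs)"

text \<open>The exterior covariant derivative \<open>d + \<theta> \<and> _\<close>.\<close>
definition ext_cov_deriv ::
  "(R7 \<Rightarrow> R7 \<Rightarrow> 'w \<Rightarrow> 'w) \<Rightarrow> (R7 \<Rightarrow> 'w::real_normed_vector form) \<Rightarrow> R7 \<Rightarrow> 'w form" where
  "ext_cov_deriv \<theta> \<alpha> x vs =
     (\<Sum>i<length vs. (-1) ^ i *\<^sub>R coeff_deriv \<theta> \<alpha> x (vs ! i) (remove_nth i vs))"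

text \<open>The covariant derivative on \<open>\<Lambda>\<^sup>k T\<^sup>*Y \<otimes> W\<close>, using Levi-Civita on the form part as well.\<close>
definition nabla_form ::
  "(R7 \<Rightarrow> bilin) \<Rightarrow> (R7 \<Rightarrow> R7 \<Rightarrow> 'w \<Rightarrow> 'w) \<Rightarrow> (R7 \<Rightarrow> 'w::real_normed_vector form) \<Rightarrow>
     R7 \<Rightarrow> R7 \<Rightarrow> 'w form" where
  "nabla_form g \<theta> \<alpha> x v vs =
     coeff_deriv \<theta> \<alpha> x v vs - (\<Sum>i<length vs. \<alpha> x (vs[i := levi_civita g x v (vs ! i)]))"


section \<open>Torsion-free \<open>G\<^sub>2\<close> structures\<close>

text \<open>In the type \<^typ>\<open>7\<close> the index \<open>7\<close> is the same as \<open>0\<close>; the indices \<open>1, \<dots>, 7\<close> are distinct.\<close>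
definition standard_three_form :: "(7 \<Rightarrow> R7) \<Rightarrow> real form" where
  "standard_three_form e vs =
     wedge_covectors [e 1, e 2, e 3] vs + wedge_covectors [e 1, e 4, e 5] vs
   + wedge_covectors [e 1, e 6, e 7] vs + wedge_covectors [e 2, e 4, e 6] vs
   - wedge_covectors [e 2, e 5, e 7] vs - wedge_covectors [e 3, e 4, e 7] vs
   - wedge_covectors [e 3, e 5, e 6] vs"

text \<open>
  \<open>\<phi>\<close> is a positive three-form with associated metric \<open>g\<close> and orientation, the latter encoded by
  the Riemannian volume form \<open>vol\<close>; both are uniquely determined by \<open>\<phi>\<close>. The functions \<open>e y i\<close>
  are the members of a local oriented orthonormal coframe.
\<close>
definition G2_structure ::
  "'y chart set \<Rightarrow> ('y, real form) field \<Rightarrow> ('y, bilin) field \<Rightarrow> ('y, real form) field \<Rightarrow> bool" where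
  "G2_structure \<A> \<phi> g vol \<longleftrightarrow>
     form_field pull_scalar \<A> 3 \<phi> \<and> riemannian_metric \<A> g \<and> form_field pull_scalar \<A> 7 vol \<and>
     (\<forall>c\<in>\<A>. \<forall>x\<in>chart_image c. \<exists>V e. open V \<and> x \<in> V \<and> V \<subseteq> chart_image c \<and>
        (\<forall>i. smooth_on V (\<lambda>y. e y i)) \<and>
        (\<forall>y\<in>V. (\<forall>u v. g c y u v = (\<Sum>i\<in>UNIV. (e y i \<bullet> u) * (e y i \<bullet> v))) \<and>
               vol c y = wedge_covectors [e y 1, e y 2, e y 3, e y 4, e y 5, e y 6, e y 7] \<and>
               \<phi> c y = standard_three_form (e y)))"

definition torsion_free ::
  "'y chart set \<Rightarrow> ('y, real form) field \<Rightarrow> ('y, bilin) field \<Rightarrow> ('y, real form) field \<Rightarrow> bool" where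
  "torsion_free \<A> \<phi> g vol \<longleftrightarrow>
     (let \<psi> = (\<lambda>c x. hodge_star (g c x) (vol c x) 3 (\<phi> c x))
      in \<forall>c\<in>\<A>. \<forall>x\<in>chart_image c.
           ext_cov_deriv conn_trivial (\<phi> c) x = (\<lambda>_. 0) \<and>
           ext_cov_deriv conn_trivial (\<psi> c) x = (\<lambda>_. 0))"


section \<open>Canonical cochains and the operators\<close>

text \<open>\<open>\<Lambda>\<^sup>k\<^sub>c\<^sub>a\<^sub>n\<close> at a point, where \<open>\<phi>\<close> is the value of the three-form there.\<close>
definition can_forms :: "real form \<Rightarrow> nat \<Rightarrow> real form set" where
  "can_forms \<phi> k =
     (if k \<le> 1 then {\<alpha>. alt_form k \<alpha>}
      else if k = 2 then {\<lambda>vs. \<phi> (X # vs) | X. True}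
      else if k = 3 then {\<lambda>vs. t * \<phi> vs | t. True}
      else {\<lambda>_. 0})"

text \<open>The orthogonal projection onto \<open>\<Lambda>\<^sup>k\<^sub>c\<^sub>a\<^sub>n\<close>, first for real and then for \<open>W\<close>-valued forms.\<close>
definition can_proj_real :: "bilin \<Rightarrow> real form \<Rightarrow> nat \<Rightarrow> real form \<Rightarrow> real form" where
  "can_proj_real g \<phi> k \<alpha> =
     (THE \<beta>. \<beta> \<in> can_forms \<phi> k \<and>
        (\<forall>\<gamma>\<in>can_forms \<phi> k. form_inner g k (\<lambda>vs. \<alpha> vs - \<beta> vs) \<gamma> = 0))"

definition can_proj ::
  "bilin \<Rightarrow> real form \<Rightarrow> nat \<Rightarrow> 'w::euclidean_space form \<Rightarrow> 'w form" where
  "can_proj g \<phi> k \<alpha> vs = (\<Sum>b\<in>Basis. can_proj_real g \<phi> k (\<lambda>us. \<alpha> us \<bullet> b) vs *\<^sub>R b)"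

text \<open>\<open>G\<^sub>0\<^sup>k\<close>, the smooth sections of \<open>\<Lambda>\<^sup>k\<^sub>c\<^sub>a\<^sub>n \<otimes> T\<^sup>*Y\<close>.\<close>
definition G0_cochains ::
  "'y chart set \<Rightarrow> ('y, real form) field \<Rightarrow> nat \<Rightarrow> ('y, R7 form) field set" where
  "G0_cochains \<A> \<phi> k =
     {m. form_field pull_covector \<A> k m \<and>
         (\<forall>c\<in>\<A>. \<forall>x\<in>chart_image c. \<forall>v. (\<lambda>vs. m c x vs \<bullet> v) \<in> can_forms (\<phi> c x) k)}"

definition d0 ::
  "('y, real form) field \<Rightarrow> ('y, bilin) field \<Rightarrow> nat \<Rightarrow> ('y, R7 form) field \<Rightarrow> ('y, R7 form) field" where
  "d0 \<phi> g k m c x =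
     can_proj (g c x) (\<phi> c x) (Suc k) (ext_cov_deriv (conn_covector (g c)) (m c) x)"

definition dE ::
  "('y, real form) field \<Rightarrow> ('y, bilin) field \<Rightarrow> nat \<Rightarrow>
     ('y, (real^7^7) form) field \<Rightarrow> ('y, (real^7^7) form) field" where
  "dE \<phi> g k a c x =
     can_proj (g c x) (\<phi> c x) (Suc k) (ext_cov_deriv (conn_End (g c)) (a c) x)"

text \<open>\<open>\<Sum>\<^sub>j (\<iota>\<^bsub>e\<^sub>j\<^esub> R) \<and> m\<^bsub>e\<^sub>j\<^esub>\<close>\<close>
definition curv_insert ::
  "('y, bilin) field \<Rightarrow> ('y, R7 form) field \<Rightarrow> ('y, (real^7^7) form) field" where
  "curv_insert g m c x vs =
     (\<Sum>j\<in>UNIV. let e = onb (g c x) j in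
        wedge_one (\<lambda>A t. t *\<^sub>R A) (\<lambda>X. riemann (g c) x e X) (\<lambda>us. m c x us \<bullet> e) vs)"

definition f_can ::
  "('y, real form) field \<Rightarrow> ('y, bilin) field \<Rightarrow> nat \<Rightarrow>
     ('y, R7 form) field \<Rightarrow> ('y, (real^7^7) form) field" where
  "f_can \<phi> g k m c x = can_proj (g c x) (\<phi> c x) (Suc k) (curv_insert g m c x)"

definition skew_deriv ::
  "('y, bilin) field \<Rightarrow> ('y, R7 form) field \<Rightarrow> ('y, (real^7^7) form) field" where
  "skew_deriv g m c x vs =
     sharp (g c x) (\<lambda>X Z. nabla_form (g c) (conn_covector (g c)) (m c) x Z vs \<bullet> X
                        - nabla_form (g c) (conn_covector (g c)) (m c) x X vs \<bullet> Z)"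

text \<open>The degree-\<open>k\<close> part of \<open>\<K>\<close> on canonical cochains, which vanish in degrees above \<open>3\<close>.\<close>
definition K_can ::
  "('y, bilin) field \<Rightarrow> nat \<Rightarrow> ('y, R7 form) field \<Rightarrow> ('y, (real^7^7) form) field" where
  "K_can g k m = (if k \<le> 3 then skew_deriv g m else (\<lambda>c x vs. 0))"

end

theory Submission
  imports Defs
begin

text \<open>
  Everything happens near one point of one chart, on a domain \<open>V\<close> that carries an adapted coframe.
  Lower all indices: a \<open>T\<^sup>*Y\<close>-valued \<open>k\<close>-form \<open>m\<close> becomes a covariant tensor \<open>M\<close> with a coefficient
  slot and \<open>k\<close> form slots, and endomorphisms become bilinear forms. Because the Levi-Civita
  connection is torsion-free, every exterior covariant derivative is an alternating sum of full
  covariant derivatives (\<open>torsion_terms_cancel\<close>). Before any projection, \<open>\<K> d\<^sub>\<nabla> m - d\<^sub>E \<K> m\<close> is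
  therefore an alternating sum of commutators of second covariant derivatives of \<open>M\<close>, and the Ricci
  identity (\<open>ricci_identity\<close>) turns it into curvature terms of two kinds. Those in which the curvature
  acts on the coefficient slot add up to the curvature insertion, by the first Bianchi identity and
  the pair symmetry (\<open>curvature_rearranged\<close>). Those in which it acts on the form slots reduce, again
  by the Bianchi identity, to \<open>m\<close> with \<open>R(v\<^sub>i, v\<^sub>j) Z\<close> inserted for two form arguments.

  The \<open>G\<^sub>2\<close> geometry enters twice. First, \<open>\<phi>\<close> is parallel (\<open>phi_parallel\<close>): in an adapted frame the
  components of \<open>\<phi>\<close> and \<open>\<psi>\<close> are constant, so that \<open>d\<phi> = 0\<close> and \<open>d\<psi> = 0\<close> are linear equations for
  the connection form, and they force it into the stabiliser \<open>g\<^sub>2\<close> of \<open>\<phi>\<close> (\<open>torsion_vanishes\<close>).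
  Consequently the projections \<open>\<Pi>\<^sub>k\<close>, which are contractions with \<open>\<phi>\<close>, commute with covariant
  differentiation (\<open>cov_proj\<close>), and \<open>\<K>\<close> may be applied before projecting. Second, the curvature
  annihilates \<open>\<phi>\<close>, so \<open>R(u, v)\<close> lies in \<open>g\<^sub>2 = \<Lambda>\<^sup>2\<^sub>1\<^sub>4\<close>; by the pair symmetry the same holds for its two
  form indices, and the contraction of \<open>R(v\<^sub>i, v\<^sub>j)\<close> with \<open>\<phi>\<close> vanishes (\<open>curvature_form_part\<close>). So
  the projections kill the terms on the form slots (\<open>residual_killed\<close>), and only the curvature
  insertion remains (\<open>local_identity\<close>). In degree \<open>3\<close> all maps vanish because \<open>\<Lambda>\<^sup>4\<^sub>c\<^sub>a\<^sub>n = 0\<close>.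
\<close>

abbreviation D :: "(R7 \<Rightarrow> 'a::real_normed_vector) \<Rightarrow> R7 \<Rightarrow> R7 \<Rightarrow> 'a" where
  "D f x \<equiv> frechet_derivative f (at x)"

section \<open>Symmetry of second derivatives\<close>

lemma Ck_on_mono: "Ck_on n S f \<Longrightarrow> T \<subseteq> S \<Longrightarrow> Ck_on n T f"
  by (induction n arbitrary: f) (auto intro: continuous_on_subset)

lemma D_has_derivative:
  "f differentiable (at x) \<Longrightarrow> (f has_derivative D f x) (at x)"
  by (simp add: frechet_derivative_works)

lemma D_eqI: "(f has_derivative f') (at x) \<Longrightarrow> D f x v = f' v"
  using frechet_derivative_at by metis

lemma D_cong:
  assumes "open S" "x \<in> S" "\<And>y. y \<in> S \<Longrightarrow> f y = h y"
  shows "D f x v = D h x v"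
proof -
  have "(f has_derivative f') (at x) \<longleftrightarrow> (h has_derivative f') (at x)" for f'
    using assms has_derivative_transform_within_open[of f f' x UNIV S h]
      has_derivative_transform_within_open[of h f' x UNIV S f] by auto
  then show ?thesis by (simp add: frechet_derivative_def)
qed

lemma differentiable_cong_open:
  assumes "open S" "x \<in> S" "\<And>y. y \<in> S \<Longrightarrow> f y = h y" "h differentiable (at x)"
  shows "f differentiable (at x)"
  using assms has_derivative_transform_within_open[of h _ x UNIV S f]
  unfolding differentiable_def by metis

text \<open>
  The mean value theorem is applied first along \<open>u\<close> and then along \<open>v\<close>. The second difference on
  the left is symmetric in \<open>u\<close> and \<open>v\<close>, so it is a value of either mixed derivative; as both are
  continuous, shrinking \<open>\<delta>\<close> shows that they agree.
\<close>
lemma mixed_difference: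
  fixes f :: "R7 \<Rightarrow> real"
  assumes S: "Ck_on 2 S f" and \<delta>: "\<delta> > 0"
    and inS: "\<And>s t. \<lbrakk>0 \<le> s; s \<le> \<delta>; 0 \<le> t; t \<le> \<delta>\<rbrakk> \<Longrightarrow> x + s *\<^sub>R u + t *\<^sub>R v \<in> S"
  obtains s t where "0 \<le> s" "s \<le> \<delta>" "0 \<le> t" "t \<le> \<delta>"
    "f (x + \<delta> *\<^sub>R u + \<delta> *\<^sub>R v) - f (x + \<delta> *\<^sub>R u) - f (x + \<delta> *\<^sub>R v) + f x
      = \<delta> * \<delta> * D (\<lambda>y. D f y u) (x + s *\<^sub>R u + t *\<^sub>R v) v"
proof -
  have C: "\<And>y. y \<in> S \<Longrightarrow> f differentiable (at y)"
    "\<And>y w. y \<in> S \<Longrightarrow> (\<lambda>z. D f z w) differentiable (at y)"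
    using S by (auto simp: numeral_2_eq_2)
  have deriv: "((\<lambda>s. h (a + s *\<^sub>R w)) has_derivative (\<lambda>r. r * D h (a + s *\<^sub>R w) w)) (at s)"
    if "h differentiable (at (a + s *\<^sub>R w))" for h :: "R7 \<Rightarrow> real" and a w s
  proof -
    have 1: "(h has_derivative D h (a + s *\<^sub>R w)) (at (a + s *\<^sub>R w))"
      using that D_has_derivative by blast
    have 2: "((\<lambda>s. a + s *\<^sub>R w) has_derivative (\<lambda>r. r *\<^sub>R w)) (at s)"
      by (auto intro!: derivative_eq_intros)
    have "(h \<circ> (\<lambda>s. a + s *\<^sub>R w) has_derivative D h (a + s *\<^sub>R w) \<circ> (\<lambda>r. r *\<^sub>R w)) (at s)"
      by (rule diff_chain_at[OF 2 1])
    moreover have "D h (a + s *\<^sub>R w) (r *\<^sub>R w) = r * D h (a + s *\<^sub>R w) w" for r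
      using linear_scale[OF linear_frechet_derivative[OF that]] by simp
    ultimately show ?thesis by (simp add: o_def)
  qed
  define h where "h s = f ((x + \<delta> *\<^sub>R v) + s *\<^sub>R u) - f (x + s *\<^sub>R u)" for s
  have "\<exists>s. 0 < s \<and> s < \<delta> \<and> h \<delta> - h 0 =
      (\<lambda>s r. r * D f ((x + \<delta> *\<^sub>R v) + s *\<^sub>R u) u - r * D f (x + s *\<^sub>R u) u) s (\<delta> - 0)"
  proof (rule mvt_simple[OF \<delta>, of h, THEN bexE])
    fix s assume "0 \<le> s" "s \<le> \<delta>"
    then have "x + s *\<^sub>R u + \<delta> *\<^sub>R v \<in> S" "x + s *\<^sub>R u + 0 *\<^sub>R v \<in> S"
      using inS \<delta> by (meson less_imp_le order_refl)+
    then have "(x + \<delta> *\<^sub>R v) + s *\<^sub>R u \<in> S" "x + s *\<^sub>R u \<in> S"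
      by (simp_all add: algebra_simps)
    then have "(h has_derivative
        (\<lambda>s r. r * D f ((x + \<delta> *\<^sub>R v) + s *\<^sub>R u) u - r * D f (x + s *\<^sub>R u) u) s) (at s)"
      unfolding h_def by (intro has_derivative_diff deriv C)
    then show "(h has_derivative
        (\<lambda>s r. r * D f ((x + \<delta> *\<^sub>R v) + s *\<^sub>R u) u - r * D f (x + s *\<^sub>R u) u) s) (at s within {0..\<delta>})"
      by (rule has_derivative_at_withinI)
  qed auto
  then obtain s where s: "0 < s" "s < \<delta>" and hs:
    "h \<delta> - h 0 = \<delta> * (D f ((x + \<delta> *\<^sub>R v) + s *\<^sub>R u) u - D f (x + s *\<^sub>R u) u)"
    by (auto simp: algebra_simps)
  define k where "k t = D f ((x + s *\<^sub>R u) + t *\<^sub>R v) u" for t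
  have "\<exists>t. 0 < t \<and> t < \<delta> \<and> k \<delta> - k 0 =
      (\<lambda>t r. r * D (\<lambda>y. D f y u) ((x + s *\<^sub>R u) + t *\<^sub>R v) v) t (\<delta> - 0)"
  proof (rule mvt_simple[OF \<delta>, of k, THEN bexE])
    fix t assume "0 \<le> t" "t \<le> \<delta>"
    then have "x + s *\<^sub>R u + t *\<^sub>R v \<in> S" using inS s by simp
    then have "(k has_derivative
        (\<lambda>t r. r * D (\<lambda>y. D f y u) ((x + s *\<^sub>R u) + t *\<^sub>R v) v) t) (at t)"
      unfolding k_def by (intro deriv[of "\<lambda>y. D f y u"] C)
    then show "(k has_derivative
        (\<lambda>t r. r * D (\<lambda>y. D f y u) ((x + s *\<^sub>R u) + t *\<^sub>R v) v) t) (at t within {0..\<delta>})"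
      by (rule has_derivative_at_withinI)
  qed auto
  then obtain t where t: "0 < t" "t < \<delta>" and kt:
    "k \<delta> - k 0 = \<delta> * D (\<lambda>y. D f y u) ((x + s *\<^sub>R u) + t *\<^sub>R v) v"
    by auto
  have "f (x + \<delta> *\<^sub>R u + \<delta> *\<^sub>R v) - f (x + \<delta> *\<^sub>R u) - f (x + \<delta> *\<^sub>R v) + f x = h \<delta> - h 0"
    by (simp add: h_def algebra_simps)
  also have "\<dots> = \<delta> * (k \<delta> - k 0)"
    by (simp add: hs k_def algebra_simps)
  finally show ?thesis using s t kt by (intro that[of s t]) auto
qed

lemma second_derivative_symmetric:
  fixes f :: "R7 \<Rightarrow> real"
  assumes S: "open S" "Ck_on 2 S f" "x \<in> S"
  shows "D (\<lambda>y. D f y v) x u = D (\<lambda>y. D f y u) x v"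
proof (rule ccontr)
  let ?F = "\<lambda>u v y. D (\<lambda>z. D f z v) y u"
  assume ne: "?F u v x \<noteq> ?F v u x"
  define \<epsilon> where "\<epsilon> = \<bar>?F u v x - ?F v u x\<bar> / 2"
  have \<epsilon>: "\<epsilon> > 0" using ne by (simp add: \<epsilon>_def)
  have cont: "continuous_on S (?F u v)" for u v
    using S by (simp add: numeral_2_eq_2)
  have near: "\<exists>r>0. ball x r \<subseteq> S \<and> (\<forall>y\<in>ball x r. \<bar>?F u v y - ?F u v x\<bar> < \<epsilon>)" for u v
  proof -
    obtain r1 where r1: "r1 > 0" "ball x r1 \<subseteq> S" using S openE by blast
    have "isCont (?F u v) x" using cont S continuous_on_eq_continuous_at by blast
    then obtain r2 where r2: "r2 > 0" "\<And>y. dist y x < r2 \<Longrightarrow> dist (?F u v y) (?F u v x) < \<epsilon>"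
      unfolding continuous_at_eps_delta using \<epsilon> by blast
    show ?thesis
      using r1 r2 by (intro exI[of _ "min r1 r2"]) (auto simp: dist_real_def dist_commute)
  qed
  obtain r where r: "r > 0" "ball x r \<subseteq> S" "\<And>y. y \<in> ball x r \<Longrightarrow> \<bar>?F u v y - ?F u v x\<bar> < \<epsilon>"
      "\<And>y. y \<in> ball x r \<Longrightarrow> \<bar>?F v u y - ?F v u x\<bar> < \<epsilon>"
  proof -
    obtain r1 where "r1 > 0" "ball x r1 \<subseteq> S" "\<And>y. y \<in> ball x r1 \<Longrightarrow> \<bar>?F u v y - ?F u v x\<bar> < \<epsilon>"
      using near by blast
    moreover obtain r2 where "r2 > 0" "\<And>y. y \<in> ball x r2 \<Longrightarrow> \<bar>?F v u y - ?F v u x\<bar> < \<epsilon>"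
      using near by blast
    moreover have "ball x (min r1 r2) \<subseteq> ball x r1" "ball x (min r1 r2) \<subseteq> ball x r2" by auto
    ultimately show ?thesis by (intro that[of "min r1 r2"]) auto
  qed
  define \<delta> where "\<delta> = r / (2 * (norm u + norm v + 1))"
  have \<delta>: "\<delta> > 0" using r by (simp add: \<delta>_def add_nonneg_pos)
  have inb: "x + s *\<^sub>R u + t *\<^sub>R v \<in> ball x r"
    if "0 \<le> s" "s \<le> \<delta>" "0 \<le> t" "t \<le> \<delta>" for s t
  proof -
    have "norm (s *\<^sub>R u + t *\<^sub>R v) \<le> s * norm u + t * norm v"
      using norm_triangle_ineq[of "s *\<^sub>R u" "t *\<^sub>R v"] that by simp
    also have "\<dots> \<le> \<delta> * norm u + \<delta> * norm v"
      using that by (intro add_mono mult_right_mono) auto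
    also have "\<dots> \<le> \<delta> * (norm u + norm v + 1)"
      using \<delta> by (simp add: algebra_simps)
    also have "\<dots> = r / 2"
    proof -
      have "norm u + norm v + 1 \<noteq> 0" by (smt (verit) norm_ge_zero)
      moreover have "N \<noteq> 0 \<Longrightarrow> r / (2 * N) * N = r / 2" for N by simp
      ultimately show ?thesis unfolding \<delta>_def by blast
    qed
    also have "\<dots> < r" using r by simp
    finally have "dist x (x + (s *\<^sub>R u + t *\<^sub>R v)) < r"
      using norm_minus_cancel[of "s *\<^sub>R u + t *\<^sub>R v"] by (simp add: dist_norm)
    then show ?thesis by (simp add: add.assoc)
  qed
  have inb': "x + s *\<^sub>R v + t *\<^sub>R u \<in> ball x r"
    if "0 \<le> s" "s \<le> \<delta>" "0 \<le> t" "t \<le> \<delta>" for s t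
    using inb[of t s] that by (simp add: algebra_simps)
  obtain s t where 1: "0 \<le> s" "s \<le> \<delta>" "0 \<le> t" "t \<le> \<delta>"
    "f (x + \<delta> *\<^sub>R u + \<delta> *\<^sub>R v) - f (x + \<delta> *\<^sub>R u) - f (x + \<delta> *\<^sub>R v) + f x
      = \<delta> * \<delta> * ?F v u (x + s *\<^sub>R u + t *\<^sub>R v)"
    using mixed_difference[OF S(2) \<delta>, of x u v] inb r(2) by blast
  obtain s' t' where 2: "0 \<le> s'" "s' \<le> \<delta>" "0 \<le> t'" "t' \<le> \<delta>"
    "f (x + \<delta> *\<^sub>R v + \<delta> *\<^sub>R u) - f (x + \<delta> *\<^sub>R v) - f (x + \<delta> *\<^sub>R u) + f x
      = \<delta> * \<delta> * ?F u v (x + s' *\<^sub>R v + t' *\<^sub>R u)"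
    using mixed_difference[OF S(2) \<delta>, of x v u] inb' r(2) by blast
  have "\<delta> * \<delta> * ?F v u (x + s *\<^sub>R u + t *\<^sub>R v) = \<delta> * \<delta> * ?F u v (x + s' *\<^sub>R v + t' *\<^sub>R u)"
    using 1(5) 2(5) by (simp add: algebra_simps)
  then have "?F v u (x + s *\<^sub>R u + t *\<^sub>R v) = ?F u v (x + s' *\<^sub>R v + t' *\<^sub>R u)"
    using \<delta> by simp
  moreover have "\<bar>?F v u (x + s *\<^sub>R u + t *\<^sub>R v) - ?F v u x\<bar> < \<epsilon>"
    using r(4) inb 1 by blast
  moreover have "\<bar>?F u v (x + s' *\<^sub>R v + t' *\<^sub>R u) - ?F u v x\<bar> < \<epsilon>"
    using r(3) inb' 2 by blast
  moreover have "\<not> (p = q \<and> \<bar>p - b\<bar> < \<bar>a - b\<bar> / 2 \<and> \<bar>q - a\<bar> < \<bar>a - b\<bar> / 2)" for p q a b :: real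
    by (auto simp: abs_if split: if_splits)
  ultimately show False unfolding \<epsilon>_def by blast
qed

section \<open>Multilinear tensors and the Leibniz rule\<close>

text \<open>
  Lists of a length other than \<open>n\<close> are not constrained, in contrast to \<^const>\<open>alt_form\<close>.
\<close>
definition multilin :: "nat \<Rightarrow> real form \<Rightarrow> bool" where
  "multilin n T \<longleftrightarrow> (\<forall>vs i. length vs = n \<and> i < n \<longrightarrow> linear (\<lambda>v. T (vs[i := v])))"

lemma alt_form_multilin: "alt_form n T \<Longrightarrow> multilin n T"
  by (simp add: alt_form_def multilin_def)

lemma multilin_update:
  "multilin n T \<Longrightarrow> length vs = n \<Longrightarrow> i < n \<Longrightarrow> linear (\<lambda>v. T (vs[i := v]))"
  by (simp add: multilin_def)

lemma multilin_append:
  assumes "multilin n T" "Suc (length xs + length ys) = n"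
  shows "linear (\<lambda>v. T (xs @ v # ys))"
  using multilin_update[OF assms(1), of "xs @ 0 # ys" "length xs"] assms(2) by simp

lemma linear_basis_expansion:
  fixes f :: "'a::euclidean_space \<Rightarrow> 'b::real_vector"
  assumes "linear f"
  shows "f w = (\<Sum>b\<in>Basis. (w \<bullet> b) *\<^sub>R f b)"
proof -
  have "f w = f (\<Sum>b\<in>Basis. (w \<bullet> b) *\<^sub>R b)" by (simp add: euclidean_representation)
  also have "\<dots> = (\<Sum>b\<in>Basis. (w \<bullet> b) *\<^sub>R f b)"
    by (simp add: linear_sum[OF assms] linear_scale[OF assms])
  finally show ?thesis .
qed

definition C1_tensor :: "R7 set \<Rightarrow> nat \<Rightarrow> (R7 \<Rightarrow> real form) \<Rightarrow> bool" where
  "C1_tensor V n T \<longleftrightarrow> (\<forall>y\<in>V. multilin n (T y) \<and>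
     (\<forall>vs. length vs = n \<longrightarrow> (\<lambda>z. T z vs) differentiable (at y)))"

definition C2_tensor :: "R7 set \<Rightarrow> nat \<Rightarrow> (R7 \<Rightarrow> real form) \<Rightarrow> bool" where
  "C2_tensor V n T \<longleftrightarrow> (\<forall>y\<in>V. multilin n (T y)) \<and>
     (\<forall>vs. length vs = n \<longrightarrow> Ck_on 2 V (\<lambda>z. T z vs))"

lemma C2_imp_C1: "C2_tensor V n T \<Longrightarrow> C1_tensor V n T"
  by (auto simp: C2_tensor_def C1_tensor_def numeral_2_eq_2)

lemma C1_multilin: "C1_tensor V n T \<Longrightarrow> y \<in> V \<Longrightarrow> multilin n (T y)"
  by (simp add: C1_tensor_def)

lemma C1_differentiable:
  "C1_tensor V n T \<Longrightarrow> y \<in> V \<Longrightarrow> length vs = n \<Longrightarrow> (\<lambda>z. T z vs) differentiable (at y)"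
  by (simp add: C1_tensor_def)

lemma D_add: "f differentiable (at x) \<Longrightarrow> h differentiable (at x) \<Longrightarrow>
    D (\<lambda>y. f y + h y) x v = D f x v + D h x v"
  by (rule D_eqI) (auto intro!: derivative_eq_intros D_has_derivative)

lemma D_diff: "f differentiable (at x) \<Longrightarrow> h differentiable (at x) \<Longrightarrow>
    D (\<lambda>y. f y - h y) x v = D f x v - D h x v"
  by (rule D_eqI) (auto intro!: derivative_eq_intros D_has_derivative)

lemma D_cmult: "f differentiable (at x) \<Longrightarrow> D (\<lambda>y. c * f y) x v = (c::real) * D f x v"
  by (rule D_eqI) (auto intro!: derivative_eq_intros D_has_derivative)

lemma D_mult: "f differentiable (at x) \<Longrightarrow> h differentiable (at x) \<Longrightarrow>
    D (\<lambda>y. f y * (h y :: real)) x v = f x * D h x v + D f x v * h x"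
  by (rule D_eqI) (auto intro!: derivative_eq_intros D_has_derivative)

lemma D_linear: "f differentiable (at x) \<Longrightarrow> linear (D f x)"
  by (rule linear_frechet_derivative)

lemma linear_D_tensor:
  assumes V: "open V" "x \<in> V" and T: "C1_tensor V n T" and i: "length vs = n" "i < n"
  shows "linear (\<lambda>w. D (\<lambda>y. T y (vs[i := w])) x v)"
proof (rule linearI)
  have df: "(\<lambda>y. T y (vs[i := w])) differentiable (at x)" for w
    using C1_differentiable[OF T V(2)] i by simp
  have lin: "linear (\<lambda>w. T y (vs[i := w]))" if "y \<in> V" for y
    using multilin_update[OF C1_multilin[OF T that]] i by simp
  fix a b :: R7 and c :: real
  have "D (\<lambda>y. T y (vs[i := a + b])) x v = D (\<lambda>y. T y (vs[i := a]) + T y (vs[i := b])) x v"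
    by (rule D_cong[OF V]) (simp add: linear_add[OF lin])
  then show "D (\<lambda>y. T y (vs[i := a + b])) x v = D (\<lambda>y. T y (vs[i := a])) x v + D (\<lambda>y. T y (vs[i := b])) x v"
    by (simp add: D_add df)
  have "D (\<lambda>y. T y (vs[i := c *\<^sub>R a])) x v = D (\<lambda>y. c * T y (vs[i := a])) x v"
    by (rule D_cong[OF V]) (simp add: linear_scale[OF lin])
  then show "D (\<lambda>y. T y (vs[i := c *\<^sub>R a])) x v = c *\<^sub>R D (\<lambda>y. T y (vs[i := a])) x v"
    by (simp add: D_cmult df)
qed

lemma linear_D_tensor_append:
  assumes "open V" "x \<in> V" "C1_tensor V n T" "Suc (length xs + length ys) = n"
  shows "linear (\<lambda>w. D (\<lambda>y. T y (xs @ w # ys)) x v)"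
  using linear_D_tensor[OF assms(1-3), of "xs @ 0 # ys" "length xs"] assms(4) by simp

text \<open>
  Expanding one argument after the other in the standard basis replaces moving arguments by
  constant ones. The induction is over the moving arguments \<open>ss\<close>; the constant ones are collected
  in \<open>ws\<close>.
\<close>
lemma tensor_leibniz_aux:
  assumes V: "open V" "x \<in> V" and T: "C1_tensor V n T"
  shows "\<lbrakk>length ss + length ws = n; \<forall>s\<in>set ss. s differentiable (at x)\<rbrakk> \<Longrightarrow>
    ((\<lambda>y. T y (map (\<lambda>s. s y) ss @ ws)) has_derivative
      (\<lambda>v. D (\<lambda>y. T y (map (\<lambda>s. s x) ss @ ws)) x v
         + (\<Sum>i<length ss. T x ((map (\<lambda>s. s x) ss)[i := D (ss ! i) x v] @ ws)))) (at x)"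
proof (induction ss arbitrary: ws rule: rev_induct)
  case Nil
  then show ?case using D_has_derivative[OF C1_differentiable[OF T V(2)]] by simp
next
  case (snoc s ss)
  let ?A = "\<lambda>y. map (\<lambda>s. s y) ss"
  let ?IH = "\<lambda>b v. D (\<lambda>y. T y (?A x @ b # ws)) x v
         + (\<Sum>i<length ss. T x ((?A x)[i := D (ss ! i) x v] @ b # ws))"
  have len: "Suc (length ss + length ws) = n" using snoc.prems by simp
  have s: "s differentiable (at x)" using snoc.prems by simp
  have IH: "((\<lambda>y. T y (?A y @ b # ws)) has_derivative ?IH b) (at x)" for b
    using snoc.IH[of "b # ws"] snoc.prems by simp
  have lin: "linear (\<lambda>w. T y (zs @ w # ws))" if "y \<in> V" "length zs = length ss" for y zs
    using multilin_append[OF C1_multilin[OF T that(1)]] len that(2) by simp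
  have linD: "linear (\<lambda>w. D (\<lambda>y. T y (?A x @ w # ws)) x v)" for v
    using linear_D_tensor_append[OF V T] len by simp
  have lin_IH: "linear (\<lambda>w. ?IH w v)" for v
    by (intro linear_compose_add linear_compose_sum linD ballI lin V) simp
  have "((\<lambda>y. \<Sum>b\<in>Basis. (s y \<bullet> b) * T y (?A y @ b # ws)) has_derivative
      (\<lambda>v. \<Sum>b\<in>Basis. (s x \<bullet> b) * ?IH b v + (D s x v \<bullet> b) * T x (?A x @ b # ws))) (at x)"
    by (intro has_derivative_sum has_derivative_mult IH has_derivative_inner_left D_has_derivative s)
  then have "((\<lambda>y. T y (?A y @ s y # ws)) has_derivative
      (\<lambda>v. \<Sum>b\<in>Basis. (s x \<bullet> b) * ?IH b v + (D s x v \<bullet> b) * T x (?A x @ b # ws))) (at x)"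
  proof (rule has_derivative_transform_within_open[OF _ V])
    fix y assume "y \<in> V"
    then show "(\<Sum>b\<in>Basis. (s y \<bullet> b) * T y (?A y @ b # ws)) = T y (?A y @ s y # ws)"
      using linear_basis_expansion[OF lin, of y "?A y" "s y"] by simp
  qed
  moreover have "(\<Sum>b\<in>Basis. (s x \<bullet> b) * ?IH b v + (D s x v \<bullet> b) * T x (?A x @ b # ws))
     = ?IH (s x) v + T x (?A x @ D s x v # ws)" for v
    using linear_basis_expansion[OF lin_IH, of "s x" v]
      linear_basis_expansion[OF lin[OF V(2)], of "?A x" "D s x v"]
    by (simp add: sum.distrib)
  moreover have "(\<Sum>i<length (ss @ [s]). T x ((map (\<lambda>s. s x) (ss @ [s]))[i := D ((ss @ [s]) ! i) x v] @ ws))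
     = (\<Sum>i<length ss. T x ((?A x)[i := D (ss ! i) x v] @ s x # ws)) + T x (?A x @ D s x v # ws)" for v
    by (simp add: nth_append list_update_append)
  ultimately show ?case by (simp add: add.assoc)
qed

lemma tensor_leibniz:
  assumes "open V" "x \<in> V" "C1_tensor V n T" "length ss = n"
    and "\<And>i. i < n \<Longrightarrow> ss ! i differentiable (at x)"
  shows "((\<lambda>y. T y (map (\<lambda>s. s y) ss)) has_derivative
      (\<lambda>v. D (\<lambda>y. T y (map (\<lambda>s. s x) ss)) x v
         + (\<Sum>i<n. T x ((map (\<lambda>s. s x) ss)[i := D (ss ! i) x v])))) (at x)"
  using tensor_leibniz_aux[OF assms(1-3), of ss "[]"] assms(4,5) by (simp add: all_set_conv_all_nth)

lemma tensor_leibniz_update: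
  assumes V: "open V" "x \<in> V" and T: "C1_tensor V n T" "length vs = n" "i < n"
    and s: "s differentiable (at x)"
  shows "((\<lambda>y. T y (vs[i := s y])) has_derivative
      (\<lambda>v. D (\<lambda>y. T y (vs[i := s x])) x v + T x (vs[i := D s x v]))) (at x)"
proof -
  define ss where "ss = (map (\<lambda>w _. w) vs)[i := s]"
  have len: "length ss = n" using T by (simp add: ss_def)
  have nth: "ss ! j = (if j = i then s else (\<lambda>_. vs ! j))" if "j < n" for j
    using that T by (auto simp: ss_def nth_list_update)
  have map: "map (\<lambda>s. s y) ss = vs[i := s y]" for y
    using T len by (intro nth_equalityI) (auto simp: nth nth_list_update)
  have zero: "T x (vs[i := s x, j := 0]) = 0" if "j < n" for j
    using linear_0[OF multilin_update[OF C1_multilin[OF T(1) V(2)], of "vs[i := s x]" j]] T that by simp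
  have "(\<Sum>j<n. T x (vs[i := s x, j := D (ss ! j) x v])) = T x (vs[i := D s x v])" for v
  proof -
    have "(\<Sum>j<n. T x (vs[i := s x, j := D (ss ! j) x v]))
        = (\<Sum>j<n. if j = i then T x (vs[i := D s x v]) else 0)"
      by (rule sum.cong) (auto simp: nth zero)
    then show ?thesis using T by simp
  qed
  then show ?thesis
    using tensor_leibniz[OF V T(1) len] nth s by (simp add: map)
qed

section \<open>Covariant derivatives and the Ricci identity\<close>

text \<open>
  The covariant derivative of a covariant tensor; a coefficient in \<open>T\<^sup>*Y\<close> counts as one of the
  slots \<open>vs\<close>.
\<close>
definition cov :: "(R7 \<Rightarrow> R7 \<Rightarrow> R7 \<Rightarrow> R7) \<Rightarrow> (R7 \<Rightarrow> real form) \<Rightarrow> R7 \<Rightarrow> R7 \<Rightarrow> real form" where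
  "cov \<Gamma> T x v vs = D (\<lambda>y. T y vs) x v - (\<Sum>i<length vs. T x (vs[i := \<Gamma> x v (vs ! i)]))"

text \<open>
  The direction of differentiation becomes the first slot.
\<close>
definition nab :: "(R7 \<Rightarrow> R7 \<Rightarrow> R7 \<Rightarrow> R7) \<Rightarrow> (R7 \<Rightarrow> real form) \<Rightarrow> R7 \<Rightarrow> real form" where
  "nab \<Gamma> T x vs = cov \<Gamma> T x (hd vs) (tl vs)"

lemma nab_Cons [simp]: "nab \<Gamma> T x (v # vs) = cov \<Gamma> T x v vs"
  by (simp add: nab_def)

text \<open>
  The curvature \<open>R(u, v) w\<close> in coordinates.
\<close>
definition curv :: "(R7 \<Rightarrow> R7 \<Rightarrow> R7 \<Rightarrow> R7) \<Rightarrow> R7 \<Rightarrow> R7 \<Rightarrow> R7 \<Rightarrow> R7 \<Rightarrow> R7" where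
  "curv \<Gamma> x u v w = D (\<lambda>y. \<Gamma> y v w) x u - D (\<lambda>y. \<Gamma> y u w) x v + \<Gamma> x u (\<Gamma> x v w) - \<Gamma> x v (\<Gamma> x u w)"

text \<open>
  A torsion-free connection on the tangent bundle in coordinates.
\<close>
locale connection =
  fixes V :: "R7 set" and \<Gamma> :: "R7 \<Rightarrow> R7 \<Rightarrow> R7 \<Rightarrow> R7"
  assumes open_V: "open V"
    and bilinear_\<Gamma>: "y \<in> V \<Longrightarrow> bilinear (\<Gamma> y)"
    and \<Gamma>_commute: "y \<in> V \<Longrightarrow> \<Gamma> y u v = \<Gamma> y v u"
    and \<Gamma>_differentiable: "y \<in> V \<Longrightarrow> (\<lambda>z. \<Gamma> z u v) differentiable (at y)"
begin

lemma linear_\<Gamma>_left: "y \<in> V \<Longrightarrow> linear (\<lambda>u. \<Gamma> y u v)"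
  and linear_\<Gamma>_right: "y \<in> V \<Longrightarrow> linear (\<Gamma> y u)"
  using bilinear_\<Gamma> by (auto simp: bilinear_def)

text \<open>
  The Christoffel terms that turn the derivatives of the vector fields into covariant ones are
  those subtracted in \<^const>\<open>cov\<close>.
\<close>
lemma cov_leibniz:
  assumes x: "x \<in> V" and T: "C1_tensor V n T" "length ss = n"
    and s: "\<And>i. i < n \<Longrightarrow> ss ! i differentiable (at x)"
  shows "D (\<lambda>y. T y (map (\<lambda>s. s y) ss)) x v
    = cov \<Gamma> T x v (map (\<lambda>s. s x) ss)
      + (\<Sum>i<n. T x ((map (\<lambda>s. s x) ss)[i := D (ss ! i) x v + \<Gamma> x v ((ss ! i) x)]))"
proof -
  have "T x ((map (\<lambda>s. s x) ss)[i := D (ss ! i) x v + \<Gamma> x v ((ss ! i) x)])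
      = T x ((map (\<lambda>s. s x) ss)[i := D (ss ! i) x v])
        + T x ((map (\<lambda>s. s x) ss)[i := \<Gamma> x v ((ss ! i) x)])" if "i < n" for i
    using linear_add[OF multilin_update[OF C1_multilin[OF T(1) x], of "map (\<lambda>s. s x) ss" i]] that T(2)
    by simp
  then show ?thesis
    unfolding D_eqI[OF tensor_leibniz[OF open_V x T s], simplified]
    using T(2) by (simp add: cov_def sum.distrib)
qed

lemma multilin_nab:
  assumes y: "y \<in> V" and T1: "C1_tensor V n T"
  shows "multilin (Suc n) (nab \<Gamma> T y)"
proof -
  have ml: "multilin n (T y)" using T1 y by (rule C1_multilin)
  show ?thesis
    unfolding multilin_def
  proof (intro allI impI, elim conjE)
    fix vs :: "R7 list" and i assume "length vs = Suc n" "i < Suc n"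
    then obtain u ws where vs: "vs = u # ws" and len: "length ws = n" by (cases vs) auto
    show "linear (\<lambda>v. nab \<Gamma> T y (vs[i := v]))"
    proof (cases i)
      case 0
      have "linear (D (\<lambda>z. T z ws) y)"
        using D_linear[OF C1_differentiable[OF T1 y len]] .
      moreover have "linear (\<lambda>v. T y (ws[j := \<Gamma> y v (ws ! j)]))" if "j < n" for j
        using linear_compose[OF linear_\<Gamma>_left[OF y] multilin_update[OF ml len that]]
        by (simp add: o_def)
      ultimately show ?thesis
        by (simp add: vs 0 cov_def len linear_compose_sub linear_compose_sum)
    next
      case (Suc k)
      then have k: "k < n" using \<open>i < Suc n\<close> by simp
      have "linear (\<lambda>v. T y (ws[k := v, j := \<Gamma> y u (ws[k := v] ! j)]))" if j: "j < n" for j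
      proof (cases "j = k")
        case True
        then show ?thesis
          using linear_compose[OF linear_\<Gamma>_right[OF y] multilin_update[OF ml len k]] len k
          by (simp add: o_def)
      next
        case False
        then show ?thesis
          using multilin_update[OF ml, of "ws[j := \<Gamma> y u (ws ! j)]" k] len k
          by (simp add: list_update_swap)
      qed
      moreover have "linear (\<lambda>v. D (\<lambda>z. T z (ws[k := v])) y u)"
        by (rule linear_D_tensor[OF open_V y T1 len k])
      ultimately show ?thesis
        by (simp add: vs Suc cov_def len linear_compose_sub linear_compose_sum)
    qed
  qed
qed

lemma C1_nab:
  assumes T: "C2_tensor V n T"
  shows "C1_tensor V (Suc n) (nab \<Gamma> T)"
  unfolding C1_tensor_def
proof (intro ballI conjI allI impI)
  fix y assume y: "y \<in> V"
  have T1: "C1_tensor V n T" using T by (rule C2_imp_C1)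
  show "multilin (Suc n) (nab \<Gamma> T y)" by (rule multilin_nab[OF y T1])
  fix vs :: "R7 list" assume "length vs = Suc n"
  then obtain u ws where vs: "vs = u # ws" and len: "length ws = n" by (cases vs) auto
  have "(\<lambda>z. D (\<lambda>z. T z ws) z u) differentiable (at y)"
    using T len y by (auto simp: C2_tensor_def numeral_2_eq_2)
  moreover have "(\<lambda>z. T z (ws[j := \<Gamma> z u (ws ! j)])) differentiable (at y)" if "j < n" for j
    using tensor_leibniz_update[OF open_V y T1 len that \<Gamma>_differentiable[OF y]]
    unfolding differentiable_def by blast
  ultimately show "(\<lambda>z. nab \<Gamma> T z vs) differentiable (at y)"
    by (auto simp: vs cov_def len intro!: differentiable_diff differentiable_sum)
qed

text \<open>
  Expand the second covariant derivative. The second derivative of the components, the derivative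
  along \<open>\<Gamma>(u, v)\<close>, the terms with one derivative of \<open>T\<close> and one Christoffel symbol, and those with Christoffel symbols in two
  different slots are symmetric in \<open>u\<close> and \<open>v\<close>; they form the expression \<open>?S\<close> of the proof. The
  remaining terms change a single slot and combine to the curvature.
\<close>
theorem ricci_identity:
  assumes x: "x \<in> V" and T: "C2_tensor V n T" and len: "length vs = n"
  shows "nab \<Gamma> (nab \<Gamma> T) x (u # v # vs) - nab \<Gamma> (nab \<Gamma> T) x (v # u # vs)
    = - (\<Sum>i<n. T x (vs[i := curv \<Gamma> x u v (vs ! i)]))"
proof -
  have T1: "C1_tensor V n T" using T by (rule C2_imp_C1)
  have ml: "multilin n (T x)" using T1 x by (rule C1_multilin)
  let ?S = "\<lambda>u v. D (\<lambda>y. D (\<lambda>z. T z vs) y v) x u - cov \<Gamma> T x (\<Gamma> x u v) vs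
    - (\<Sum>i<n. D (\<lambda>y. T y (vs[i := \<Gamma> x v (vs ! i)])) x u)
    - (\<Sum>i<n. D (\<lambda>y. T y (vs[i := \<Gamma> x u (vs ! i)])) x v)
    + (\<Sum>i<n. \<Sum>j\<in>{..<n} - {i}. T x (vs[i := \<Gamma> x u (vs ! i), j := \<Gamma> x v (vs ! j)]))"
  have expand: "nab \<Gamma> (nab \<Gamma> T) x (u # v # vs)
     = ?S u v + (\<Sum>i<n. T x (vs[i := \<Gamma> x v (\<Gamma> x u (vs ! i))])
        - T x (vs[i := D (\<lambda>y. \<Gamma> y v (vs ! i)) x u]))" for u v
  proof -
    have 1: "D (\<lambda>y. nab \<Gamma> T y (v # vs)) x u
       = D (\<lambda>y. D (\<lambda>z. T z vs) y v) x u
         - (\<Sum>i<n. D (\<lambda>y. T y (vs[i := \<Gamma> x v (vs ! i)])) x u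
                 + T x (vs[i := D (\<lambda>y. \<Gamma> y v (vs ! i)) x u]))"
    proof -
      have d1: "(\<lambda>z. D (\<lambda>z. T z vs) z v) differentiable (at x)"
        using T len x by (auto simp: C2_tensor_def numeral_2_eq_2)
      have d2: "((\<lambda>z. T z (vs[j := \<Gamma> z v (vs ! j)])) has_derivative
          (\<lambda>u. D (\<lambda>y. T y (vs[j := \<Gamma> x v (vs ! j)])) x u
                 + T x (vs[j := D (\<lambda>y. \<Gamma> y v (vs ! j)) x u]))) (at x)" if "j < n" for j
        by (rule tensor_leibniz_update[OF open_V x T1 len that \<Gamma>_differentiable[OF x]])
      show ?thesis
        unfolding nab_Cons cov_def len
        by (rule D_eqI) (auto intro!: has_derivative_diff has_derivative_sum D_has_derivative d1 d2)
    qed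
    have 2: "(\<Sum>i<n. cov \<Gamma> T x v (vs[i := \<Gamma> x u (vs ! i)]))
      = (\<Sum>i<n. D (\<lambda>y. T y (vs[i := \<Gamma> x u (vs ! i)])) x v)
        - (\<Sum>i<n. \<Sum>j\<in>{..<n} - {i}. T x (vs[i := \<Gamma> x u (vs ! i), j := \<Gamma> x v (vs ! j)]))
        - (\<Sum>i<n. T x (vs[i := \<Gamma> x v (\<Gamma> x u (vs ! i))]))"
    proof -
      have "cov \<Gamma> T x v (vs[i := \<Gamma> x u (vs ! i)])
        = D (\<lambda>y. T y (vs[i := \<Gamma> x u (vs ! i)])) x v
          - ((\<Sum>j\<in>{..<n} - {i}. T x (vs[i := \<Gamma> x u (vs ! i), j := \<Gamma> x v (vs ! j)]))
          + T x (vs[i := \<Gamma> x v (\<Gamma> x u (vs ! i))]))" if i: "i < n" for i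
      proof -
        have "(\<Sum>j<n. T x (vs[i := \<Gamma> x u (vs ! i), j := \<Gamma> x v (vs[i := \<Gamma> x u (vs ! i)] ! j)]))
          = T x (vs[i := \<Gamma> x v (\<Gamma> x u (vs ! i))])
           + (\<Sum>j\<in>{..<n} - {i}. T x (vs[i := \<Gamma> x u (vs ! i), j := \<Gamma> x v (vs[i := \<Gamma> x u (vs ! i)] ! j)]))"
          using i len by (subst sum.remove[of _ i]) auto
        also have "(\<Sum>j\<in>{..<n} - {i}. T x (vs[i := \<Gamma> x u (vs ! i), j := \<Gamma> x v (vs[i := \<Gamma> x u (vs ! i)] ! j)]))
          = (\<Sum>j\<in>{..<n} - {i}. T x (vs[i := \<Gamma> x u (vs ! i), j := \<Gamma> x v (vs ! j)]))"
          by (rule sum.cong) auto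
        finally show ?thesis by (simp add: cov_def len)
      qed
      then have "(\<Sum>i<n. cov \<Gamma> T x v (vs[i := \<Gamma> x u (vs ! i)]))
        = (\<Sum>i<n. D (\<lambda>y. T y (vs[i := \<Gamma> x u (vs ! i)])) x v
          - ((\<Sum>j\<in>{..<n} - {i}. T x (vs[i := \<Gamma> x u (vs ! i), j := \<Gamma> x v (vs ! j)]))
          + T x (vs[i := \<Gamma> x v (\<Gamma> x u (vs ! i))])))"
        by (intro sum.cong) auto
      then show ?thesis by (simp add: sum.distrib sum_subtractf)
    qed
    have 3: "(\<Sum>i<Suc n. nab \<Gamma> T x ((v # vs)[i := \<Gamma> x u ((v # vs) ! i)]))
      = cov \<Gamma> T x (\<Gamma> x u v) vs + (\<Sum>i<n. cov \<Gamma> T x v (vs[i := \<Gamma> x u (vs ! i)]))"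
      by (subst sum.lessThan_Suc_shift) simp
    have "nab \<Gamma> (nab \<Gamma> T) x (u # v # vs) = D (\<lambda>y. nab \<Gamma> T y (v # vs)) x u
       - (\<Sum>i<Suc n. nab \<Gamma> T x ((v # vs)[i := \<Gamma> x u ((v # vs) ! i)]))"
      by (simp only: nab_Cons[of _ "nab \<Gamma> T"] cov_def[of _ "nab \<Gamma> T"] len list.size add_Suc_right add_0_right)
    then show ?thesis
      unfolding 1 2 3 by (simp add: sum.distrib sum_subtractf)
  qed
  have "?S u v = ?S v u"
  proof -
    have "D (\<lambda>y. D (\<lambda>z. T z vs) y v) x u = D (\<lambda>y. D (\<lambda>z. T z vs) y u) x v"
      using T len by (intro second_derivative_symmetric[OF open_V _ x]) (auto simp: C2_tensor_def)
    moreover have "(\<Sum>i<n. \<Sum>j\<in>{..<n} - {i}. T x (vs[i := \<Gamma> x u (vs ! i), j := \<Gamma> x v (vs ! j)]))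
      = (\<Sum>i<n. \<Sum>j\<in>{..<n} - {i}. T x (vs[i := \<Gamma> x v (vs ! i), j := \<Gamma> x u (vs ! j)]))"
    proof -
      have "(\<Sum>i<n. \<Sum>j\<in>{..<n} - {i}. T x (vs[i := \<Gamma> x u (vs ! i), j := \<Gamma> x v (vs ! j)]))
        = (\<Sum>i<n. \<Sum>j<n. if j = i then 0 else T x (vs[i := \<Gamma> x u (vs ! i), j := \<Gamma> x v (vs ! j)]))"
        by (intro sum.cong refl sum.mono_neutral_cong_left) auto
      also have "\<dots> = (\<Sum>j<n. \<Sum>i<n. if j = i then 0 else T x (vs[i := \<Gamma> x u (vs ! i), j := \<Gamma> x v (vs ! j)]))"
        by (rule sum.swap)
      also have "\<dots> = (\<Sum>j<n. \<Sum>i\<in>{..<n} - {j}. T x (vs[j := \<Gamma> x v (vs ! j), i := \<Gamma> x u (vs ! i)]))"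
        by (intro sum.cong refl sum.mono_neutral_cong_right) (auto simp: list_update_swap)
      finally show ?thesis .
    qed
    ultimately show ?thesis by (simp add: \<Gamma>_commute[OF x, of u v])
  qed
  moreover have "T x (vs[i := curv \<Gamma> x u v (vs ! i)])
    = T x (vs[i := D (\<lambda>y. \<Gamma> y v (vs ! i)) x u]) - T x (vs[i := D (\<lambda>y. \<Gamma> y u (vs ! i)) x v])
     + T x (vs[i := \<Gamma> x u (\<Gamma> x v (vs ! i))]) - T x (vs[i := \<Gamma> x v (\<Gamma> x u (vs ! i))])" if "i < n" for i
    by (simp add: curv_def linear_add[OF multilin_update[OF ml len that]]
        linear_diff[OF multilin_update[OF ml len that]])
  then have "(\<Sum>i<n. T x (vs[i := curv \<Gamma> x u v (vs ! i)]))
    = (\<Sum>i<n. T x (vs[i := D (\<lambda>y. \<Gamma> y v (vs ! i)) x u])) - (\<Sum>i<n. T x (vs[i := D (\<lambda>y. \<Gamma> y u (vs ! i)) x v]))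
     + (\<Sum>i<n. T x (vs[i := \<Gamma> x u (\<Gamma> x v (vs ! i))])) - (\<Sum>i<n. T x (vs[i := \<Gamma> x v (\<Gamma> x u (vs ! i))]))"
    by (simp add: sum.distrib sum_subtractf)
  ultimately show ?thesis
    unfolding expand by (simp add: sum_subtractf)
qed

lemma linear_D_\<Gamma>:
  assumes x: "x \<in> V"
  shows "linear (\<lambda>w. D (\<lambda>y. \<Gamma> y v w) x u)"
proof (rule linearI)
  fix a b :: R7 and c :: real
  have "D (\<lambda>y. \<Gamma> y v (a + b)) x u = D (\<lambda>y. \<Gamma> y v a + \<Gamma> y v b) x u"
    by (rule D_cong[OF open_V x]) (simp add: linear_add[OF linear_\<Gamma>_right])
  then show "D (\<lambda>y. \<Gamma> y v (a + b)) x u = D (\<lambda>y. \<Gamma> y v a) x u + D (\<lambda>y. \<Gamma> y v b) x u"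
    by (simp add: D_add \<Gamma>_differentiable[OF x])
  have "D (\<lambda>y. \<Gamma> y v (c *\<^sub>R a)) x u = D (\<lambda>y. c *\<^sub>R \<Gamma> y v a) x u"
    by (rule D_cong[OF open_V x]) (simp add: linear_scale[OF linear_\<Gamma>_right])
  also have "\<dots> = c *\<^sub>R D (\<lambda>y. \<Gamma> y v a) x u"
    by (rule D_eqI) (auto intro!: has_derivative_scaleR_right D_has_derivative \<Gamma>_differentiable[OF x])
  finally show "D (\<lambda>y. \<Gamma> y v (c *\<^sub>R a)) x u = c *\<^sub>R D (\<lambda>y. \<Gamma> y v a) x u" .
qed

lemma linear_curv:
  assumes x: "x \<in> V"
  shows "linear (\<lambda>w. curv \<Gamma> x u v w)"
  unfolding curv_def
  using linear_compose[OF linear_\<Gamma>_right[OF x] linear_\<Gamma>_right[OF x]]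
  by (intro linear_compose_sub linear_compose_add linear_D_\<Gamma>[OF x]) (simp_all add: o_def)

lemma curv_swap: "curv \<Gamma> x u v w = - curv \<Gamma> x v u w"
  by (simp add: curv_def)

lemma curv_bianchi:
  assumes x: "x \<in> V"
  shows "curv \<Gamma> x u v w + curv \<Gamma> x v w u + curv \<Gamma> x w u v = 0"
proof -
  have "D (\<lambda>y. \<Gamma> y a b) x c = D (\<lambda>y. \<Gamma> y b a) x c" for a b c
    by (rule D_cong[OF open_V x]) (rule \<Gamma>_commute)
  note this[of u v] this[of v w] this[of w u]
  moreover note \<Gamma>_commute[OF x, of u v] \<Gamma>_commute[OF x, of v w] \<Gamma>_commute[OF x, of w u]
  ultimately show ?thesis by (simp add: curv_def)
qed

text \<open>
  The Bianchi identity trades the first argument for the last and the second, where linearity can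
  be read off.
\<close>
lemma linear_curv_left:
  assumes x: "x \<in> V"
  shows "linear (\<lambda>u. curv \<Gamma> x u v w)"
proof -
  have "curv \<Gamma> x u v w = curv \<Gamma> x w v u - curv \<Gamma> x w u v" for u
    using curv_bianchi[OF x, of u v w] curv_swap[of x v w u]
    by (simp add: algebra_simps add_eq_0_iff)
  moreover have "linear (\<lambda>u. curv \<Gamma> x w u v)"
  proof -
    have "linear (\<lambda>u. D (\<lambda>y. \<Gamma> y u v) x w)"
    proof -
      have "D (\<lambda>y. \<Gamma> y u v) x w = D (\<lambda>y. \<Gamma> y v u) x w" for u
        by (rule D_cong[OF open_V x]) (rule \<Gamma>_commute)
      then show ?thesis using linear_D_\<Gamma>[OF x] by simp
    qed
    moreover have "linear (\<lambda>u. D (\<lambda>y. \<Gamma> y w v) x u)"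
      by (rule D_linear[OF \<Gamma>_differentiable[OF x]])
    ultimately show ?thesis
      unfolding curv_def
      using linear_compose[OF linear_\<Gamma>_left[OF x] linear_\<Gamma>_right[OF x]] 
        linear_\<Gamma>_left[OF x, of "\<Gamma> x w v"]
      by (intro linear_compose_sub linear_compose_add) (simp_all add: o_def)
  qed
  ultimately show ?thesis
    using linear_curv[OF x] by (simp add: linear_compose_sub)
qed

end

section \<open>Alternating forms and exterior derivatives\<close>

lemma alt_form_swap:
  assumes "alt_form k \<alpha>" "length xs + length ys + 2 = k"
  shows "\<alpha> (xs @ a # b # ys) = - \<alpha> (xs @ b # a # ys)"
proof -
  have slot: "linear (\<lambda>v. \<alpha> (vs[i := v]))" if "length vs = k" "i < k" for vs i
    using assms(1) that by (simp add: alt_form_def)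
  have lin1: "linear (\<lambda>v. \<alpha> (xs @ v # c # ys))" for c
    using slot[of "xs @ 0 # c # ys" "length xs"] assms(2) by simp
  have lin2: "linear (\<lambda>v. \<alpha> (xs @ c # v # ys))" for c
    using slot[of "xs @ c # 0 # ys" "Suc (length xs)"] assms(2) by (simp add: list_update_append)
  have zero: "\<alpha> (xs @ c # c # ys) = 0" for c
  proof -
    have "\<forall>vs i j. length vs = k \<and> i < j \<and> j < k \<and> vs ! i = vs ! j \<longrightarrow> \<alpha> vs = 0"
      using assms(1) by (simp add: alt_form_def)
    from this[rule_format, of "xs @ c # c # ys" "length xs" "Suc (length xs)"]
    show ?thesis using assms(2) by (simp add: nth_append)
  qed
  have "0 = \<alpha> (xs @ (a + b) # (a + b) # ys)" by (simp add: zero)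
  also have "\<dots> = \<alpha> (xs @ a # b # ys) + \<alpha> (xs @ b # a # ys)"
    unfolding linear_add[OF lin1] linear_add[OF lin2] by (simp add: zero)
  finally have "\<alpha> (xs @ a # b # ys) + \<alpha> (xs @ b # a # ys) = 0" by (rule sym)
  then show ?thesis by (simp only: eq_neg_iff_add_eq_0)
qed

lemma alt_form_move:
  assumes "alt_form k \<alpha>" "length xs + length ys + length zs + 1 = k"
  shows "\<alpha> (xs @ ys @ w # zs) = (-1) ^ length ys *\<^sub>R \<alpha> (xs @ w # ys @ zs)"
  using assms(2)
proof (induction ys arbitrary: xs)
  case (Cons y ys)
  have "\<alpha> (xs @ (y # ys) @ w # zs) = (-1) ^ length ys *\<^sub>R \<alpha> (xs @ y # w # ys @ zs)"
    using Cons.IH[of "xs @ [y]"] Cons.prems by simp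
  also have "\<dots> = (-1) ^ length (y # ys) *\<^sub>R \<alpha> (xs @ w # y # ys @ zs)"
    using alt_form_swap[OF assms(1), of xs "ys @ zs" y w] Cons.prems by simp
  finally show ?case by simp
qed simp

text \<open>
  These are the Christoffel terms by which the alternating sum of covariant derivatives differs
  from the exterior derivative. Omitting \<open>v\<^sub>i\<close> and replacing \<open>v\<^sub>j\<close> by \<open>G v\<^sub>i v\<^sub>j\<close> gives the same list as
  the exchanged choice, up to moving that vector past the entries between the two positions; the
  resulting sign makes the two terms opposite.
\<close>
lemma torsion_terms_cancel:
  assumes \<alpha>: "alt_form k \<alpha>" and G: "\<And>u v. G u v = G v u" and len: "length vs = Suc k"
  shows "(\<Sum>i<Suc k. (-1) ^ i *\<^sub>R (\<Sum>j<k. \<alpha> ((remove_nth i vs)[j := G (vs ! i) (remove_nth i vs ! j)]))) = 0"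
proof -
  define h where "h i j = (-1) ^ i *\<^sub>R \<alpha> ((remove_nth i vs)[j := G (vs ! i) (remove_nth i vs ! j)])" for i j
  have pair: "h i j + h j (i - 1) = 0" if ij: "j < i" "i < Suc k" for i j
  proof -
    define xs ys zs a b where "xs = take j vs" and "ys = drop (Suc j) (take i vs)" and "zs = drop (Suc i) vs"
      and "a = vs ! j" and "b = vs ! i"
    have vs: "vs = xs @ a # ys @ b # zs"
    proof -
      have "vs = take i vs @ b # zs"
        using ij len by (simp add: b_def zs_def id_take_nth_drop)
      moreover have "take i vs = xs @ a # ys"
        using ij len id_take_nth_drop[of j "take i vs"] by (simp add: xs_def ys_def a_def min_def)
      ultimately show ?thesis by simp
    qed
    have lx: "length xs = j" and i: "i = j + Suc (length ys)" and lk: "length xs + length ys + length zs + 1 = k"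
      using ij len by (auto simp: xs_def ys_def zs_def)
    have r1: "remove_nth i vs = xs @ a # ys @ zs" and r2: "remove_nth j vs = xs @ ys @ b # zs"
      by (auto simp: remove_nth_def vs i lx)
    have "(remove_nth i vs)[j := G (vs ! i) (remove_nth i vs ! j)] = xs @ G b a # ys @ zs"
      by (simp add: r1 b_def[symmetric] lx[symmetric])
    moreover have "(remove_nth j vs)[i - 1 := G (vs ! j) (remove_nth j vs ! (i - 1))] = xs @ ys @ G a b # zs"
      unfolding r2 a_def[symmetric] by (simp add: lx[symmetric] i nth_append list_update_append)
    ultimately show ?thesis
      using alt_form_move[OF \<alpha> lk, of "G a b"]
      by (simp add: h_def i G[of b a] power_add flip: scaleR_left_distrib)
  qed
  have "(\<Sum>i<Suc k. (-1) ^ i *\<^sub>R (\<Sum>j<k. \<alpha> ((remove_nth i vs)[j := G (vs ! i) (remove_nth i vs ! j)])))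
    = (\<Sum>i<Suc k. \<Sum>j<k. h i j)"
    by (simp only: h_def scaleR_sum_right)
  also have "\<dots> = (\<Sum>i<Suc k. (\<Sum>j<i. h i j) + (\<Sum>j\<in>{i..<k}. h i j))"
  proof (rule sum.cong)
    fix i assume "i \<in> {..<Suc k}"
    then have "{..<k} = {..<i} \<union> {i..<k}" by auto
    moreover have "{..<i} \<inter> {i..<k} = {}" by auto
    ultimately show "(\<Sum>j<k. h i j) = (\<Sum>j<i. h i j) + (\<Sum>j\<in>{i..<k}. h i j)"
      by (metis finite_atLeastLessThan finite_lessThan sum.union_disjoint)
  qed simp
  also have "\<dots> = (\<Sum>i<Suc k. \<Sum>j<i. h i j) + (\<Sum>i<Suc k. \<Sum>j\<in>{i..<k}. h i j)"
    by (rule sum.distrib)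
  also have "(\<Sum>i<Suc k. \<Sum>j\<in>{i..<k}. h i j) = (\<Sum>i<Suc k. \<Sum>j<i. h j (i - 1))"
  proof -
    have "(\<Sum>i<Suc k. \<Sum>j\<in>{i..<k}. h i j) = (\<Sum>(i, j)\<in>Sigma {..<Suc k} (\<lambda>i. {i..<k}). h i j)"
      by (rule sum.Sigma) auto
    also have "\<dots> = (\<Sum>(i, j)\<in>Sigma {..<Suc k} (\<lambda>i. {..<i}). h j (i - 1))"
      by (rule sum.reindex_bij_witness[of _ "\<lambda>(i, j). (j, i - 1)" "\<lambda>(i, j). (Suc j, i)"]) auto
    also have "\<dots> = (\<Sum>i<Suc k. \<Sum>j<i. h j (i - 1))"
      by (rule sum.Sigma[symmetric]) auto
    finally show ?thesis .
  qed
  also have "(\<Sum>i<Suc k. \<Sum>j<i. h i j) + (\<Sum>i<Suc k. \<Sum>j<i. h j (i - 1))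
      = (\<Sum>i<Suc k. \<Sum>j<i. h i j + h j (i - 1))"
    by (simp only: sum.distrib)
  also have "\<dots> = 0" using pair by (intro sum.neutral ballI) auto
  finally show ?thesis .
qed

section \<open>Orthonormal frames\<close>

abbreviation sum7 :: "(7 \<Rightarrow> 'a::comm_monoid_add) \<Rightarrow> 'a" (binder "\<^bold>\<Sum>" 10) where
  "sum7 h \<equiv> sum h UNIV"

lemma sum7_rotate:
  fixes K :: "7 \<Rightarrow> 7 \<Rightarrow> 7 \<Rightarrow> 'a::comm_monoid_add"
  shows "(\<^bold>\<Sum>p i j. K p i j) = (\<^bold>\<Sum>i j p. K p i j)"
  by (subst sum.swap, rule sum.cong[OF refl], rule sum.swap)

lemma linear_scaleR_const: "linear h \<Longrightarrow> linear (\<lambda>u. (h u :: real) *\<^sub>R w)"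
  by (rule linearI) (simp_all add: linear_add linear_scale scaleR_add_left)

lemma linear_cmult: "linear h \<Longrightarrow> linear (\<lambda>u. c * (h u :: real))"
  by (rule linearI) (simp_all add: linear_add linear_scale algebra_simps)

lemma matrix_apply: "linear h \<Longrightarrow> matrix h *v x = (h x :: real^'m)" for h :: "real^'n \<Rightarrow> real^'m"
  by (simp add: matrix_works linear_matrix_vector_mul_eq)

lemma differentiable_prod:
  fixes h :: "'i \<Rightarrow> R7 \<Rightarrow> real"
  assumes "\<And>i. i \<in> I \<Longrightarrow> h i differentiable (at x)"
  shows "(\<lambda>z. \<Prod>i\<in>I. h i z) differentiable (at x)"
  using has_derivative_prod[of I h "\<lambda>i. D (h i) x" x UNIV] assms D_has_derivative
  unfolding differentiable_def by blast

text \<open>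
  Cramer's rule for the inverse of the matrix with rows \<open>e i\<close>; the frame depends rationally on the
  coframe and inherits its differentiability.
\<close>
definition dual_frame :: "(7 \<Rightarrow> R7) \<Rightarrow> 7 \<Rightarrow> R7" where
  "dual_frame e j = (\<chi> k. det (\<chi> a b. if b = k then axis j 1 $ a else e a $ b) / det (\<chi> a b. e a $ b))"

definition metric_tensor :: "('a \<Rightarrow> bilin) \<Rightarrow> 'a \<Rightarrow> real form" where
  "metric_tensor g y vs = g y (vs ! 0) (vs ! 1)"

lemma length_2_cases: "length vs = 2 \<Longrightarrow> (\<And>a b. vs = [a, b] \<Longrightarrow> P) \<Longrightarrow> P"
  by (auto simp: numeral_2_eq_2 length_Suc_conv)

lemma less_2_cases': "(i::nat) < 2 \<Longrightarrow> (i = 0 \<Longrightarrow> P) \<Longrightarrow> (i = 1 \<Longrightarrow> P) \<Longrightarrow> P"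
  by linarith

locale metric_frame =
  fixes V :: "R7 set" and g :: "R7 \<Rightarrow> bilin" and e :: "R7 \<Rightarrow> 7 \<Rightarrow> R7"
  assumes open_V: "open V"
    and g_frame: "y \<in> V \<Longrightarrow> g y u v = (\<^bold>\<Sum>i. (e y i \<bullet> u) * (e y i \<bullet> v))"
    and g_pos: "y \<in> V \<Longrightarrow> v \<noteq> 0 \<Longrightarrow> g y v v > 0"
    and e_differentiable: "y \<in> V \<Longrightarrow> (\<lambda>z. e z i) differentiable (at y)"
    and g_C2: "Ck_on 2 V (\<lambda>z. g z u v)"
begin

definition f :: "R7 \<Rightarrow> 7 \<Rightarrow> R7" where "f y = dual_frame (e y)"

lemma g_commute: "y \<in> V \<Longrightarrow> g y u v = g y v u"
  by (simp add: g_frame mult.commute)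

lemma linear_g_right: "y \<in> V \<Longrightarrow> linear (g y u)"
  and linear_g_left: "y \<in> V \<Longrightarrow> linear (\<lambda>u. g y u v)"
  by (rule linearI; simp add: g_frame inner_add_right algebra_simps sum.distrib sum_distrib_left)+

lemma e_nondegenerate: "y \<in> V \<Longrightarrow> (\<And>i. e y i \<bullet> v = 0) \<Longrightarrow> v = 0"
  using g_pos[of y v] g_frame[of y v v] by force

lemma det_e: assumes "y \<in> V" shows "det (\<chi> a b. e y a $ b) \<noteq> 0"
proof -
  have "(\<chi> a b. e y a $ b) *v x = 0 \<Longrightarrow> x = 0" for x
  proof (rule e_nondegenerate[OF assms])
    fix i assume "(\<chi> a b. e y a $ b) *v x = 0"
    then have "((\<chi> a b. e y a $ b) *v x) $ i = 0" by simp
    then show "e y i \<bullet> x = 0" by (simp add: matrix_vector_mult_def inner_vec_def)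
  qed
  then have "invertible (\<chi> a b. e y a $ b)"
    by (meson invertible_left_inverse matrix_left_invertible_ker)
  then show ?thesis by (simp add: invertible_det_nz)
qed

lemma e_f: assumes "y \<in> V" shows "e y i \<bullet> f y j = (if i = j then 1 else 0)"
proof -
  have "(\<chi> a b. e y a $ b) *v f y j = axis j 1"
    using cramer[OF det_e[OF assms], of "f y j" "axis j 1"]
    by (simp add: f_def dual_frame_def cong: if_cong)
  then have "((\<chi> a b. e y a $ b) *v f y j) $ i = axis j 1 $ i" by simp
  then show ?thesis by (simp add: matrix_vector_mult_def inner_vec_def axis_def)
qed

lemma f_differentiable:
  assumes y: "y \<in> V" shows "(\<lambda>z. f z i) differentiable (at y)"
proof -
  have entry: "(\<lambda>z. e z a $ b) differentiable (at y)" for a b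
    using differentiable_inner[OF e_differentiable[OF y] differentiable_const, of a "axis b 1"]
    by (simp add: inner_axis)
  have entry': "(\<lambda>z. if b = k then axis i 1 $ a else e z a $ b) differentiable (at y)" for a b k
    by (cases "b = k") (simp_all add: entry)
  have det: "(\<lambda>z. det (\<chi> a b. M z a b)) differentiable (at y)"
    if "\<And>a b. (\<lambda>z. M z a b) differentiable (at y)" for M :: "R7 \<Rightarrow> 7 \<Rightarrow> 7 \<Rightarrow> real"
    unfolding det_def
    by (intro differentiable_sum differentiable_mult differentiable_const differentiable_prod ballI)
      (simp_all add: that)
  have "(\<lambda>z. f z i $ k) differentiable (at y)" for k
    unfolding f_def dual_frame_def vec_lambda_beta
    by (intro differentiable_divide det entry entry' det_e[OF y])
  then show ?thesis
    unfolding differentiable_componentwise_within[of "\<lambda>z. f z i"]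
    by (auto simp: Basis_vec_def inner_axis)
qed

lemma frame_expansion: assumes "y \<in> V" shows "v = (\<^bold>\<Sum>i. (e y i \<bullet> v) *\<^sub>R f y i)"
proof -
  have "v - (\<^bold>\<Sum>i. (e y i \<bullet> v) *\<^sub>R f y i) = 0"
    by (rule e_nondegenerate[OF assms]) (simp add: inner_diff_right inner_sum_right e_f[OF assms] if_distrib cong: if_cong)
  then show ?thesis by simp
qed

lemma g_f: "y \<in> V \<Longrightarrow> g y (f y i) v = e y i \<bullet> v"
  by (simp add: g_frame e_f if_distrib[of "\<lambda>c. c * _"] cong: if_cong)

lemma linear_frame_expansion:
  fixes h :: "R7 \<Rightarrow> 'b::real_vector"
  assumes "y \<in> V" "linear h"
  shows "h v = (\<^bold>\<Sum>i. (e y i \<bullet> v) *\<^sub>R h (f y i))"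
proof -
  have "h v = h (\<^bold>\<Sum>i. (e y i \<bullet> v) *\<^sub>R f y i)"
    using frame_expansion[OF assms(1)] by simp
  then show ?thesis by (simp add: linear_sum[OF assms(2)] linear_scale[OF assms(2)])
qed

lemma g_f_f: "y \<in> V \<Longrightarrow> g y (f y i) (f y j) = (if i = j then 1 else 0)"
  by (simp add: g_f e_f)

lemma g_eqI: "y \<in> V \<Longrightarrow> (\<And>w. g y w u = g y w v) \<Longrightarrow> u = v"
  using e_nondegenerate[of y "u - v"] g_f[of y _ u] g_f[of y _ v]
  by (simp add: inner_diff_right)

text \<open>
  The matrix relating two orthonormal frames has orthonormal rows, hence orthonormal columns.
\<close>
lemma contraction_independent:
  fixes B :: "R7 \<Rightarrow> R7 \<Rightarrow> 'b::real_vector"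
  assumes y: "y \<in> V" and a: "\<And>i j. g y (a i) (a j) = (if i = j then 1 else (0::real))"
    and B: "\<And>u. linear (B u)" "\<And>v. linear (\<lambda>u. B u v)"
  shows "(\<^bold>\<Sum>i. B (a i) (a i)) = (\<^bold>\<Sum>i. B (f y i) (f y i))"
proof -
  define Q :: "real^7^7" where "Q = (\<chi> i p. e y p \<bullet> a i)"
  have "Q ** transpose Q = mat 1"
    using a by (simp add: Q_def vec_eq_iff matrix_matrix_mult_def transpose_def mat_def g_frame[OF y])
  then have "transpose Q ** Q = mat 1" by (simp add: matrix_left_right_inverse)
  then have "(transpose Q ** Q) $ p $ q = mat 1 $ p $ q" for p q by simp
  then have Q: "(\<^bold>\<Sum>i. (e y p \<bullet> a i) * (e y q \<bullet> a i)) = (if p = q then 1 else 0)" for p q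
    by (simp add: Q_def matrix_matrix_mult_def transpose_def mat_def)
  have "B (a i) (a i) = (\<^bold>\<Sum>p q. ((e y p \<bullet> a i) * (e y q \<bullet> a i)) *\<^sub>R B (f y p) (f y q))" for i
  proof -
    have "B (a i) (a i) = (\<^bold>\<Sum>p. (e y p \<bullet> a i) *\<^sub>R B (f y p) (a i))"
      by (rule linear_frame_expansion[OF y B(2)])
    also have "\<dots> = (\<^bold>\<Sum>p. (e y p \<bullet> a i) *\<^sub>R (\<^bold>\<Sum>q. (e y q \<bullet> a i) *\<^sub>R B (f y p) (f y q)))"
      using linear_frame_expansion[OF y B(1), of _ "a i"] by simp
    finally show ?thesis by (simp add: scaleR_sum_right)
  qed
  then have "(\<^bold>\<Sum>i. B (a i) (a i))
    = (\<^bold>\<Sum>i p q. ((e y p \<bullet> a i) * (e y q \<bullet> a i)) *\<^sub>R B (f y p) (f y q))"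
    by simp
  also have "\<dots> = (\<^bold>\<Sum>p q i. ((e y p \<bullet> a i) * (e y q \<bullet> a i)) *\<^sub>R B (f y p) (f y q))"
    by (subst sum.swap, rule sum.cong[OF refl], rule sum.swap)
  also have "\<dots> = (\<^bold>\<Sum>p q. (if p = q then 1 else 0) *\<^sub>R B (f y p) (f y q))"
    by (simp only: scaleR_sum_left[symmetric] Q)
  also have "\<dots> = (\<^bold>\<Sum>p. B (f y p) (f y p))"
    by (simp add: if_distrib[of "\<lambda>c. c *\<^sub>R _"] cong: if_cong)
  finally show ?thesis .
qed

section \<open>The Levi-Civita connection\<close>

lemma C2_metric: "C2_tensor V 2 (metric_tensor g)"
  unfolding C2_tensor_def multilin_def
  by (auto simp: metric_tensor_def g_C2 linear_g_left linear_g_right elim!: length_2_cases less_2_cases')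

lemma C1_metric: "C1_tensor V 2 (metric_tensor g)"
  by (rule C2_imp_C1[OF C2_metric])

lemma g_differentiable: "y \<in> V \<Longrightarrow> (\<lambda>z. g z u v) differentiable (at y)"
  using g_C2[of u v] by (simp add: numeral_2_eq_2)

lemma linear_Dg_left: "y \<in> V \<Longrightarrow> linear (\<lambda>v. D (\<lambda>z. g z v w) y u)"
  using linear_D_tensor[OF open_V _ C1_metric, of y "[0, w]" 0] by (simp add: metric_tensor_def)

lemma linear_Dg_right: "y \<in> V \<Longrightarrow> linear (\<lambda>w. D (\<lambda>z. g z v w) y u)"
  using linear_D_tensor[OF open_V _ C1_metric, of y "[v, 0]" 1] by (simp add: metric_tensor_def)

lemma linear_Dg: "y \<in> V \<Longrightarrow> linear (\<lambda>u. D (\<lambda>z. g z v w) y u)"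
  using D_linear[OF g_differentiable] by simp

lemma Dg_commute: "y \<in> V \<Longrightarrow> D (\<lambda>z. g z v w) y u = D (\<lambda>z. g z w v) y u"
  by (rule D_cong[OF open_V]) (auto intro: g_commute)

text \<open>
  The Christoffel symbols of the first kind.
\<close>
definition christoffel :: "R7 \<Rightarrow> R7 \<Rightarrow> R7 \<Rightarrow> R7 \<Rightarrow> real" where
  "christoffel y u v w = (D (\<lambda>z. g z v w) y u + D (\<lambda>z. g z u w) y v - D (\<lambda>z. g z u v) y w) / 2"

text \<open>
  The Koszul formula, with the index raised in the frame.
\<close>
definition koszul :: "R7 \<Rightarrow> R7 \<Rightarrow> R7 \<Rightarrow> R7" where
  "koszul y u v = (\<^bold>\<Sum>k. christoffel y u v (f y k) *\<^sub>R f y k)"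

lemma linear_christoffel:
  assumes "y \<in> V"
  shows "linear (\<lambda>u. christoffel y u v w)" "linear (\<lambda>v. christoffel y u v w)" "linear (christoffel y u v)"
  unfolding christoffel_def divide_inverse mult.commute[of _ "inverse 2"]
  by (intro linear_compose_sub linear_compose_add linear_cmult
      linear_Dg[OF assms] linear_Dg_left[OF assms] linear_Dg_right[OF assms])+

lemma g_koszul: assumes y: "y \<in> V" shows "g y (koszul y u v) w = christoffel y u v w"
proof -
  have "christoffel y u v w = christoffel y u v (\<^bold>\<Sum>k. (e y k \<bullet> w) *\<^sub>R f y k)"
    using frame_expansion[OF y] by simp
  then show ?thesis
    by (simp add: koszul_def linear_sum[OF linear_christoffel(3)[OF y]] linear_scale[OF linear_christoffel(3)[OF y]]
      linear_sum[OF linear_g_left[OF y]] linear_scale[OF linear_g_left[OF y]] g_f[OF y] mult.commute)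
qed

lemma koszul_levi_civita:
  assumes y: "y \<in> V"
  shows "bilinear (koszul y)" and "koszul y u v = koszul y v u"
    and "D (\<lambda>z. g z v w) y u = g y (koszul y u v) w + g y v (koszul y u w)"
proof -
  show "bilinear (koszul y)"
    unfolding bilinear_def koszul_def
    by (intro conjI allI linear_compose_sum ballI linear_scaleR_const linear_christoffel y)
  show "koszul y u v = koszul y v u"
    by (simp add: koszul_def christoffel_def Dg_commute[OF y, of u v] add.commute)
  show "D (\<lambda>z. g z v w) y u = g y (koszul y u v) w + g y v (koszul y u w)"
    unfolding g_commute[OF y, of v] g_koszul[OF y] christoffel_def
    using Dg_commute[OF y, of v w u] by (simp add: field_simps)
qed

lemma levi_civita_eq: assumes y: "y \<in> V" shows "levi_civita g y = koszul y"
  unfolding levi_civita_def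
proof (rule the_equality)
  show "bilinear (koszul y) \<and> (\<forall>u v. koszul y u v = koszul y v u) \<and>
     (\<forall>u v w. D (\<lambda>z. g z v w) y u = g y (koszul y u v) w + g y v (koszul y u w))"
    using koszul_levi_civita[OF y] by blast
next
  fix \<Gamma> assume *: "bilinear \<Gamma> \<and> (\<forall>u v. \<Gamma> u v = \<Gamma> v u) \<and>
     (\<forall>u v w. D (\<lambda>z. g z v w) y u = g y (\<Gamma> u v) w + g y v (\<Gamma> u w))"
  have "g y w (\<Gamma> u v) = g y w (koszul y u v)" for u v w
  proof -
    have "christoffel y u v w = g y (\<Gamma> u v) w"
      unfolding christoffel_def
      using * g_commute[OF y, of "\<Gamma> _ _"] by simp
    then show ?thesis by (metis g_commute[OF y] g_koszul[OF y])
  qed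
  then show "\<Gamma> = koszul y"
    by (intro ext g_eqI[OF y])
qed

text \<open>
  The first derivatives of the metric form the covariant derivative of \<open>g\<close> for the flat connection,
  hence a differentiable tensor field of degree \<open>3\<close> into which the frame may be inserted.
\<close>
lemma koszul_differentiable:
  assumes y: "y \<in> V" shows "(\<lambda>z. koszul z u v) differentiable (at y)"
proof -
  interpret flat: connection V "\<lambda>_ _ _. 0"
    by unfold_locales (auto simp: open_V bilinear_def linear_0 intro: module_hom_zero)
  have H: "C1_tensor V 3 (nab (\<lambda>_ _ _. 0) (metric_tensor g))"
    using flat.C1_nab[OF C2_metric] by (simp add: eval_nat_numeral)
  have H_eq: "cov (\<lambda>_ _ _. 0) (metric_tensor g) z a [b, c] = D (\<lambda>y. g y b c) z a" if "z \<in> V" for z a b c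
    using that linear_0[OF linear_g_left] linear_0[OF linear_g_right]
    by (simp add: cov_def metric_tensor_def numeral_2_eq_2)
  have *: "(\<lambda>z. nab (\<lambda>_ _ _. 0) (metric_tensor g) z (vs[i := f z k])) differentiable (at y)"
    if "length vs = 3" "i < 3" for vs i k
    using tensor_leibniz_update[OF open_V y H that f_differentiable[OF y]]
    unfolding differentiable_def by blast
  have "(\<lambda>z. christoffel z u v (f z k)) differentiable (at y)" for k
  proof (rule differentiable_cong_open[OF open_V y])
    fix z assume "z \<in> V"
    then show "christoffel z u v (f z k) = inverse 2 *
      (nab (\<lambda>_ _ _. 0) (metric_tensor g) z ([u, v, 0][2 := f z k])
      + nab (\<lambda>_ _ _. 0) (metric_tensor g) z ([v, u, 0][2 := f z k])
      - nab (\<lambda>_ _ _. 0) (metric_tensor g) z ([0, u, v][0 := f z k]))"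
      by (simp add: christoffel_def H_eq)
  qed (intro differentiable_mult differentiable_add differentiable_diff differentiable_const *; simp)
  then show ?thesis
    unfolding koszul_def
    by (intro differentiable_sum differentiable_scaleR f_differentiable y ballI) auto
qed

abbreviation "\<Gamma> \<equiv> levi_civita g"

sublocale connection V "\<Gamma>"
proof
  fix y u v assume y: "y \<in> V"
  show "bilinear (\<Gamma> y)" "\<Gamma> y u v = \<Gamma> y v u"
    by (simp_all only: levi_civita_eq[OF y] koszul_levi_civita[OF y])
  show "(\<lambda>z. \<Gamma> z u v) differentiable (at y)"
    by (rule differentiable_cong_open[OF open_V y _ koszul_differentiable[OF y]])
      (simp add: levi_civita_eq)
qed (rule open_V)

lemma metric_compatible:
  "y \<in> V \<Longrightarrow> D (\<lambda>z. g z v w) y u = g y (\<Gamma> y u v) w + g y v (\<Gamma> y u w)"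
  by (simp only: levi_civita_eq koszul_levi_civita(3))

lemma cov_metric: "y \<in> V \<Longrightarrow> cov \<Gamma> (metric_tensor g) y u [v, w] = 0"
  by (simp add: cov_def metric_tensor_def metric_compatible numeral_2_eq_2)

section \<open>Symmetries of the curvature\<close>

lemma parallel_second:
  assumes x: "x \<in> V" and par: "\<And>y vs. y \<in> V \<Longrightarrow> length vs = Suc n \<Longrightarrow> nab \<Gamma> T y vs = 0" and len: "length vs = Suc (Suc n)"
  shows "nab \<Gamma> (nab \<Gamma> T) x vs = 0"
proof -
  obtain u ws where vs: "vs = u # ws" "length ws = Suc n" using len by (cases vs) auto
  have "D (\<lambda>y. nab \<Gamma> T y ws) x u = D (\<lambda>y. 0) x u"
    by (rule D_cong[OF open_V x]) (simp add: par vs)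
  then show ?thesis
    unfolding vs nab_Cons[of _ "nab \<Gamma> T"] cov_def[of _ "nab \<Gamma> T"] by (simp add: par vs x)
qed

text \<open>
  The metric is parallel, so the curvature annihilates it by the Ricci identity.
\<close>
lemma curvature_skew:
  assumes x: "x \<in> V" shows "g x (curv \<Gamma> x u v a) b + g x a (curv \<Gamma> x u v b) = 0"
proof -
  have "nab \<Gamma> (metric_tensor g) y vs = 0" if "y \<in> V" "length vs = Suc 2" for y vs
    using that by (auto simp: length_Suc_conv numeral_2_eq_2 cov_metric)
  then have "nab \<Gamma> (nab \<Gamma> (metric_tensor g)) x vs = 0" if "length vs = 4" for vs
    using parallel_second[OF x, of 2] that by simp
  from this[of "[u, v, a, b]"] this[of "[v, u, a, b]"] show ?thesis
    using ricci_identity[OF x C2_metric, of "[a, b]" u v]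
    by (simp add: metric_tensor_def numeral_2_eq_2)
qed

text \<open>
  A combination of the Bianchi identities for the four cyclic triples of \<open>a, b, c, d\<close>.
\<close>
lemma curvature_pair_symmetry:
  assumes x: "x \<in> V"
  shows "g x (curv \<Gamma> x a b c) d = g x (curv \<Gamma> x c d a) b"
proof -
  define R where "R a b c d = g x (curv \<Gamma> x a b c) d" for a b c d
  have 1: "R a b c d = - R b a c d" for a b c d
    using curv_swap[of x a b c] linear_neg[OF linear_g_left[OF x]] by (simp add: R_def)
  have 2: "R a b c d = - R a b d c" for a b c d
    using curvature_skew[OF x, of a b c d] g_commute[OF x, of c] by (simp add: R_def)
  have 3: "R a b c d + R b c a d + R c a b d = 0" for a b c d
    using arg_cong[OF curv_bianchi[OF x, of a b c], of "\<lambda>w. g x w d"]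
    by (simp add: R_def linear_add[OF linear_g_left[OF x]] linear_0[OF linear_g_left[OF x]])
  show ?thesis
    using 1[of a b c d] 1[of b c a d] 1[of c a b d] 
      3[of a b c d] 3[of b c d a] 3[of c d a b] 3[of d a b c]
      2[of a b c d] 2[of b c a d] 2[of c a b d] 2[of b c d a] 2[of c d b a] 2[of d b c a]
      2[of c d a b] 2[of d a c b] 2[of a c d b] 2[of d a b c] 2[of a b d c] 2[of b d a c]
      1[of c d a b] 1[of d b c a] 1[of d a c b] 1[of a c d b] 1[of b d a c] 1[of b d c a] 1[of a c b d]
    unfolding R_def by linarith
qed

lemma riemann_mult:
  assumes x: "x \<in> V" shows "riemann g x u v *v w = curv \<Gamma> x u v w"
proof -
  have "curvature_fields g (\<lambda>_. u) (\<lambda>_. v) (\<lambda>_. w) x = curv \<Gamma> x u v w" for w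
  proof -
    have 1: "nabla g (\<lambda>_. b) (\<lambda>_. c) = (\<lambda>y. \<Gamma> y b c)" for b c
      by (simp add: nabla_def fun_eq_iff)
    have 2: "lie_bracket (\<lambda>_. u) (\<lambda>_. v) = (\<lambda>_. 0)"
      by (simp add: lie_bracket_def fun_eq_iff)
    show ?thesis
      unfolding curvature_fields_def 1 2 bilinear_lzero[OF bilinear_\<Gamma>[OF x]]
      by (simp add: nabla_def curv_def)
  qed
  then show ?thesis
    using matrix_apply[OF linear_curv[OF x], of u v w] by (simp add: riemann_def)
qed

section \<open>Endomorphisms and bilinear forms\<close>

lemma sharp_mult:
  assumes y: "y \<in> V" and A: "\<And>X. linear (A X)" "\<And>Z. linear (\<lambda>X. A X Z)"
  shows "sharp (g y) A = matrix (\<lambda>Z. \<^bold>\<Sum>i. A (f y i) Z *\<^sub>R f y i)"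
    and "g y X (sharp (g y) A *v Z) = A X Z"
proof -
  let ?B = "\<lambda>Z. \<^bold>\<Sum>i. A (f y i) Z *\<^sub>R f y i"
  have lin: "linear ?B"
    by (intro linear_compose_sum ballI linear_scaleR_const A)
  have B: "g y X (matrix ?B *v Z) = A X Z" for X Z
  proof -
    have "A X Z = A (\<^bold>\<Sum>i. (e y i \<bullet> X) *\<^sub>R f y i) Z"
      using frame_expansion[OF y] by simp
    also have "\<dots> = (\<^bold>\<Sum>i. (e y i \<bullet> X) * A (f y i) Z)"
      by (simp add: linear_sum[OF A(2)] linear_scale[OF A(2)])
    finally show ?thesis
      using g_f[OF y] g_commute[OF y, of X]
      by (simp add: matrix_apply[OF lin] linear_sum[OF linear_g_right[OF y]] linear_scale[OF linear_g_right[OF y]] mult.commute)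
  qed
  show eq: "sharp (g y) A = matrix ?B"
    unfolding sharp_def
  proof (rule the_equality)
    fix C assume "\<forall>X Y. g y X (C *v Y) = A X Y"
    then have "C *v Y = matrix ?B *v Y" for Y using B by (intro g_eqI[OF y]) simp
    then show "C = matrix ?B" by (simp add: matrix_eq)
  qed (use B in blast)
  show "g y X (sharp (g y) A *v Z) = A X Z" by (simp only: eq B)
qed

lemma matrix_eq_by_metric:
  assumes y: "y \<in> V" and "\<And>X Z. g y X (A *v Z) = g y X (B *v Z)"
  shows "A = B"
  using assms(2) by (intro matrix_eq[THEN iffD2] allI g_eqI[OF y]) 

lemma matrix_differentiable:
  fixes B :: "R7 \<Rightarrow> real^7^7"
  assumes "\<And>X Z. (\<lambda>y. X \<bullet> (B y *v Z)) differentiable (at x)"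
  shows "B differentiable (at x)"
  unfolding differentiable_componentwise_within[of B]
proof
  fix b :: "real^7^7" assume "b \<in> Basis"
  then obtain i j where b: "b = axis i (axis j 1)"
    by (auto simp: Basis_vec_def)
  have "B y \<bullet> b = axis i 1 \<bullet> (B y *v axis j 1)" for y
    by (simp add: b inner_axis inner_axis' matrix_vector_mult_basis column_def)
  then show "(\<lambda>y. B y \<bullet> b) differentiable (at x)" using assms by simp
qed

lemma sharp_differentiable:
  assumes x: "x \<in> V" and A: "\<And>y X. y \<in> V \<Longrightarrow> linear (A y X)" "\<And>y Z. y \<in> V \<Longrightarrow> linear (\<lambda>X. A y X Z)"
    and d: "\<And>i Z. (\<lambda>y. A y (f y i) Z) differentiable (at x)"
  shows "(\<lambda>y. sharp (g y) (A y)) differentiable (at x)"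
proof (rule matrix_differentiable)
  fix X Z
  show "(\<lambda>y. X \<bullet> (sharp (g y) (A y) *v Z)) differentiable (at x)"
  proof (rule differentiable_cong_open[OF open_V x])
    fix y assume y: "y \<in> V"
    have "linear (\<lambda>Z. \<^bold>\<Sum>i. A y (f y i) Z *\<^sub>R f y i)"
      by (intro linear_compose_sum ballI linear_scaleR_const A y)
    then show "X \<bullet> (sharp (g y) (A y) *v Z) = (\<^bold>\<Sum>i. A y (f y i) Z * (X \<bullet> f y i))"
      by (simp add: sharp_mult(1)[OF y A[OF y]] matrix_apply inner_sum_right)
  qed (intro differentiable_sum differentiable_mult d differentiable_inner differentiable_const f_differentiable x ballI; simp)
qed

text \<open>
  The metric is parallel, so lowering the first index of an endomorphism commutes with covariant
  differentiation: the right-hand side is the derivative of the bilinear form \<open>g(\<cdot>, B \<cdot>)\<close>,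
  corrected in its two slots.
\<close>
lemma coeff_deriv_End:
  assumes x: "x \<in> V" and B: "B differentiable (at x)"
  shows "g x X ((D B x v + conn_End g x v (B x)) *v Z)
    = D (\<lambda>y. g y X (B y *v Z)) x v - g x (\<Gamma> x v X) (B x *v Z) - g x X (B x *v \<Gamma> x v Z)"
proof -
  have bl: "bounded_linear (\<lambda>M::real^7^7. M *v Z)"
    by (rule linear_conv_bounded_linear[THEN iffD1], rule linearI)
      (simp_all add: matrix_vector_mult_add_rdistrib scaleR_matrix_vector_assoc)
  have hd: "((\<lambda>y. B y *v Z) has_derivative (\<lambda>v. D B x v *v Z)) (at x)"
    by (rule bounded_linear.has_derivative[OF bl D_has_derivative[OF B]])
  have dB: "D (\<lambda>y. B y *v Z) x v = D B x v *v Z"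
    by (rule D_eqI[OF hd])
  have df: "(\<lambda>y. B y *v Z) differentiable (at x)" using hd differentiable_def by blast
  have "D (\<lambda>y. metric_tensor g y (map (\<lambda>s. s y) [\<lambda>_. X, \<lambda>y. B y *v Z])) x v
    = cov \<Gamma> (metric_tensor g) x v (map (\<lambda>s. s x) [\<lambda>_. X, \<lambda>y. B y *v Z])
     + (\<Sum>i<2. metric_tensor g x ((map (\<lambda>s. s x) [\<lambda>_. X, \<lambda>y. B y *v Z])
         [i := D ([\<lambda>_. X, \<lambda>y. B y *v Z] ! i) x v + \<Gamma> x v (([\<lambda>_. X, \<lambda>y. B y *v Z] ! i) x)]))"
    by (rule cov_leibniz[OF x C1_metric]) (auto simp: df elim!: less_2_cases')
  then have "D (\<lambda>y. g y X (B y *v Z)) x v = g x (\<Gamma> x v X) (B x *v Z) + g x X (D B x v *v Z + \<Gamma> x v (B x *v Z))"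
    by (simp add: cov_metric[OF x] metric_tensor_def numeral_2_eq_2 dB)
  then show ?thesis
    by (simp add: conn_End_def matrix_vector_mult_add_rdistrib matrix_vector_mult_diff_rdistrib
        matrix_vector_mul_assoc[symmetric] matrix_apply[OF linear_\<Gamma>_right[OF x]]
        linear_add[OF linear_g_right[OF x]] linear_diff[OF linear_g_right[OF x]])
qed

section \<open>Derivatives of the frame\<close>

text \<open>
  The covariant derivative of the frame vector \<open>f\<^sub>p\<close> along \<open>v\<close>.
\<close>
definition nabf :: "R7 \<Rightarrow> R7 \<Rightarrow> 7 \<Rightarrow> R7" where
  "nabf x v p = D (\<lambda>y. f y p) x v + \<Gamma> x v (f x p)"

lemma nabf_skew: assumes x: "x \<in> V" shows "g x (nabf x v p) (f x q) = - g x (f x p) (nabf x v q)"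
proof -
  let ?ss = "[\<lambda>y. f y p, \<lambda>y. f y q]"
  have "D (\<lambda>y. metric_tensor g y (map (\<lambda>s. s y) ?ss)) x v
    = cov \<Gamma> (metric_tensor g) x v (map (\<lambda>s. s x) ?ss)
     + (\<Sum>i<2. metric_tensor g x ((map (\<lambda>s. s x) ?ss)[i := D (?ss ! i) x v + \<Gamma> x v ((?ss ! i) x)]))"
    by (rule cov_leibniz[OF x C1_metric]) (auto simp: f_differentiable[OF x] elim!: less_2_cases')
  moreover have "D (\<lambda>y. g y (f y p) (f y q)) x v = D (\<lambda>y. if p = q then 1 else 0) x v"
    by (rule D_cong[OF open_V x]) (simp add: g_f_f)
  ultimately show ?thesis
    by (simp add: cov_metric[OF x] metric_tensor_def numeral_2_eq_2 nabf_def)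
qed

end

section \<open>Linear algebra of the model forms\<close>

lemma exhaust_7:
  fixes x :: 7
  shows "x = 0 \<or> x = 1 \<or> x = 2 \<or> x = 3 \<or> x = 4 \<or> x = 5 \<or> x = 6"
proof (induct x)
  case (of_int z)
  then have "z = 0 \<or> z = 1 \<or> z = 2 \<or> z = 3 \<or> z = 4 \<or> z = 5 \<or> z = 6" by fastforce
  then show ?case by auto
qed

lemma forall_7: "(\<forall>i::7. P i) \<longleftrightarrow> P 0 \<and> P 1 \<and> P 2 \<and> P 3 \<and> P 4 \<and> P 5 \<and> P 6"
  by (metis exhaust_7)

lemma UNIV_7: "(UNIV :: 7 set) = {0, 1, 2, 3, 4, 5, 6}"
  using exhaust_7 by auto

lemma sum_7: "sum h (UNIV :: 7 set) = h 0 + h 1 + h 2 + h 3 + h 4 + h 5 + h 6"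
  unfolding UNIV_7 by (simp add: ac_simps)

text \<open>
  The order of the indices serves to bring the arguments of skew symbols into a normal form. The
  index \<open>7\<close> of the standard three-form is \<open>0\<close> here.
\<close>
lemma index_less:
  "(0::7) < 1" "(0::7) < 2" "(0::7) < 3" "(0::7) < 4" "(0::7) < 5" "(0::7) < 6"
  "(1::7) < 2" "(1::7) < 3" "(1::7) < 4" "(1::7) < 5" "(1::7) < 6" "(2::7) < 3"
  "(2::7) < 4" "(2::7) < 5" "(2::7) < 6" "(3::7) < 4" "(3::7) < 5" "(3::7) < 6"
  "(4::7) < 5" "(4::7) < 6" "(5::7) < 6"
  by (simp_all add: less_bit1_def bit1.Rep_numeral bit1.Rep_0 bit1.Rep_1)

lemmas index_not_less = index_less[THEN order_less_not_sym]

lemma wedge_covectors_3: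
  "wedge_covectors [p, q, r] [u, v, w]
    = (p \<bullet> u) * (q \<bullet> v) * (r \<bullet> w) + (p \<bullet> v) * (q \<bullet> w) * (r \<bullet> u) + (p \<bullet> w) * (q \<bullet> u) * (r \<bullet> v)
    - (p \<bullet> u) * (q \<bullet> w) * (r \<bullet> v) - (p \<bullet> v) * (q \<bullet> u) * (r \<bullet> w) - (p \<bullet> w) * (q \<bullet> v) * (r \<bullet> u)"
proof -
  have set: "{..<3::nat} = {0, 1, 2}" by auto
  have f012: "finite {1::nat, 2}" "0 \<notin> {1::nat, 2}" and f12: "finite {2::nat}" "1 \<notin> {2::nat}"
    by auto
  have length: "length [u, v, w] = length [p, q, r]" "length [p, q, r] = 3" by simp_all
  have prod: "(\<Prod>i<3. [p, q, r] ! i \<bullet> [u, v, w] ! \<pi> i)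
    = (p \<bullet> [u, v, w] ! \<pi> 0) * (q \<bullet> [u, v, w] ! \<pi> 1) * (r \<bullet> [u, v, w] ! \<pi> 2)" for \<pi>
    by (simp add: eval_nat_numeral)
  show ?thesis
    unfolding wedge_covectors_def length prod set sum_over_permutations_insert[OF f012]
      sum_over_permutations_insert[OF f12] permutes_sing
    by (simp add: sign_swap_id permutation_swap_id sign_compose sign_id swap_id_eq algebra_simps)
qed

text \<open>
  The components of \<open>\<phi>\<close> in every frame dual to an adapted coframe.
\<close>
definition phi0 :: "7 \<Rightarrow> 7 \<Rightarrow> 7 \<Rightarrow> real" where
  "phi0 a b c = standard_three_form (\<lambda>i. axis i 1) [axis a 1, axis b 1, axis c 1]"

lemma phi0_swap: "phi0 b a c = - phi0 a b c" and phi0_rotate: "phi0 b c a = phi0 a b c"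
  by (simp_all add: phi0_def standard_three_form_def wedge_covectors_3 algebra_simps)

lemma phi0_diag: "phi0 p a a = 0"
  by (simp add: phi0_def standard_three_form_def wedge_covectors_3)

text \<open>
  The multiplication table of the imaginary octonions: two distinct indices lie on one line of the
  Fano plane.
\<close>
lemma phi0_rows:
  "phi0 p 0 1 = (if p = 6 then 1 else 0)" "phi0 p 0 2 = (if p = 5 then -1 else 0)"
  "phi0 p 0 3 = (if p = 4 then -1 else 0)" "phi0 p 0 4 = (if p = 3 then 1 else 0)"
  "phi0 p 0 5 = (if p = 2 then 1 else 0)" "phi0 p 0 6 = (if p = 1 then -1 else 0)"
  "phi0 p 1 0 = (if p = 6 then -1 else 0)" "phi0 p 1 2 = (if p = 3 then 1 else 0)"
  "phi0 p 1 3 = (if p = 2 then -1 else 0)" "phi0 p 1 4 = (if p = 5 then 1 else 0)"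
  "phi0 p 1 5 = (if p = 4 then -1 else 0)" "phi0 p 1 6 = (if p = 0 then 1 else 0)"
  "phi0 p 2 0 = (if p = 5 then 1 else 0)" "phi0 p 2 1 = (if p = 3 then -1 else 0)"
  "phi0 p 2 3 = (if p = 1 then 1 else 0)" "phi0 p 2 4 = (if p = 6 then 1 else 0)"
  "phi0 p 2 5 = (if p = 0 then -1 else 0)" "phi0 p 2 6 = (if p = 4 then -1 else 0)"
  "phi0 p 3 0 = (if p = 4 then 1 else 0)" "phi0 p 3 1 = (if p = 2 then 1 else 0)"
  "phi0 p 3 2 = (if p = 1 then -1 else 0)" "phi0 p 3 4 = (if p = 0 then -1 else 0)"
  "phi0 p 3 5 = (if p = 6 then -1 else 0)" "phi0 p 3 6 = (if p = 5 then 1 else 0)"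
  "phi0 p 4 0 = (if p = 3 then -1 else 0)" "phi0 p 4 1 = (if p = 5 then -1 else 0)"
  "phi0 p 4 2 = (if p = 6 then -1 else 0)" "phi0 p 4 3 = (if p = 0 then 1 else 0)"
  "phi0 p 4 5 = (if p = 1 then 1 else 0)" "phi0 p 4 6 = (if p = 2 then 1 else 0)"
  "phi0 p 5 0 = (if p = 2 then -1 else 0)" "phi0 p 5 1 = (if p = 4 then 1 else 0)"
  "phi0 p 5 2 = (if p = 0 then 1 else 0)" "phi0 p 5 3 = (if p = 6 then 1 else 0)"
  "phi0 p 5 4 = (if p = 1 then -1 else 0)" "phi0 p 5 6 = (if p = 3 then -1 else 0)"
  "phi0 p 6 0 = (if p = 1 then 1 else 0)" "phi0 p 6 1 = (if p = 0 then -1 else 0)"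
  "phi0 p 6 2 = (if p = 4 then 1 else 0)" "phi0 p 6 3 = (if p = 5 then -1 else 0)"
  "phi0 p 6 4 = (if p = 2 then -1 else 0)" "phi0 p 6 5 = (if p = 3 then 1 else 0)"
  using exhaust_7[of p]
  by (auto simp: phi0_def standard_three_form_def wedge_covectors_3 inner_axis_axis)

lemma contract_row:
  fixes h :: "7 \<Rightarrow> real"
  shows "(\<^bold>\<Sum>p. h p * (if p = r then s else 0)) = h r * s"
  by (simp add: if_distrib cong: if_cong)

lemma phi0_contract_two: "(\<^bold>\<Sum>i j. phi0 p i j * phi0 q i j) = (if p = q then 6 else 0)"
proof -
  have "\<forall>q. (\<^bold>\<Sum>i j. phi0 p i j * phi0 q i j) = (if p = q then 6 else 0)"
    unfolding forall_7 using exhaust_7[of p]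
    by (simp add: sum_7 phi0_rows phi0_diag)
  then show ?thesis by blast
qed

text \<open>
  The components of the three-form \<open>A \<cdot> \<phi>\<close>, for the action of matrices as derivations.
\<close>
definition act3 :: "(7 \<Rightarrow> 7 \<Rightarrow> real) \<Rightarrow> 7 \<Rightarrow> 7 \<Rightarrow> 7 \<Rightarrow> real" where
  "act3 A b c d = (\<^bold>\<Sum>p. A p b * phi0 p c d + A p c * phi0 b p d + A p d * phi0 b c p)"

text \<open>
  Up to a factor, the component of a skew matrix \<open>A\<close> in \<open>\<Lambda>\<^sup>2\<^sub>7 = \<real>\<^sup>7\<close>.
\<close>
definition contr :: "(7 \<Rightarrow> 7 \<Rightarrow> real) \<Rightarrow> 7 \<Rightarrow> real" where
  "contr A k = (\<^bold>\<Sum>i j. A i j * phi0 i j k)"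

lemma act3_rows: "act3 A b c d = (\<^bold>\<Sum>p. A p b * phi0 p c d) + (\<^bold>\<Sum>p. A p c * phi0 p d b)
   + (\<^bold>\<Sum>p. A p d * phi0 p b c)"
proof -
  have "phi0 b p d = phi0 p d b" "phi0 b c p = phi0 p b c" for p
    by (metis phi0_rotate)+
  then show ?thesis by (simp add: act3_def sum.distrib)
qed

lemma contr_rows: "contr A k = (\<^bold>\<Sum>p. A p 0 * phi0 p 0 k) + (\<^bold>\<Sum>p. A p 1 * phi0 p 1 k)
   + (\<^bold>\<Sum>p. A p 2 * phi0 p 2 k) + (\<^bold>\<Sum>p. A p 3 * phi0 p 3 k) + (\<^bold>\<Sum>p. A p 4 * phi0 p 4 k)
   + (\<^bold>\<Sum>p. A p 5 * phi0 p 5 k) + (\<^bold>\<Sum>p. A p 6 * phi0 p 6 k)"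
  unfolding contr_def by (subst sum.swap) (rule sum_7)

text \<open>
  For skew \<open>A\<close>, the three-form \<open>A \<cdot> \<phi>\<close> only depends on the component of \<open>A\<close> in \<open>\<Lambda>\<^sup>2\<^sub>7\<close>: it is the
  interior product of that vector with \<open>\<psi>\<close>, up to a factor.
\<close>
lemma act3_contr:
  assumes "\<And>p. A p p = 0" and "\<And>p q. q < p \<Longrightarrow> A p q = - A q p"
  shows
  "2 * act3 A 0 1 2 = contr A 4" "2 * act3 A 0 1 3 = - contr A 5"
  "2 * act3 A 0 1 4 = - contr A 2" "2 * act3 A 0 1 5 = contr A 3"
  "act3 A 0 1 6 = 0" "2 * act3 A 0 2 3 = - contr A 6"
  "2 * act3 A 0 2 4 = contr A 1" "act3 A 0 2 5 = 0"
  "2 * act3 A 0 2 6 = contr A 3" "act3 A 0 3 4 = 0"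
  "2 * act3 A 0 3 5 = - contr A 1" "2 * act3 A 0 3 6 = - contr A 2"
  "2 * act3 A 0 4 5 = - contr A 6" "2 * act3 A 0 4 6 = contr A 5"
  "2 * act3 A 0 5 6 = - contr A 4" "act3 A 1 2 3 = 0"
  "2 * act3 A 1 2 4 = - contr A 0" "2 * act3 A 1 2 5 = - contr A 6"
  "2 * act3 A 1 2 6 = contr A 5" "2 * act3 A 1 3 4 = - contr A 6"
  "2 * act3 A 1 3 5 = contr A 0" "2 * act3 A 1 3 6 = contr A 4"
  "act3 A 1 4 5 = 0" "2 * act3 A 1 4 6 = - contr A 3"
  "2 * act3 A 1 5 6 = - contr A 2" "2 * act3 A 2 3 4 = contr A 5"
  "2 * act3 A 2 3 5 = - contr A 4" "2 * act3 A 2 3 6 = contr A 0"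
  "2 * act3 A 2 4 5 = contr A 3" "act3 A 2 4 6 = 0"
  "2 * act3 A 2 5 6 = contr A 1" "2 * act3 A 3 4 5 = - contr A 2"
  "2 * act3 A 3 4 6 = contr A 1" "act3 A 3 5 6 = 0"
  "2 * act3 A 4 5 6 = contr A 0"
  by (simp_all add: act3_rows contr_rows phi0_rows contract_row phi0_diag assms index_less)

lemma act3_swap: "act3 A c b d = - act3 A b c d" "act3 A b d c = - act3 A b c d"
proof -
  define S where "S x y z = (\<^bold>\<Sum>p. A p x * phi0 p y z)" for x y z
  have "phi0 p z y + phi0 p y z = 0" for p y z
    using phi0_rotate phi0_swap by (metis add.left_inverse)
  then have "S x z y + S x y z = 0" for x y z
    by (simp add: S_def sum.distrib[symmetric] distrib_left[symmetric])
  from this[of b d c] this[of d c b] this[of c b d] this[of b c d] this[of c d b] this[of d b c]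
  show "act3 A c b d = - act3 A b c d" "act3 A b d c = - act3 A b c d"
    unfolding act3_rows S_def[symmetric] by linarith+
qed

text \<open>
  The stabiliser of \<open>\<phi>\<close> in \<open>so(7)\<close> is the kernel \<open>\<Lambda>\<^sup>2\<^sub>1\<^sub>4\<close> of the contraction with \<open>\<phi>\<close>.
\<close>
lemma act3_zero_iff:
  assumes skew: "\<And>p q. A p q = - A q p"
  shows "(\<forall>b c d. act3 A b c d = 0) \<longleftrightarrow> (\<forall>k. contr A k = 0)"
proof -
  have diag: "A p p = 0" for p using skew[of p p] by simp
  have order: "q < p \<Longrightarrow> A p q = - A q p" for p q by (rule skew)
  note table = act3_contr[of A, OF diag order]
  have repeat: "act3 A b b d = 0" "act3 A b c c = 0" for b c d
    using act3_swap(1)[of A b b d] act3_swap(2)[of A b c c] by simp_all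
  show ?thesis
  proof
    assume "\<forall>b c d. act3 A b c d = 0"
    then have *: "act3 A b c d = 0" for b c d by blast
    show "\<forall>k. contr A k = 0"
      using table unfolding forall_7 by (simp add: *)
  next
    assume *: "\<forall>k. contr A k = 0"
    have "\<forall>b c d. b < c \<longrightarrow> c < d \<longrightarrow> act3 A b c d = 0"
      using table unfolding forall_7 by (simp add: * index_less index_not_less)
    then have sorted: "act3 A b c d = 0" if "b < c" "c < d" for b c d
      using that by blast
    show "\<forall>b c d. act3 A b c d = 0"
    proof (intro allI)
      fix b c d :: 7
      consider "b = c" | "c = d" | "b = d" | "b < c" "c < d" | "b < d" "d < c" | "c < b" "b < d"
        | "c < d" "d < b" | "d < b" "b < c" | "d < c" "c < b"
        by (cases b c rule: linorder_cases; cases c d rule: linorder_cases; cases b d rule: linorder_cases; blast)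
      then show "act3 A b c d = 0"
        by cases (metis repeat sorted act3_swap neg_0_equal_iff_equal)+
    qed
  qed
qed

text \<open>
  \<open>E\<close> is the Levi-Civita symbol, given by the properties that are needed to compute the Hodge star
  of \<open>\<phi>\<close>.
\<close>
locale orientation_symbol =
  fixes E :: "7 list \<Rightarrow> real"
  assumes E_swap: "length xs + length ys = 5 \<Longrightarrow> E (xs @ a # b # ys) = - E (xs @ b # a # ys)"
    and E_unit: "E [1, 2, 3, 4, 5, 6, 7] = 1"
begin

text \<open>
  The components of \<open>\<psi> = *\<phi>\<close>.
\<close>
definition \<psi>0 :: "7 \<Rightarrow> 7 \<Rightarrow> 7 \<Rightarrow> 7 \<Rightarrow> real" where
  "\<psi>0 a b c d = (1 / 6) * (\<^bold>\<Sum>i j k. phi0 i j k * E [i, j, k, a, b, c, d])"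

lemma E_swaps:
  "E [b, a, c, d, e, f, g] = - E [a, b, c, d, e, f, g]"
  "E [a, c, b, d, e, f, g] = - E [a, b, c, d, e, f, g]"
  "E [a, b, d, c, e, f, g] = - E [a, b, c, d, e, f, g]"
  "E [a, b, c, e, d, f, g] = - E [a, b, c, d, e, f, g]"
  "E [a, b, c, d, f, e, g] = - E [a, b, c, d, e, f, g]"
  "E [a, b, c, d, e, g, f] = - E [a, b, c, d, e, f, g]"
  using E_swap[of "[]" "[c, d, e, f, g]" b a] E_swap[of "[a]" "[d, e, f, g]" c b]
    E_swap[of "[a, b]" "[e, f, g]" d c] E_swap[of "[a, b, c]" "[f, g]" e d]
    E_swap[of "[a, b, c, d]" "[g]" f e] E_swap[of "[a, b, c, d, e]" "[]" g f]
  by simp_all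

lemma E_repeat:
  "E [a, a, c, d, e, f, g] = 0" "E [a, b, b, d, e, f, g] = 0" "E [a, b, c, c, e, f, g] = 0"
  "E [a, b, c, d, d, f, g] = 0" "E [a, b, c, d, e, e, g] = 0" "E [a, b, c, d, e, f, f] = 0"
  using E_swaps(1)[of a a c d e f g] E_swaps(2)[of a b b d e f g] E_swaps(3)[of a b c c e f g]
    E_swaps(4)[of a b c d d f g] E_swaps(5)[of a b c d e e g] E_swaps(6)[of a b c d e f f]
  by simp_all

lemma E_sort:
  "b < a \<Longrightarrow> E [a, b, c, d, e, f, g] = - E [b, a, c, d, e, f, g]"
  "c < b \<Longrightarrow> E [a, b, c, d, e, f, g] = - E [a, c, b, d, e, f, g]"
  "d < c \<Longrightarrow> E [a, b, c, d, e, f, g] = - E [a, b, d, c, e, f, g]"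
  "e < d \<Longrightarrow> E [a, b, c, d, e, f, g] = - E [a, b, c, e, d, f, g]"
  "f < e \<Longrightarrow> E [a, b, c, d, e, f, g] = - E [a, b, c, d, f, e, g]"
  "g < f \<Longrightarrow> E [a, b, c, d, e, f, g] = - E [a, b, c, d, e, g, f]"
  by (rule E_swaps)+

lemma E_unit': "E [0, 1, 2, 3, 4, 5, 6] = 1"
proof -
  \<comment> \<open>Moving the index \<open>7 = 0\<close> to the front takes six transpositions, an even number.\<close>
  have "(7::7) = 0" by simp
  then have "E [1, 2, 3, 4, 5, 6, 0] = 1" using E_unit by metis
  then show ?thesis by (simp add: E_sort index_less)
qed

text \<open>
  Each line of the Fano plane occurs in the triple sum with its six orderings.
\<close>
lemma \<psi>0_lines: "\<psi>0 a b c d = E [1, 2, 3, a, b, c, d] + E [1, 4, 5, a, b, c, d]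
   + E [0, 1, 6, a, b, c, d] + E [2, 4, 6, a, b, c, d] - E [0, 2, 5, a, b, c, d]
   - E [0, 3, 4, a, b, c, d] - E [3, 5, 6, a, b, c, d]"
proof -
  define F where "F j k = (\<^bold>\<Sum>i. E [i, j, k, a, b, c, d] * phi0 i j k)" for j k
  have "(\<^bold>\<Sum>i j k. phi0 i j k * E [i, j, k, a, b, c, d])
    = (\<^bold>\<Sum>j k. F j k)"
    unfolding F_def by (subst sum.swap, rule sum.cong[OF refl], subst sum.swap) (simp add: mult.commute)
  also have "\<dots> = 6 * (E [1, 2, 3, a, b, c, d] + E [1, 4, 5, a, b, c, d]
   + E [0, 1, 6, a, b, c, d] + E [2, 4, 6, a, b, c, d] - E [0, 2, 5, a, b, c, d]
   - E [0, 3, 4, a, b, c, d] - E [3, 5, 6, a, b, c, d])"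
    unfolding sum_7 unfolding F_def phi0_rows contract_row phi0_diag
    by (simp add: E_sort(1,2) index_less)
  finally show ?thesis by (simp add: \<psi>0_def)
qed

lemma \<psi>0_swaps:
  "\<psi>0 b a c d = - \<psi>0 a b c d" "\<psi>0 a c b d = - \<psi>0 a b c d" "\<psi>0 a b d c = - \<psi>0 a b c d"
  by (simp_all add: \<psi>0_lines E_swaps(4)[of _ _ _ b a] E_swaps(5)[of _ _ _ _ c b] E_swaps(6)[of _ _ _ _ _ d c])

lemma \<psi>0_sort:
  "b < a \<Longrightarrow> \<psi>0 a b c d = - \<psi>0 b a c d" "c < b \<Longrightarrow> \<psi>0 a b c d = - \<psi>0 a c b d"
  "d < c \<Longrightarrow> \<psi>0 a b c d = - \<psi>0 a b d c"
  by (rule \<psi>0_swaps)+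

lemma \<psi>0_repeat: "\<psi>0 a a c d = 0" "\<psi>0 a b b d = 0" "\<psi>0 a b c c = 0"
  using \<psi>0_swaps(1)[of a a c d] \<psi>0_swaps(2)[of a b b d] \<psi>0_swaps(3)[of a b c c] by simp_all

lemma \<psi>0_values:
  "\<psi>0 0 1 2 3 = 0" "\<psi>0 0 1 2 4 = 1" "\<psi>0 0 1 2 5 = 0"
  "\<psi>0 0 1 2 6 = 0" "\<psi>0 0 1 3 4 = 0" "\<psi>0 0 1 3 5 = -1"
  "\<psi>0 0 1 3 6 = 0" "\<psi>0 0 1 4 5 = 0" "\<psi>0 0 1 4 6 = 0"
  "\<psi>0 0 1 5 6 = 0" "\<psi>0 0 2 3 4 = 0" "\<psi>0 0 2 3 5 = 0"
  "\<psi>0 0 2 3 6 = -1" "\<psi>0 0 2 4 5 = 0" "\<psi>0 0 2 4 6 = 0"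
  "\<psi>0 0 2 5 6 = 0" "\<psi>0 0 3 4 5 = 0" "\<psi>0 0 3 4 6 = 0"
  "\<psi>0 0 3 5 6 = 0" "\<psi>0 0 4 5 6 = -1" "\<psi>0 1 2 3 4 = 0"
  "\<psi>0 1 2 3 5 = 0" "\<psi>0 1 2 3 6 = 0" "\<psi>0 1 2 4 5 = 0"
  "\<psi>0 1 2 4 6 = 0" "\<psi>0 1 2 5 6 = -1" "\<psi>0 1 3 4 5 = 0"
  "\<psi>0 1 3 4 6 = -1" "\<psi>0 1 3 5 6 = 0" "\<psi>0 1 4 5 6 = 0"
  "\<psi>0 2 3 4 5 = 1" "\<psi>0 2 3 4 6 = 0" "\<psi>0 2 3 5 6 = 0"
  "\<psi>0 2 4 5 6 = 0" "\<psi>0 3 4 5 6 = 0"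
  by (simp_all add: \<psi>0_lines E_sort E_repeat E_unit' index_less)

lemma \<psi>0_rows:
  "\<psi>0 p 0 1 2 = (if p = 4 then -1 else 0)" "\<psi>0 p 0 1 3 = (if p = 5 then 1 else 0)"
  "\<psi>0 p 0 1 4 = (if p = 2 then 1 else 0)" "\<psi>0 p 0 1 5 = (if p = 3 then -1 else 0)"
  "\<psi>0 p 0 1 6 = 0" "\<psi>0 p 0 2 3 = (if p = 6 then 1 else 0)"
  "\<psi>0 p 0 2 4 = (if p = 1 then -1 else 0)" "\<psi>0 p 0 2 5 = 0"
  "\<psi>0 p 0 2 6 = (if p = 3 then -1 else 0)" "\<psi>0 p 0 3 4 = 0"
  "\<psi>0 p 0 3 5 = (if p = 1 then 1 else 0)" "\<psi>0 p 0 3 6 = (if p = 2 then 1 else 0)"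
  "\<psi>0 p 0 4 5 = (if p = 6 then 1 else 0)" "\<psi>0 p 0 4 6 = (if p = 5 then -1 else 0)"
  "\<psi>0 p 0 5 6 = (if p = 4 then 1 else 0)" "\<psi>0 p 1 2 3 = 0"
  "\<psi>0 p 1 2 4 = (if p = 0 then 1 else 0)" "\<psi>0 p 1 2 5 = (if p = 6 then 1 else 0)"
  "\<psi>0 p 1 2 6 = (if p = 5 then -1 else 0)" "\<psi>0 p 1 3 4 = (if p = 6 then 1 else 0)"
  "\<psi>0 p 1 3 5 = (if p = 0 then -1 else 0)" "\<psi>0 p 1 3 6 = (if p = 4 then -1 else 0)"
  "\<psi>0 p 1 4 5 = 0" "\<psi>0 p 1 4 6 = (if p = 3 then 1 else 0)"
  "\<psi>0 p 1 5 6 = (if p = 2 then 1 else 0)" "\<psi>0 p 2 3 4 = (if p = 5 then -1 else 0)"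
  "\<psi>0 p 2 3 5 = (if p = 4 then 1 else 0)" "\<psi>0 p 2 3 6 = (if p = 0 then -1 else 0)"
  "\<psi>0 p 2 4 5 = (if p = 3 then -1 else 0)" "\<psi>0 p 2 4 6 = 0"
  "\<psi>0 p 2 5 6 = (if p = 1 then -1 else 0)" "\<psi>0 p 3 4 5 = (if p = 2 then 1 else 0)"
  "\<psi>0 p 3 4 6 = (if p = 1 then -1 else 0)" "\<psi>0 p 3 5 6 = 0"
  "\<psi>0 p 4 5 6 = (if p = 0 then -1 else 0)"
  using exhaust_7[of p] by (auto simp: \<psi>0_sort \<psi>0_repeat \<psi>0_values index_less)

text \<open>
  The components of the four-form \<open>A \<cdot> \<psi>\<close>.
\<close>
definition act4 :: "(7 \<Rightarrow> 7 \<Rightarrow> real) \<Rightarrow> 7 \<Rightarrow> 7 \<Rightarrow> 7 \<Rightarrow> 7 \<Rightarrow> real" where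
  "act4 A a b c d = (\<^bold>\<Sum>p. A p a * \<psi>0 p b c d + A p b * \<psi>0 a p c d + A p c * \<psi>0 a b p d + A p d * \<psi>0 a b c p)"

lemma act4_rows: "act4 A a b c d = (\<^bold>\<Sum>p. A p a * \<psi>0 p b c d) - (\<^bold>\<Sum>p. A p b * \<psi>0 p a c d)
   + (\<^bold>\<Sum>p. A p c * \<psi>0 p a b d) - (\<^bold>\<Sum>p. A p d * \<psi>0 p a b c)"
proof -
  have "\<psi>0 a p c d = - \<psi>0 p a c d" "\<psi>0 a b p d = \<psi>0 p a b d" "\<psi>0 a b c p = - \<psi>0 p a b c" for p
    using \<psi>0_swaps(1)[of a p c d] \<psi>0_swaps(2)[of a p b d] \<psi>0_swaps(1)[of a p b d]
      \<psi>0_swaps(3)[of a b p c] \<psi>0_swaps(2)[of a p b c] \<psi>0_swaps(1)[of a p b c] by simp_all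
  then show ?thesis by (simp add: act4_def sum.distrib sum_subtractf)
qed

text \<open>
  Here \<open>w a\<close> is the connection form of an adapted frame in the direction \<open>f\<^sub>a\<close>, and the numbers
  \<^term>\<open>contr (w a) k\<close> are the \<open>49\<close> components of the intrinsic torsion. The hypotheses are \<open>d\<phi> = 0\<close> and
  \<open>d\<psi> = 0\<close>. These linear equations fall into eight independent blocks of seven equations: one for the
  diagonal components \<open>a = k\<close>, and for each index \<open>q\<close> one for the six components whose indices \<open>a, k\<close>
  lie on a line of the Fano plane with \<open>q\<close>. Each block has only the zero solution.
\<close>
theorem torsion_vanishes:
  fixes w :: "7 \<Rightarrow> 7 \<Rightarrow> 7 \<Rightarrow> real"
  assumes skew: "\<And>v p q. w v p q = - w v q p"
    and dphi: "\<And>a b c d. act3 (w a) b c d - act3 (w b) a c d + act3 (w c) a b d - act3 (w d) a b c = 0"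
    and dpsi: "\<And>a b c d e. act4 (w a) b c d e - act4 (w b) a c d e + act4 (w c) a b d e
        - act4 (w d) a b c e + act4 (w e) a b c d = 0"
  shows "contr (w v) k = 0"
proof -
  have diag: "w v p p = 0" for v p using skew[of v p p] by simp
  have order: "q < p \<Longrightarrow> w v p q = - w v q p" for v p q by (rule skew)
  note evaluate = act3_rows contr_rows act4_rows phi0_rows contract_row phi0_diag \<psi>0_rows
    diag order index_less
  have "contr (w 1) 5 = 0" "contr (w 2) 6 = 0" "contr (w 3) 0 = 0"
    "contr (w 5) 1 = 0" "contr (w 6) 2 = 0" "contr (w 0) 3 = 0"
    using dphi[of 1 2 3 4] dphi[of 0 1 4 6] dphi[of 0 2 4 5] dphi[of 3 4 5 6]
      dpsi[of 1 2 4 5 6] dpsi[of 0 1 3 4 5] dpsi[of 0 2 3 4 6]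
    by (simp_all add: evaluate)
  moreover
  have "contr (w 1) 4 = 0" "contr (w 2) 0 = 0" "contr (w 3) 6 = 0"
    "contr (w 4) 1 = 0" "contr (w 6) 3 = 0" "contr (w 0) 2 = 0"
    using dphi[of 1 2 3 5] dphi[of 0 1 5 6] dphi[of 2 4 5 6] dphi[of 0 3 4 5]
      dpsi[of 0 1 2 4 5] dpsi[of 1 3 4 5 6] dpsi[of 0 2 3 5 6]
    by (simp_all add: evaluate)
  moreover
  have "contr (w 1) 0 = 0" "contr (w 2) 4 = 0" "contr (w 3) 5 = 0"
    "contr (w 4) 2 = 0" "contr (w 5) 3 = 0" "contr (w 0) 1 = 0"
    using dphi[of 1 2 3 6] dphi[of 1 4 5 6] dphi[of 0 2 5 6] dphi[of 0 3 4 6]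
      dpsi[of 0 1 2 4 6] dpsi[of 0 1 3 5 6] dpsi[of 2 3 4 5 6]
    by (simp_all add: evaluate)
  moreover
  have "contr (w 1) 6 = 0" "contr (w 2) 5 = 0" "contr (w 3) 4 = 0"
    "contr (w 4) 3 = 0" "contr (w 5) 2 = 0" "contr (w 6) 1 = 0"
    using dphi[of 0 1 2 3] dphi[of 0 1 4 5] dphi[of 0 2 4 6] dphi[of 0 3 5 6]
      dpsi[of 0 1 2 5 6] dpsi[of 0 1 3 4 6] dpsi[of 0 2 3 4 5]
    by (simp_all add: evaluate)
  moreover
  have "contr (w 1) 3 = 0" "contr (w 3) 1 = 0" "contr (w 4) 6 = 0"
    "contr (w 5) 0 = 0" "contr (w 6) 4 = 0" "contr (w 0) 5 = 0"
    using dphi[of 1 2 4 5] dphi[of 0 1 2 6] dphi[of 0 2 3 4] dphi[of 2 3 5 6]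
      dpsi[of 1 2 3 4 6] dpsi[of 0 1 2 3 5] dpsi[of 0 2 4 5 6]
    by (simp_all add: evaluate)
  moreover
  have "contr (w 2) 3 = 0" "contr (w 3) 2 = 0" "contr (w 4) 5 = 0"
    "contr (w 5) 4 = 0" "contr (w 6) 0 = 0" "contr (w 0) 6 = 0"
    using dphi[of 1 2 4 6] dphi[of 0 1 2 5] dphi[of 0 1 3 4] dphi[of 1 3 5 6]
      dpsi[of 1 2 3 4 5] dpsi[of 0 1 2 3 6] dpsi[of 0 1 4 5 6]
    by (simp_all add: evaluate)
  moreover
  have "contr (w 1) 1 = 0" "contr (w 2) 2 = 0" "contr (w 3) 3 = 0"
    "contr (w 4) 4 = 0" "contr (w 5) 5 = 0" "contr (w 6) 6 = 0"
    "contr (w 0) 0 = 0"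
    using dphi[of 0 1 2 4] dphi[of 1 2 5 6] dphi[of 1 3 4 6] dphi[of 0 1 3 5] dphi[of 2 3 4 5] dphi[of 0 2 3 6] dphi[of 0 4 5 6]
      
    by (simp_all add: evaluate)
  moreover
  have "contr (w 1) 2 = 0" "contr (w 2) 1 = 0" "contr (w 4) 0 = 0"
    "contr (w 5) 6 = 0" "contr (w 6) 5 = 0" "contr (w 0) 4 = 0"
    using dphi[of 1 3 4 5] dphi[of 0 1 3 6] dphi[of 2 3 4 6] dphi[of 0 2 3 5]
      dpsi[of 0 1 2 3 4] dpsi[of 1 2 3 5 6] dpsi[of 0 3 4 5 6]
    by (simp_all add: evaluate)
  ultimately have "\<forall>v k. contr (w v) k = 0" unfolding forall_7 by simp
  then show ?thesis by blast
qed

end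

section \<open>Index lists, alternating forms and adapted frames\<close>

lemma sum_index_lists_0: "(\<Sum>I | length I = 0. h I) = h []"
  by simp

lemma finite_index_lists: "finite {I :: 'a::finite list. length I = n}"
  using finite_lists_length_eq[of "UNIV :: 'a set" n] by simp

lemma sum_index_lists_Suc:
  "(\<Sum>I | length I = Suc n. h I) = (\<Sum>i\<in>UNIV. \<Sum>I | length I = n. h (i # I :: 'a::finite list))"
proof -
  have "(\<Sum>I | length I = Suc n. h I) = (\<Sum>(i, I)\<in>UNIV \<times> {I. length I = n}. h (i # I))"
    by (rule sum.reindex_bij_witness[of _ "\<lambda>(i, I). i # I" "\<lambda>I. (hd I, tl I)"])
      (auto simp: length_Suc_conv)
  then show ?thesis by (simp add: sum.cartesian_product)
qed

lemmas sum_index_lists = sum_index_lists_0 sum_index_lists_Suc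

lemma alt_form_length: "alt_form k \<alpha> \<Longrightarrow> length vs \<noteq> k \<Longrightarrow> \<alpha> vs = 0"
  by (simp add: alt_form_def)

lemma alt_form_repeat:
  assumes "alt_form k \<alpha>" "length vs = k" "i < j" "j < k" "vs ! i = vs ! j" shows "\<alpha> vs = 0"
proof -
  have "\<forall>vs i j. length vs = k \<and> i < j \<and> j < k \<and> vs ! i = vs ! j \<longrightarrow> \<alpha> vs = 0"
    using assms(1) by (simp add: alt_form_def)
  then show ?thesis using assms(2-) by blast
qed

lemma alt_form_append:
  fixes \<alpha> :: "real form"
  assumes \<alpha>: "alt_form (length us + k) \<alpha>"
  shows "alt_form k (\<lambda>vs. \<alpha> (us @ vs))"
  unfolding alt_form_def
proof (intro conjI allI impI)
  fix vs :: "R7 list" assume "length vs \<noteq> k"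
  then show "\<alpha> (us @ vs) = 0" by (intro alt_form_length[OF \<alpha>]) simp
next
  fix vs :: "R7 list" and i assume "length vs = k \<and> i < k"
  then show "linear (\<lambda>v. \<alpha> (us @ vs[i := v]))"
    using multilin_update[OF alt_form_multilin[OF \<alpha>], of "us @ vs" "length us + i"]
    by (simp add: list_update_append)
next
  fix vs :: "R7 list" and i j assume "length vs = k \<and> i < j \<and> j < k \<and> vs ! i = vs ! j"
  then show "\<alpha> (us @ vs) = 0"
    by (intro alt_form_repeat[OF \<alpha>, of _ "length us + i" "length us + j"]) (simp_all add: nth_append)
qed

lemma alt_form_cmult: "alt_form k \<alpha> \<Longrightarrow> alt_form k (\<lambda>vs. c * \<alpha> vs :: real)"
  unfolding alt_form_def by (auto intro!: linear_cmult)

lemma alt_form_diff: "alt_form k \<alpha> \<Longrightarrow> alt_form k \<beta> \<Longrightarrow> alt_form k (\<lambda>vs. \<alpha> vs - \<beta> vs :: real)"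
  unfolding alt_form_def by (auto intro!: linear_compose_sub)

lemma alt_form_sum: "(\<And>i. i \<in> S \<Longrightarrow> alt_form k (\<alpha> i)) \<Longrightarrow> alt_form k (\<lambda>vs. \<Sum>i\<in>S. \<alpha> i vs :: real)"
  unfolding alt_form_def by (auto intro!: linear_compose_sum sum.neutral)

lemma (in connection) ext_deriv_cov:
  assumes x: "x \<in> V" and \<alpha>: "alt_form k (\<alpha> x)" and len: "length vs = Suc k"
  shows "ext_cov_deriv conn_trivial \<alpha> x vs = (\<Sum>i<Suc k. (-1) ^ i * cov \<Gamma> \<alpha> x (vs ! i) (remove_nth i vs))"
proof -
  have len': "i < Suc k \<Longrightarrow> length (remove_nth i vs) = k" for i
    using len by (simp add: remove_nth_def)
  have "(\<Sum>i<Suc k. (-1) ^ i * cov \<Gamma> \<alpha> x (vs ! i) (remove_nth i vs))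
    = (\<Sum>i<Suc k. (-1) ^ i * D (\<lambda>y. \<alpha> y (remove_nth i vs)) x (vs ! i))
     - (\<Sum>i<Suc k. (-1) ^ i *\<^sub>R (\<Sum>j<k. \<alpha> x ((remove_nth i vs)[j := \<Gamma> x (vs ! i) (remove_nth i vs ! j)])))"
    unfolding sum_subtractf[symmetric]
    by (rule sum.cong) (auto simp: cov_def len' right_diff_distrib)
  also have "(\<Sum>i<Suc k. (-1) ^ i *\<^sub>R (\<Sum>j<k. \<alpha> x ((remove_nth i vs)[j := \<Gamma> x (vs ! i) (remove_nth i vs ! j)]))) = 0"
    by (rule torsion_terms_cancel[OF \<alpha> \<Gamma>_commute[OF x] len])
  finally show ?thesis
    by (simp add: ext_cov_deriv_def coeff_deriv_def conn_trivial_def len)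
qed

text \<open>
  Only the identity permutation contributes.
\<close>
lemma wedge_covectors_dual:
  assumes "length \<theta>s = n" "length vs = n"
    and "\<And>i j. i < n \<Longrightarrow> j < n \<Longrightarrow> \<theta>s ! i \<bullet> vs ! j = (if i = j then 1 else 0)"
  shows "wedge_covectors \<theta>s vs = 1"
proof -
  have zero: "(\<Prod>i<n. \<theta>s ! i \<bullet> vs ! \<pi> i) = 0" if \<pi>: "\<pi> permutes {..<n}" "\<pi> \<noteq> id" for \<pi>
  proof -
    obtain i where i: "i < n" "\<pi> i \<noteq> i"
      using \<pi> by (metis eq_id_iff lessThan_iff permutes_not_in)
    moreover have "\<pi> i < n" using i permutes_in_image[OF \<pi>(1)] by simp
    ultimately show ?thesis using assms(3)[of i "\<pi> i"] by (intro prod_zero) auto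
  qed
  have "(\<Sum>\<pi> | \<pi> permutes {..<n}. of_int (sign \<pi>) * (\<Prod>i<n. \<theta>s ! i \<bullet> vs ! \<pi> i))
    = (\<Sum>\<pi>\<in>{id}. of_int (sign \<pi>) * (\<Prod>i<n. \<theta>s ! i \<bullet> vs ! \<pi> i))"
    by (rule sum.mono_neutral_right) (auto simp: finite_permutations permutes_id zero)
  then show ?thesis using assms by (simp add: wedge_covectors_def)
qed

lemma wedge_covectors_cong:
  assumes "length \<theta>s = n" "length \<theta>s' = n" "length vs = n" "length vs' = n"
    and "\<And>i j. i < n \<Longrightarrow> j < n \<Longrightarrow> \<theta>s ! i \<bullet> vs ! j = \<theta>s' ! i \<bullet> vs' ! j"
  shows "wedge_covectors \<theta>s vs = wedge_covectors \<theta>s' vs'"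
proof -
  have "(\<Prod>i<n. \<theta>s ! i \<bullet> vs ! \<pi> i) = (\<Prod>i<n. \<theta>s' ! i \<bullet> vs' ! \<pi> i)" if "\<pi> permutes {..<n}" for \<pi>
    using permutes_in_image[OF that] by (intro prod.cong) (auto simp: assms(5))
  then show ?thesis using assms(1-4) by (simp add: wedge_covectors_def)
qed

context metric_frame
begin

lemma multilin_frame_zero:
  assumes y: "y \<in> V" and T: "multilin n T" and zero: "\<And>I. length I = n \<Longrightarrow> T (map (f y) I) = 0"
    and len: "length vs = n"
  shows "T vs = 0"
proof -
  have "\<forall>I. length I + length ws = n \<longrightarrow> T (map (f y) I @ ws) = 0" for ws
  proof (induction ws)
    case (Cons w ws)
    show ?case
    proof (intro allI impI)
      fix I :: "7 list" assume len: "length I + length (w # ws) = n"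
      have "linear (\<lambda>v. T (map (f y) I @ v # ws))"
        using len by (intro multilin_append[OF T]) simp
      from linear_frame_expansion[OF y this, of w]
      have "T (map (f y) I @ w # ws) = (\<^bold>\<Sum>i. (e y i \<bullet> w) *\<^sub>R T (map (f y) (I @ [i]) @ ws))"
        by simp
      also have "\<dots> = 0"
        using Cons.IH[rule_format, of "I @ [_]"] len by simp
      finally show "T (map (f y) I @ w # ws) = 0" .
    qed
  qed (use zero in simp)
  from this[of vs, rule_format, of "[]"] len show ?thesis by simp
qed

text \<open>
  The frame is exchanged one slot at a time, by \<open>contraction_independent\<close>; the lists \<open>us\<close> and \<open>us'\<close>
  of the proof hold the slots that come before.
\<close>
lemma inner_independent:
  fixes a :: "7 \<Rightarrow> R7"
  assumes y: "y \<in> V" and a: "\<And>i j. g y (a i) (a j) = (if i = j then 1 else (0::real))"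
    and \<alpha>: "multilin n \<alpha>" and \<beta>: "multilin (n + length ws) \<beta>"
  shows "(\<Sum>I | length I = n. \<alpha> (map a I) * \<beta> (map a I @ ws))
    = (\<Sum>I | length I = n. \<alpha> (map (f y) I) * \<beta> (map (f y) I @ ws))"
proof -
  have "(\<Sum>I | length I = m. \<alpha> (us @ map a I) * \<beta> (us' @ map a I @ ws))
    = (\<Sum>I | length I = m. \<alpha> (us @ map (f y) I) * \<beta> (us' @ map (f y) I @ ws))"
    if "length us + m = n" "length us' + m = n" for m us us'
    using that
  proof (induction m arbitrary: us us')
    case (Suc m)
    have "(\<Sum>I | length I = Suc m. \<alpha> (us @ map a I) * \<beta> (us' @ map a I @ ws))
      = (\<^bold>\<Sum>i. \<Sum>I | length I = m. \<alpha> ((us @ [a i]) @ map a I) * \<beta> ((us' @ [a i]) @ map a I @ ws))"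
      unfolding sum_index_lists_Suc by simp
    also have "\<dots> = (\<^bold>\<Sum>i. \<Sum>I | length I = m. \<alpha> ((us @ [a i]) @ map (f y) I) * \<beta> ((us' @ [a i]) @ map (f y) I @ ws))"
      using Suc.prems by (intro sum.cong refl Suc.IH) simp_all
    also have "\<dots> = (\<Sum>I | length I = m. \<^bold>\<Sum>i. \<alpha> ((us @ [a i]) @ map (f y) I) * \<beta> ((us' @ [a i]) @ map (f y) I @ ws))"
      by (rule sum.swap)
    also have "\<dots> = (\<Sum>I | length I = m. \<^bold>\<Sum>i. \<alpha> ((us @ [f y i]) @ map (f y) I) * \<beta> ((us' @ [f y i]) @ map (f y) I @ ws))"
    proof (rule sum.cong[OF refl])
      fix I :: "7 list" assume "I \<in> {I. length I = m}"
      then have "linear (\<lambda>u. \<alpha> (us @ u # map (f y) I))" "linear (\<lambda>v. \<beta> (us' @ v # map (f y) I @ ws))"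
        using Suc.prems by (auto intro!: multilin_append[OF \<alpha>] multilin_append[OF \<beta>])
      then show "(\<^bold>\<Sum>i. \<alpha> ((us @ [a i]) @ map (f y) I) * \<beta> ((us' @ [a i]) @ map (f y) I @ ws))
        = (\<^bold>\<Sum>i. \<alpha> ((us @ [f y i]) @ map (f y) I) * \<beta> ((us' @ [f y i]) @ map (f y) I @ ws))"
        using contraction_independent[OF y a, of "\<lambda>u v. \<alpha> (us @ u # map (f y) I) * \<beta> (us' @ v # map (f y) I @ ws)"]
        by (simp add: linear_cmult linear_cmult[of _ "\<beta> _", simplified mult.commute[of "\<beta> _"]])
    qed
    also have "\<dots> = (\<^bold>\<Sum>i. \<Sum>I | length I = m. \<alpha> ((us @ [f y i]) @ map (f y) I) * \<beta> ((us' @ [f y i]) @ map (f y) I @ ws))"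
      by (rule sum.swap)
    finally show ?case unfolding sum_index_lists_Suc by simp
  qed simp
  from this[of "[]" n "[]"] show ?thesis by simp
qed

lemma onb_orthonormal: "y \<in> V \<Longrightarrow> g y (onb (g y) i) (onb (g y) j) = (if i = j then 1 else 0)"
  unfolding onb_def
  using someI_ex[of "\<lambda>e. \<forall>i j. g y (e i) (e j) = (if i = j then 1 else 0)"] g_f_f by blast

lemma onb_expansion: "y \<in> V \<Longrightarrow> linear h \<Longrightarrow> (\<^bold>\<Sum>i. g y w (onb (g y) i) *\<^sub>R h (onb (g y) i)) = (h w :: 'b::real_vector)"
proof -
  assume y: "y \<in> V" and h: "linear h"
  have "(\<^bold>\<Sum>i. g y w (onb (g y) i) *\<^sub>R h (onb (g y) i)) = (\<^bold>\<Sum>i. g y w (f y i) *\<^sub>R h (f y i))"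
    by (rule contraction_independent[OF y onb_orthonormal[OF y], of "\<lambda>u v. g y w u *\<^sub>R h v"])
      (use y h in \<open>auto intro!: linear_compose_scale_right linear_scaleR_const linear_g_right\<close>)
  then show ?thesis
    using linear_frame_expansion[OF y h, of w] by (simp add: g_commute[OF y, of w] g_f[OF y])
qed

text \<open>
  When the components of \<open>T\<close> in the frame are constant, the Leibniz rule leaves only the derivatives
  of the frame.
\<close>
lemma cov_frame:
  assumes x: "x \<in> V" and T: "C1_tensor V n T" and const: "\<And>y. y \<in> V \<Longrightarrow> T y (map (f y) I) = c"
    and len: "length I = n"
  shows "cov \<Gamma> T x v (map (f x) I)
    = - (\<Sum>i<n. \<^bold>\<Sum>p. (e x p \<bullet> nabf x v (I ! i)) * T x (map (f x) (I[i := p])))"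
proof -
  let ?ss = "map (\<lambda>i y. f y i) I"
  have "D (\<lambda>y. T y (map (\<lambda>s. s y) ?ss)) x v
    = cov \<Gamma> T x v (map (\<lambda>s. s x) ?ss)
     + (\<Sum>i<n. T x ((map (\<lambda>s. s x) ?ss)[i := D (?ss ! i) x v + \<Gamma> x v ((?ss ! i) x)]))"
    by (rule cov_leibniz[OF x T]) (auto simp: len f_differentiable[OF x])
  moreover have "D (\<lambda>y. T y (map (\<lambda>s. s y) ?ss)) x v = D (\<lambda>y. c) x v"
    by (rule D_cong[OF open_V x]) (simp add: const o_def)
  moreover have "T x ((map (f x) I)[i := nabf x v (I ! i)])
    = (\<^bold>\<Sum>p. (e x p \<bullet> nabf x v (I ! i)) * T x (map (f x) (I[i := p])))" if "i < n" for i
    using linear_frame_expansion[OF x multilin_update[OF C1_multilin[OF T x], of "map (f x) I" i], of "nabf x v (I ! i)"] that len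
    by (simp add: map_update)
  ultimately show ?thesis by (simp add: o_def nabf_def len)
qed

end

section \<open>Torsion-free \<open>G\<^sub>2\<close> structures\<close>

text \<open>
  The Levi-Civita symbol of the order \<open>1, \<dots>, 7\<close>.
\<close>
definition eps :: "7 list \<Rightarrow> real" where
  "eps I = wedge_covectors (map (\<lambda>i. axis i 1) [1, 2, 3, 4, 5, 6, 7]) (map (\<lambda>i. axis i 1) I)"

locale torsion_free_frame = metric_frame +
  fixes \<phi> vol :: "R7 \<Rightarrow> real form"
  assumes V_nonempty: "V \<noteq> {}"
    and phi_alt: "y \<in> V \<Longrightarrow> alt_form 3 (\<phi> y)"
    and vol_alt: "y \<in> V \<Longrightarrow> alt_form 7 (vol y)"
    and phi_C2: "Ck_on 2 V (\<lambda>y. \<phi> y vs)"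
    and vol_C2: "Ck_on 2 V (\<lambda>y. vol y vs)"
    and phi_eq: "y \<in> V \<Longrightarrow> \<phi> y = standard_three_form (e y)"
    and vol_eq: "y \<in> V \<Longrightarrow> vol y = wedge_covectors [e y 1, e y 2, e y 3, e y 4, e y 5, e y 6, e y 7]"
    and dphi: "y \<in> V \<Longrightarrow> ext_cov_deriv conn_trivial \<phi> y = (\<lambda>_. 0)"
    and dpsi: "y \<in> V \<Longrightarrow> ext_cov_deriv conn_trivial (\<lambda>z. hodge_star (g z) (vol z) 3 (\<phi> z)) y = (\<lambda>_. 0)"
begin

definition \<psi> :: "R7 \<Rightarrow> real form" where "\<psi> y = hodge_star (g y) (vol y) 3 (\<phi> y)"

lemma phi_f: "y \<in> V \<Longrightarrow> \<phi> y [f y a, f y b, f y c] = phi0 a b c"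
proof -
  assume y: "y \<in> V"
  have "wedge_covectors [e y i, e y j, e y k] [f y a, f y b, f y c]
    = wedge_covectors [axis i 1, axis j 1, axis k 1] [axis a 1, axis b 1, axis c 1 :: R7]" for i j k
    unfolding wedge_covectors_3 e_f[OF y] inner_axis_axis by simp
  then show ?thesis by (simp only: phi_eq[OF y] phi0_def standard_three_form_def)
qed

lemma vol_f: assumes "y \<in> V" "length I = 7" shows "vol y (map (f y) I) = eps I"
proof -
  have "vol y = wedge_covectors (map (e y) [1, 2, 3, 4, 5, 6, 7])"
    by (simp add: vol_eq assms)
  then show ?thesis
    unfolding eps_def
    using assms by (auto intro!: wedge_covectors_cong[of _ 7] simp del: list.map simp: e_f inner_axis_axis)
qed

sublocale orientation_symbol eps
proof
  obtain y where y: "y \<in> V" using V_nonempty by blast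
  fix xs ys :: "7 list" and a b assume "length xs + length ys = 5"
  then show "eps (xs @ a # b # ys) = - eps (xs @ b # a # ys)"
    using alt_form_swap[OF vol_alt[OF y], of "map (f y) xs" "map (f y) ys" "f y a" "f y b"]
    by (simp flip: vol_f[OF y])
next
  show "eps [1, 2, 3, 4, 5, 6, 7] = 1"
    unfolding eps_def
  proof (rule wedge_covectors_dual[of _ 7])
    fix i j :: nat assume ij: "i < 7" "j < 7"
    have "distinct [1::7, 2, 3, 4, 5, 6, 7]" by simp
    then have "[1::7, 2, 3, 4, 5, 6, 7] ! i = [1::7, 2, 3, 4, 5, 6, 7] ! j \<longleftrightarrow> i = j"
      using ij by (subst nth_eq_iff_index_eq) simp_all
    then show "map (\<lambda>i. axis i 1 :: R7) [1, 2, 3, 4, 5, 6, 7] ! i \<bullet> map (\<lambda>i. axis i 1) [1, 2, 3, 4, 5, 6, 7] ! j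
       = (if i = j then 1 else 0)"
      using ij by (simp add: inner_axis_axis nth_map del: list.map nth_Cons_numeral)
  qed simp_all
qed

lemma C2_phi: "C2_tensor V 3 \<phi>"
  by (simp add: C2_tensor_def phi_C2 alt_form_multilin[OF phi_alt])

lemma C1_phi: "C1_tensor V 3 \<phi>"
  by (rule C2_imp_C1[OF C2_phi])

lemma C1_vol: "C1_tensor V 7 vol"
  by (rule C2_imp_C1) (simp add: C2_tensor_def vol_C2 alt_form_multilin[OF vol_alt])

text \<open>
  The basis in the definition of the Hodge star is chosen at each point separately. The frame
  depends differentiably on the point, so \<open>\<psi>\<close> can be differentiated in this form.
\<close>
lemma psi_eq:
  assumes y: "y \<in> V"
  shows "\<psi> y ws = (1 / 6) * (\<^bold>\<Sum>i j k. phi0 i j k * vol y ([f y i, f y j, f y k] @ ws))"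
proof (cases "length ws = 4")
  case True
  have "\<psi> y ws = (1 / 6) * (\<Sum>I | length I = 3. \<phi> y (map (f y) I) * vol y (map (f y) I @ ws))"
    unfolding \<psi>_def hodge_star_def
    using inner_independent[OF y onb_orthonormal[OF y] alt_form_multilin[OF phi_alt[OF y]], of ws "vol y"]
      alt_form_multilin[OF vol_alt[OF y]] True by (simp add: fact_numeral)
  then show ?thesis by (simp add: numeral_3_eq_3 sum_index_lists phi_f[OF y])
next
  case False
  then have zero: "vol y (us @ ws) = 0" if "length us = 3" for us
    using that by (intro alt_form_length[OF vol_alt[OF y]]) simp
  have "vol y ([f y i, f y j, f y k] @ ws) = 0" for i j k by (rule zero) simp
  then show ?thesis by (simp add: \<psi>_def hodge_star_def zero)
qed

lemma psi_alt: assumes y: "y \<in> V" shows "alt_form 4 (\<psi> y)"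
proof -
  have "alt_form 4 (\<lambda>ws. vol y ([f y i, f y j, f y k] @ ws))" for i j k
    using vol_alt[OF y] by (intro alt_form_append) simp
  then show ?thesis
    unfolding psi_eq[OF y, abs_def] by (intro alt_form_cmult alt_form_sum) auto
qed

lemma C1_psi: "C1_tensor V 4 \<psi>"
  unfolding C1_tensor_def
proof (intro ballI conjI allI impI)
  fix y and ws :: "R7 list" assume y: "y \<in> V" and len: "length ws = 4"
  have "(\<lambda>z. vol z ([f z i, f z j, f z k] @ ws)) differentiable (at y)" for i j k
  proof -
    let ?ss = "[\<lambda>z. f z i, \<lambda>z. f z j, \<lambda>z. f z k]"
    have "((\<lambda>z. vol z (map (\<lambda>s. s z) ?ss @ ws)) has_derivative
      (\<lambda>v. D (\<lambda>z. vol z (map (\<lambda>s. s y) ?ss @ ws)) y v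
         + (\<Sum>i<length ?ss. vol y ((map (\<lambda>s. s y) ?ss)[i := D (?ss ! i) y v] @ ws)))) (at y)"
      by (rule tensor_leibniz_aux[OF open_V y C1_vol]) (auto simp: len f_differentiable[OF y])
    then show ?thesis unfolding differentiable_def by auto
  qed
  then show "(\<lambda>z. \<psi> z ws) differentiable (at y)"
    by (intro differentiable_cong_open[OF open_V y psi_eq] differentiable_mult differentiable_const
        differentiable_sum ballI) auto
qed (rule alt_form_multilin[OF psi_alt])

lemma psi_f: "y \<in> V \<Longrightarrow> \<psi> y [f y a, f y b, f y c, f y d] = \<psi>0 a b c d"
  using vol_f[of y "[_, _, _, a, b, c, d]"] by (simp add: psi_eq \<psi>0_def)

lemma dpsi': "y \<in> V \<Longrightarrow> ext_cov_deriv conn_trivial \<psi> y = (\<lambda>_. 0)"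
  using dpsi by (simp add: \<psi>_def[abs_def])

text \<open>
  The connection form of the frame.
\<close>
definition \<omega> :: "R7 \<Rightarrow> R7 \<Rightarrow> 7 \<Rightarrow> 7 \<Rightarrow> real" where
  "\<omega> x v p b = e x p \<bullet> nabf x v b"

lemma \<omega>_skew: "x \<in> V \<Longrightarrow> \<omega> x v p q = - \<omega> x v q p"
  using nabf_skew[of x v p q] by (simp add: \<omega>_def g_f g_commute[of x "nabf x v p"])

lemma cov_phi_f: assumes x: "x \<in> V"
  shows "cov \<Gamma> \<phi> x v [f x b, f x c, f x d] = - act3 (\<omega> x v) b c d"
  using cov_frame[OF x C1_phi, of "[b, c, d]" "phi0 b c d" v] phi_f
  by (simp add: eval_nat_numeral phi_f[OF x] act3_def sum.distrib \<omega>_def)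

lemma cov_psi_f: assumes x: "x \<in> V"
  shows "cov \<Gamma> \<psi> x v [f x a, f x b, f x c, f x d] = - act4 (\<omega> x v) a b c d"
  using cov_frame[OF x C1_psi, of "[a, b, c, d]" "\<psi>0 a b c d" v] psi_f
  by (simp add: eval_nat_numeral psi_f[OF x] act4_def sum.distrib \<omega>_def)

text \<open>
  The theorem of Fernandez and Gray: closedness of \<open>\<phi>\<close> and \<open>\<psi>\<close> forces the connection form into \<open>g\<^sub>2\<close>.
  The equations are evaluated on the frame, where the derivatives of \<open>\<phi>\<close> and \<open>\<psi>\<close> are given by the
  action of the connection form.
\<close>
lemma act3_\<omega>: assumes x: "x \<in> V" shows "act3 (\<omega> x v) b c d = 0"
proof -
  have "contr (\<omega> x (f x a)) k = 0" for a k
  proof (rule torsion_vanishes[where w = "\<lambda>a. \<omega> x (f x a)"])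
    show "\<omega> x (f x v) p q = - \<omega> x (f x v) q p" for v p q by (rule \<omega>_skew[OF x])
    show "act3 (\<omega> x (f x a)) b c d - act3 (\<omega> x (f x b)) a c d + act3 (\<omega> x (f x c)) a b d
        - act3 (\<omega> x (f x d)) a b c = 0" for a b c d
      using ext_deriv_cov[where \<alpha> = \<phi>, OF x phi_alt[OF x], of "[f x a, f x b, f x c, f x d]"] dphi[OF x]
      by (simp add: eval_nat_numeral remove_nth_def cov_phi_f[OF x])
    show "act4 (\<omega> x (f x a)) b c d i - act4 (\<omega> x (f x b)) a c d i + act4 (\<omega> x (f x c)) a b d i
        - act4 (\<omega> x (f x d)) a b c i + act4 (\<omega> x (f x i)) a b c d = 0" for a b c d i
      using ext_deriv_cov[where \<alpha> = \<psi>, OF x psi_alt[OF x], of "[f x a, f x b, f x c, f x d, f x i]"] dpsi'[OF x]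
      by (simp add: eval_nat_numeral remove_nth_def cov_psi_f[OF x])
  qed
  then have zero: "act3 (\<omega> x (f x a)) b c d = 0" for a b c d
    using act3_zero_iff[of "\<omega> x (f x a)", OF \<omega>_skew[OF x]] by blast
  have "cov \<Gamma> \<phi> x v [f x b, f x c, f x d] = 0"
  proof -
    have "linear (\<lambda>v. nab \<Gamma> \<phi> x ([0, f x b, f x c, f x d][0 := v]))"
      by (rule multilin_update[OF C1_multilin[OF C1_nab[OF C2_phi] x]]) simp_all
    from linear_frame_expansion[OF x this, of v] show ?thesis
      by (simp add: cov_phi_f[OF x] zero)
  qed
  then show ?thesis by (simp add: cov_phi_f[OF x])
qed

theorem phi_parallel: assumes y: "y \<in> V" "length vs = 4" shows "nab \<Gamma> \<phi> y vs = 0"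
proof (rule multilin_frame_zero[OF y(1) _ _ y(2)])
  show "multilin 4 (nab \<Gamma> \<phi> y)" using C1_multilin[OF C1_nab[OF C2_phi] y(1)] by simp
  fix I :: "7 list" assume "length I = 4"
  then obtain a b c d where "I = [a, b, c, d]" by (auto simp: eval_nat_numeral length_Suc_conv)
  then show "nab \<Gamma> \<phi> y (map (f y) I) = 0" by (simp add: cov_phi_f[OF y(1)] act3_\<omega>[OF y(1)])
qed

lemma cov_phi: "x \<in> V \<Longrightarrow> length vs = 3 \<Longrightarrow> cov \<Gamma> \<phi> x v vs = 0"
  using phi_parallel[of x "v # vs"] by simp

text \<open>
  As \<open>\<phi>\<close> is parallel, the Ricci identity shows that the curvature annihilates it.
\<close>
lemma curvature_in_g2: assumes x: "x \<in> V"
  shows "contr (\<lambda>p b. e x p \<bullet> curv \<Gamma> x u v (f x b)) k = 0"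
proof -
  define A where "A = (\<lambda>p b. e x p \<bullet> curv \<Gamma> x u v (f x b))"
  have skew: "A p q = - A q p" for p q
    using curvature_skew[OF x, of u v "f x p" "f x q"]
    by (simp add: A_def g_f[OF x] g_commute[OF x, of "curv \<Gamma> x u v (f x p)"])
  have "act3 A b c d = 0" for b c d
  proof -
    have lin: "linear (\<lambda>v. \<phi> x (vs[i := v]))" if "length vs = 3" "i < 3" for vs i
      using multilin_update[OF alt_form_multilin[OF phi_alt[OF x]]] that .
    have par: "nab \<Gamma> (nab \<Gamma> \<phi>) x vs = 0" if "length vs = 5" for vs
      using parallel_second[OF x, of 3 \<phi> vs] phi_parallel that by simp
    have "(\<Sum>i<3. \<phi> x ([f x b, f x c, f x d][i := curv \<Gamma> x u v ([f x b, f x c, f x d] ! i)])) = 0"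
      using ricci_identity[OF x C2_phi, of "[f x b, f x c, f x d]" u v]
        par[of "[u, v, f x b, f x c, f x d]"] par[of "[v, u, f x b, f x c, f x d]"] by simp
    then show ?thesis
      using linear_frame_expansion[OF x lin[of "[0, f x c, f x d]" 0], of "curv \<Gamma> x u v (f x b)"]
        linear_frame_expansion[OF x lin[of "[f x b, 0, f x d]" 1], of "curv \<Gamma> x u v (f x c)"]
        linear_frame_expansion[OF x lin[of "[f x b, f x c, 0]" 2], of "curv \<Gamma> x u v (f x d)"]
      by (simp add: eval_nat_numeral phi_f[OF x] act3_def A_def sum.distrib)
  qed
  then show ?thesis
    using act3_zero_iff[of A, OF skew] by (auto simp: A_def)
qed

text \<open>
  By the pair symmetry, the form indices of the curvature lie in \<open>\<Lambda>\<^sup>2\<^sub>1\<^sub>4\<close> as its endomorphism indices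
  do.
\<close>
lemma curvature_form_part: assumes x: "x \<in> V"
  shows "(\<^bold>\<Sum>i j. phi0 i j k *\<^sub>R curv \<Gamma> x (f x i) (f x j) z) = 0"
proof (rule g_eqI[OF x])
  fix w
  have "g x w (curv \<Gamma> x (f x i) (f x j) z) = - (e x i \<bullet> curv \<Gamma> x z w (f x j))" for i j
    using curvature_pair_symmetry[OF x, of "f x i" "f x j" z w] curvature_skew[OF x, of z w "f x i" "f x j"]
    by (simp add: g_f[OF x] g_commute[OF x, of w])
  then have "g x w (\<^bold>\<Sum>i j. phi0 i j k *\<^sub>R curv \<Gamma> x (f x i) (f x j) z)
    = - contr (\<lambda>p b. e x p \<bullet> curv \<Gamma> x z w (f x b)) k"
    by (simp add: linear_sum[OF linear_g_right[OF x]] linear_scale[OF linear_g_right[OF x]] contr_def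
        sum_negf mult.commute)
  then show "g x w (\<^bold>\<Sum>i j. phi0 i j k *\<^sub>R curv \<Gamma> x (f x i) (f x j) z) = g x w 0"
    by (simp add: curvature_in_g2[OF x] linear_0[OF linear_g_right[OF x]])
qed

section \<open>Contraction with the three-form\<close>

text \<open>
  Contraction of the first three slots with \<open>\<phi>\<close>, the operation from which \<open>\<Pi>\<^sub>2\<close> and \<open>\<Pi>\<^sub>3\<close> are built.
\<close>
definition contract_phi :: "(R7 \<Rightarrow> real form) \<Rightarrow> R7 \<Rightarrow> real form" where
  "contract_phi H y zs = (\<^bold>\<Sum>p i j. phi0 p i j * H y ([f y p, f y i, f y j] @ zs))"

text \<open>
  Expanding \<open>\<nabla>\<^sub>v f\<^sub>p\<close> in the frame moves the connection form to the coefficients.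
\<close>
lemma nabf_transfer:
  fixes h :: "R7 \<Rightarrow> real"
  assumes x: "x \<in> V" and h: "linear h"
  shows "(\<^bold>\<Sum>p. c p * h (nabf x v p)) = (\<^bold>\<Sum>p. (\<^bold>\<Sum>q. \<omega> x v p q * c q) * h (f x p))"
proof -
  have "(\<^bold>\<Sum>p. c p * h (nabf x v p)) = (\<^bold>\<Sum>p q. \<omega> x v q p * c p * h (f x q))"
    using linear_frame_expansion[OF x h, of "nabf x v _"]
    by (simp add: \<omega>_def sum_distrib_left mult.assoc mult.left_commute)
  also have "\<dots> = (\<^bold>\<Sum>q p. \<omega> x v q p * c p * h (f x q))"
    by (rule sum.swap)
  finally show ?thesis by (simp add: sum_distrib_right)
qed

text \<open>
  The connection form lies in \<open>g\<^sub>2\<close>, so its action on \<open>\<phi>\<close> vanishes.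
\<close>
lemma contract_phi_nabf:
  fixes F :: "R7 \<Rightarrow> R7 \<Rightarrow> R7 \<Rightarrow> real"
  assumes x: "x \<in> V" and F: "\<And>v w. linear (\<lambda>u. F u v w)" "\<And>u w. linear (\<lambda>v. F u v w)" "\<And>u v. linear (\<lambda>w. F u v w)"
  shows "(\<^bold>\<Sum>p i j. phi0 p i j *
    (F (nabf x v p) (f x i) (f x j) + F (f x p) (nabf x v i) (f x j) + F (f x p) (f x i) (nabf x v j))) = 0"
proof -
  let ?F = "\<lambda>p i j. F (f x p) (f x i) (f x j)"
  have 1: "(\<^bold>\<Sum>p i j. phi0 p i j * F (nabf x v p) (f x i) (f x j))
    = (\<^bold>\<Sum>p i j. (\<^bold>\<Sum>q. \<omega> x v p q * phi0 q i j) * ?F p i j)"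
  proof -
    have "(\<^bold>\<Sum>p i j. phi0 p i j * F (nabf x v p) (f x i) (f x j))
      = (\<^bold>\<Sum>i j p. phi0 p i j * F (nabf x v p) (f x i) (f x j))"
      by (rule sum7_rotate)
    also have "\<dots> = (\<^bold>\<Sum>i j p. (\<^bold>\<Sum>q. \<omega> x v p q * phi0 q i j) * ?F p i j)"
      by (simp only: nabf_transfer[OF x F(1)])
    finally show ?thesis unfolding sum7_rotate[of "\<lambda>p i j. (\<^bold>\<Sum>q. \<omega> x v p q * phi0 q i j) * ?F p i j"] .
  qed
  have 2: "(\<^bold>\<Sum>p i j. phi0 p i j * F (f x p) (nabf x v i) (f x j))
    = (\<^bold>\<Sum>p i j. (\<^bold>\<Sum>q. \<omega> x v i q * phi0 p q j) * ?F p i j)"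
    by (rule sum.cong[OF refl], subst (1 2) sum.swap) (simp only: nabf_transfer[OF x F(2)])
  have 3: "(\<^bold>\<Sum>p i j. phi0 p i j * F (f x p) (f x i) (nabf x v j))
    = (\<^bold>\<Sum>p i j. (\<^bold>\<Sum>q. \<omega> x v j q * phi0 p i q) * ?F p i j)"
    by (simp only: nabf_transfer[OF x F(3)])
  have act: "(\<^bold>\<Sum>q. \<omega> x v p q * phi0 q i j) + (\<^bold>\<Sum>q. \<omega> x v i q * phi0 p q j)
    + (\<^bold>\<Sum>q. \<omega> x v j q * phi0 p i q) = 0" for p i j
  proof -
    have "(\<^bold>\<Sum>q. \<omega> x v p q * phi0 q i j) + (\<^bold>\<Sum>q. \<omega> x v i q * phi0 p q j)
      + (\<^bold>\<Sum>q. \<omega> x v j q * phi0 p i q) = - act3 (\<omega> x v) p i j"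
      unfolding act3_def sum.distrib[symmetric] sum_negf[symmetric]
      using \<omega>_skew[OF x, of v p] \<omega>_skew[OF x, of v i] \<omega>_skew[OF x, of v j]
      by (intro sum.cong refl) simp
    then show ?thesis by (simp add: act3_\<omega>[OF x])
  qed
  have "(\<^bold>\<Sum>p i j. phi0 p i j *
    (F (nabf x v p) (f x i) (f x j) + F (f x p) (nabf x v i) (f x j) + F (f x p) (f x i) (nabf x v j)))
    = (\<^bold>\<Sum>p i j. ((\<^bold>\<Sum>q. \<omega> x v p q * phi0 q i j) + (\<^bold>\<Sum>q. \<omega> x v i q * phi0 p q j)
    + (\<^bold>\<Sum>q. \<omega> x v j q * phi0 p i q)) * ?F p i j)"
    by (simp only: distrib_left distrib_right sum.distrib 1 2 3)
  then show ?thesis by (simp add: act)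
qed

text \<open>
  The derivatives of the three frame vectors contribute nothing, by \<open>contract_phi_nabf\<close>; what
  remains of the Leibniz rule is the derivative of \<open>H\<close> and the corrections in the slots \<open>zs\<close>.
\<close>
theorem cov_contract_phi:
  assumes x: "x \<in> V" and H: "C1_tensor V (n + 3) H" and len: "length zs = n"
  shows "cov \<Gamma> (contract_phi H) x v zs = contract_phi (\<lambda>y. cov \<Gamma> H y v) x zs"
proof -
  let ?ss = "\<lambda>p i j. [\<lambda>y. f y p, \<lambda>y. f y i, \<lambda>y. f y j] @ map (\<lambda>z _. z) zs"
  let ?R = "\<lambda>u a b. \<Sum>l<n. H x ([u, a, b] @ zs[l := \<Gamma> x v (zs ! l)])"
  have map: "map (\<lambda>s. s y) (?ss p i j) = [f y p, f y i, f y j] @ zs" for y p i j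
    by (simp add: o_def)
  have sum3: "(\<Sum>l<n + 3. h l) = h 0 + h 1 + h 2 + (\<Sum>l<n. h (l + 3))" for h :: "nat \<Rightarrow> real"
    by (induction n) (simp_all add: eval_nat_numeral)
  have d: "?ss p i j ! l differentiable (at x)" if "l < n + 3" for l p i j
    using that len f_differentiable[OF x] by (auto simp: nth_append nth_Cons split: nat.split)
  have leib: "D (\<lambda>y. H y ([f y p, f y i, f y j] @ zs)) x v
     = cov \<Gamma> H x v ([f x p, f x i, f x j] @ zs)
      + (H x ([nabf x v p, f x i, f x j] @ zs) + H x ([f x p, nabf x v i, f x j] @ zs) + H x ([f x p, f x i, nabf x v j] @ zs))
      + ?R (f x p) (f x i) (f x j)" for p i j
    using cov_leibniz[OF x H, of "?ss p i j" v] len d[of _ p i j] unfolding map sum3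
    by (simp add: nabf_def numeral_3_eq_3)
  have diff: "(\<lambda>y. H y ([f y p, f y i, f y j] @ zs)) differentiable (at x)" for p i j
    using tensor_leibniz[OF open_V x H, of "?ss p i j"] len d[of _ p i j] unfolding map differentiable_def
    by auto
  have ml: "multilin (n + 3) (H x)" by (rule C1_multilin[OF H x])
  have zero: "(\<^bold>\<Sum>p i j. phi0 p i j *
      (H x ([nabf x v p, f x i, f x j] @ zs) + H x ([f x p, nabf x v i, f x j] @ zs) + H x ([f x p, f x i, nabf x v j] @ zs))) = 0"
    using multilin_append[OF ml, of "[]" "_ # _ # zs"] multilin_append[OF ml, of "[_]" "_ # zs"]
      multilin_append[OF ml, of "[_, _]" "zs"] len
    by (intro contract_phi_nabf[OF x, of "\<lambda>u a b. H x ([u, a, b] @ zs)"]) simp_all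
  have "((\<lambda>y. contract_phi H y zs) has_derivative (\<lambda>v. \<^bold>\<Sum>p i. \<Sum>j\<in>UNIV.
      phi0 p i j * D (\<lambda>y. H y ([f y p, f y i, f y j] @ zs)) x v)) (at x)"
    unfolding contract_phi_def
    by (intro has_derivative_sum has_derivative_mult_right D_has_derivative diff)
  from D_eqI[OF this, of v]
  have "D (\<lambda>y. contract_phi H y zs) x v
    = (\<^bold>\<Sum>p i j. phi0 p i j * D (\<lambda>y. H y ([f y p, f y i, f y j] @ zs)) x v)" .
  also have "\<dots> = contract_phi (\<lambda>y. cov \<Gamma> H y v) x zs
    + (\<^bold>\<Sum>p i j. phi0 p i j * ?R (f x p) (f x i) (f x j))"
  proof -
    have "phi0 p i j * D (\<lambda>y. H y ([f y p, f y i, f y j] @ zs)) x v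
      = phi0 p i j * cov \<Gamma> H x v ([f x p, f x i, f x j] @ zs)
       + phi0 p i j * (H x ([nabf x v p, f x i, f x j] @ zs) + H x ([f x p, nabf x v i, f x j] @ zs) + H x ([f x p, f x i, nabf x v j] @ zs))
       + phi0 p i j * ?R (f x p) (f x i) (f x j)" for p i j
      unfolding leib by (simp only: distrib_left)
    then show ?thesis
      using zero by (simp only: sum.distrib contract_phi_def add_0_right)
  qed
  also have "(\<^bold>\<Sum>p i j. phi0 p i j * ?R (f x p) (f x i) (f x j))
    = (\<Sum>l<n. contract_phi H x (zs[l := \<Gamma> x v (zs ! l)]))"
    unfolding contract_phi_def sum_distrib_left
    by (simp only: sum.swap[of _ "{..<n}"])
  finally show ?thesis by (simp add: cov_def[of _ "contract_phi H"] len)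
qed

end

section \<open>Wedge products with one-forms\<close>

text \<open>
  The wedge product of a one-form and a \<open>k\<close>-form, where \<open>B w us\<close> is the product of the two values.
  Exterior covariant derivatives and the curvature insertion are all of this shape.
\<close>
definition wedge_sum :: "nat \<Rightarrow> (R7 \<Rightarrow> real form) \<Rightarrow> real form" where
  "wedge_sum k B us = (\<Sum>i<Suc k. (-1) ^ i * B (us ! i) (remove_nth i us))"

lemma length_remove_nth: "i < length us \<Longrightarrow> length (remove_nth i us) = length us - 1"
  by (simp add: remove_nth_def)

lemma nth_remove_nth:
  "i < length us \<Longrightarrow> l < length us - 1 \<Longrightarrow> remove_nth i us ! l = us ! (if l < i then l else Suc l)"
  by (auto simp: remove_nth_def nth_append)

lemma remove_nth_update:
  assumes "i < length us" "j < length us"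
  shows "remove_nth i (us[j := w])
    = (if j = i then remove_nth i us else (remove_nth i us)[(if j < i then j else j - 1) := w])"
  using assms
  by (intro nth_equalityI) (auto simp: length_remove_nth nth_remove_nth nth_list_update)

lemma wedge_sum_cong:
  assumes "length us = Suc k" "\<And>w us. length us = k \<Longrightarrow> B w us = B' w us"
  shows "wedge_sum k B us = wedge_sum k B' us"
  unfolding wedge_sum_def by (rule sum.cong) (auto simp: assms length_remove_nth)

lemma wedge_sum_diff: "wedge_sum k (\<lambda>w us. B w us - B' w us) us = wedge_sum k B us - wedge_sum k B' us"
  by (simp only: wedge_sum_def sum_subtractf right_diff_distrib)

lemma wedge_sum_add: "wedge_sum k (\<lambda>w us. B w us + B' w us) us = wedge_sum k B us + wedge_sum k B' us"
  by (simp only: wedge_sum_def sum.distrib distrib_left)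

lemma multilin_wedge_sum:
  assumes B1: "\<And>us. length us = k \<Longrightarrow> linear (\<lambda>w. B w us)" and B2: "\<And>w. multilin k (B w)"
  shows "multilin (Suc k) (wedge_sum k B)"
  unfolding multilin_def
proof (intro allI impI, elim conjE)
  fix us :: "R7 list" and j assume len: "length us = Suc k" and j: "j < Suc k"
  have "linear (\<lambda>v. B (us[j := v] ! i) (remove_nth i (us[j := v])))" if i: "i < Suc k" for i
  proof (cases "j = i")
    case True
    then show ?thesis using B1[of "remove_nth i us"] i len by (simp add: remove_nth_update length_remove_nth)
  next
    case False
    then have "(if j < i then j else j - 1) < k" using i j by auto
    then show ?thesis
      using multilin_update[OF B2, of "remove_nth i us" "if j < i then j else j - 1" "us ! i"] False i j len
      by (simp add: remove_nth_update length_remove_nth)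
  qed
  then show "linear (\<lambda>v. wedge_sum k B (us[j := v]))"
    unfolding wedge_sum_def by (intro linear_compose_sum ballI linear_cmult) auto
qed

text \<open>
  An endomorphism \<open>L\<close> of the tangent space acts on forms as a derivation; this is its product rule.
\<close>
lemma wedge_sum_derivation:
  assumes len: "length us = Suc k"
  shows "(\<Sum>j<Suc k. wedge_sum k B (us[j := L (us ! j)]))
    = wedge_sum k (\<lambda>w us. B (L w) us + (\<Sum>l<k. B w (us[l := L (us ! l)]))) us"
proof -
  have "(\<Sum>j<Suc k. B (us[j := L (us ! j)] ! i) (remove_nth i (us[j := L (us ! j)])))
    = B (L (us ! i)) (remove_nth i us)
      + (\<Sum>l<k. B (us ! i) ((remove_nth i us)[l := L (remove_nth i us ! l)]))" if i: "i < Suc k" for i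
  proof -
    have "(\<Sum>j<Suc k. B (us[j := L (us ! j)] ! i) (remove_nth i (us[j := L (us ! j)])))
      = B (L (us ! i)) (remove_nth i us)
       + (\<Sum>j\<in>{..<Suc k} - {i}. B (us[j := L (us ! j)] ! i) (remove_nth i (us[j := L (us ! j)])))"
      using i len by (subst sum.remove[of _ i]) (auto simp: remove_nth_update)
    also have "(\<Sum>j\<in>{..<Suc k} - {i}. B (us[j := L (us ! j)] ! i) (remove_nth i (us[j := L (us ! j)])))
      = (\<Sum>l<k. B (us ! i) ((remove_nth i us)[l := L (remove_nth i us ! l)]))"
      by (rule sum.reindex_bij_witness[of _ "\<lambda>l. if l < i then l else Suc l" "\<lambda>j. if j < i then j else j - 1"])
        (use i len in \<open>auto simp: remove_nth_update nth_remove_nth split: if_splits\<close>)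
    finally show ?thesis .
  qed
  then have "(\<Sum>i<Suc k. (-1) ^ i * (\<Sum>j<Suc k. B (us[j := L (us ! j)] ! i) (remove_nth i (us[j := L (us ! j)]))))
    = wedge_sum k (\<lambda>w us. B (L w) us + (\<Sum>l<k. B w (us[l := L (us ! l)]))) us"
    unfolding wedge_sum_def by (intro sum.cong) auto
  then show ?thesis
    unfolding wedge_sum_def sum_distrib_left by (subst sum.swap) simp
qed

text \<open>
  Only the terms with \<open>l = i\<close> and \<open>l = j\<close> survive, and they are opposite.
\<close>
lemma alt_form_derivation_repeat:
  fixes \<alpha> :: "real form"
  assumes \<alpha>: "alt_form k \<alpha>" and vs: "length vs = k" "i < j" "j < k" "vs ! i = vs ! j"
  shows "(\<Sum>l<k. \<alpha> (vs[l := L (vs ! l)])) = 0"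
proof -
  let ?a = "vs ! j" let ?G = "L ?a"
  have lin: "linear (\<lambda>v. \<alpha> (ws[l := v]))" if "length ws = k" "l < k" for ws l
    using multilin_update[OF alt_form_multilin[OF \<alpha>] that] .
  have rep: "\<alpha> (vs[i := c, j := c]) = 0" for c
    by (rule alt_form_repeat[OF \<alpha>, of _ i j]) (use vs in simp_all)
  have add1: "\<alpha> (vs[i := u + u', j := w]) = \<alpha> (vs[i := u, j := w]) + \<alpha> (vs[i := u', j := w])" for u u' w
    using linear_add[OF lin[of "vs[j := w]" i], of u u'] vs by (simp add: list_update_swap[of i j])
  have add2: "\<alpha> (vs[i := u, j := w + w']) = \<alpha> (vs[i := u, j := w]) + \<alpha> (vs[i := u, j := w'])" for u w w'
    using linear_add[OF lin[of "vs[i := u]" j], of w w'] vs by simp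
  have "\<alpha> (vs[i := ?a, j := ?G]) + \<alpha> (vs[i := ?G, j := ?a]) = 0"
    using rep[of "?a + ?G"] rep[of ?a] rep[of ?G] unfolding add1 add2 by simp
  moreover have "vs[i := ?a, j := ?G] = vs[j := ?G]" "vs[i := ?G, j := ?a] = vs[i := ?G]"
    using vs list_update_id[of vs i] list_update_id[of vs j] by (simp_all add: list_update_swap[of i j])
  ultimately have "\<alpha> (vs[j := ?G]) + \<alpha> (vs[i := ?G]) = 0" by simp
  moreover have "\<alpha> (vs[l := L (vs ! l)]) = 0" if "l < k" "l \<noteq> i" "l \<noteq> j" for l
    by (rule alt_form_repeat[OF \<alpha>, of _ i j]) (use vs that in simp_all)
  then have "(\<Sum>l<k. \<alpha> (vs[l := L (vs ! l)])) = (\<Sum>l\<in>{i, j}. \<alpha> (vs[l := L (vs ! l)]))"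
    using vs by (intro sum.mono_neutral_right) auto
  ultimately show ?thesis using vs by simp
qed

section \<open>The canonical projections\<close>

lemma linear_inner_const: "linear (\<lambda>w. w \<bullet> b)"
  by (simp add: linearI inner_add_left)

context torsion_free_frame
begin

text \<open>
  The projections \<open>\<Pi>\<^sub>1\<close>, \<open>\<Pi>\<^sub>2\<close>, \<open>\<Pi>\<^sub>3\<close> in the frame. The constants come from
  \<open>\<phi>\<^sub>p\<^sub>i\<^sub>j \<phi>\<^sub>q\<^sub>i\<^sub>j = 6 \<delta>\<^sub>p\<^sub>q\<close> and \<open>\<phi>\<^sub>p\<^sub>i\<^sub>j \<phi>\<^sub>p\<^sub>i\<^sub>j = 42\<close>.
\<close>
definition proj :: "R7 \<Rightarrow> nat \<Rightarrow> 'w::real_vector form \<Rightarrow> 'w form" where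
  "proj y k \<alpha> vs =
    (if length vs \<noteq> k then 0
     else if k = 1 then \<alpha> vs
     else if k = 2 then (1 / 6) *\<^sub>R (\<^bold>\<Sum>p i. \<Sum>j\<in>UNIV.
        (phi0 p i j * \<phi> y (f y p # vs)) *\<^sub>R \<alpha> [f y i, f y j])
     else if k = 3 then (1 / 42) *\<^sub>R (\<^bold>\<Sum>p i. \<Sum>j\<in>UNIV.
        (phi0 p i j * \<phi> y vs) *\<^sub>R \<alpha> [f y p, f y i, f y j])
     else 0)"

lemma proj_map: "linear h \<Longrightarrow> h (proj y k \<alpha> vs) = proj y k (\<lambda>us. h (\<alpha> us)) vs"
  by (simp add: proj_def linear_sum linear_scale linear_0)

lemma proj_cong: "(\<And>us. length us = k \<Longrightarrow> \<alpha> us = \<beta> us) \<Longrightarrow> proj y k \<alpha> vs = proj y k \<beta> vs"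
  by (simp add: proj_def)

lemma proj_diff: "proj y k (\<lambda>us. \<alpha> us - \<beta> us) vs = proj y k \<alpha> vs - proj y k \<beta> vs"
  by (simp add: proj_def scaleR_diff_right sum_subtractf)

lemma proj_add: "proj y k (\<lambda>us. \<alpha> us + \<beta> us) vs = proj y k \<alpha> vs + proj y k \<beta> vs"
  by (simp add: proj_def scaleR_add_right sum.distrib)

lemma linear_proj:
  assumes "\<And>us. length us = k \<Longrightarrow> linear (\<lambda>X. \<alpha> X us :: real)"
  shows "linear (\<lambda>X. proj y k (\<alpha> X) vs)"
proof -
  consider "length vs = k" "k = 1" | "length vs = k" "k = 2" | "length vs = k" "k = 3"
    | "length vs \<noteq> k \<or> k \<notin> {1, 2, 3}" by auto
  then show ?thesis
  proof cases
    case 1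
    then show ?thesis by (simp add: proj_def assms)
  next
    case 2
    then have "proj y k (\<alpha> X) vs = (1 / 6) *\<^sub>R (\<^bold>\<Sum>p i. \<Sum>j\<in>UNIV.
        (phi0 p i j * \<phi> y (f y p # vs)) *\<^sub>R \<alpha> X [f y i, f y j])" for X
      by (simp add: proj_def)
    moreover have "linear (\<lambda>X. (1 / 6) *\<^sub>R (\<^bold>\<Sum>p i. \<Sum>j\<in>UNIV.
        (phi0 p i j * \<phi> y (f y p # vs)) *\<^sub>R \<alpha> X [f y i, f y j]))"
      using 2 by (intro linear_compose_scale_right linear_compose_sum ballI assms) simp
    ultimately show ?thesis by (simp only:)
  next
    case 3
    then have "proj y k (\<alpha> X) vs = (1 / 42) *\<^sub>R (\<^bold>\<Sum>p i. \<Sum>j\<in>UNIV.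
        (phi0 p i j * \<phi> y vs) *\<^sub>R \<alpha> X [f y p, f y i, f y j])" for X
      by (simp add: proj_def)
    moreover have "linear (\<lambda>X. (1 / 42) *\<^sub>R (\<^bold>\<Sum>p i. \<Sum>j\<in>UNIV.
        (phi0 p i j * \<phi> y vs) *\<^sub>R \<alpha> X [f y p, f y i, f y j]))"
      using 3 by (intro linear_compose_scale_right linear_compose_sum ballI assms) simp
    ultimately show ?thesis by (simp only:)
  next
    case 4
    then have "proj y k (\<alpha> X) vs = 0" for X by (auto simp: proj_def)
    then show ?thesis by (simp add: linear_zero)
  qed
qed

lemma proj_3:
  fixes \<alpha> :: "real form"
  assumes "length vs = 3"
  shows "proj y 3 \<alpha> vs = (\<^bold>\<Sum>p i j. phi0 p i j * \<alpha> [f y p, f y i, f y j]) / 42 * \<phi> y vs"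
proof -
  have "(\<^bold>\<Sum>p i j. (phi0 p i j * \<phi> y vs) *\<^sub>R \<alpha> [f y p, f y i, f y j])
    = (\<^bold>\<Sum>p i j. phi0 p i j * \<alpha> [f y p, f y i, f y j]) * \<phi> y vs"
    unfolding sum_distrib_right real_scaleR_def by (simp only: mult.assoc mult.commute[of "\<phi> y vs"])
  then show ?thesis by (simp add: proj_def assms)
qed

lemma form_inner_f:
  assumes y: "y \<in> V" and "multilin k \<alpha>" "multilin k \<beta>"
  shows "form_inner (g y) k \<alpha> \<beta> = (1 / fact k) * (\<Sum>I | length I = k. \<alpha> (map (f y) I) * \<beta> (map (f y) I))"
  using inner_independent[OF y onb_orthonormal[OF y], of k \<alpha> "[]" \<beta>] assms by (simp add: form_inner_def)

lemma can_forms_alt: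
  assumes y: "y \<in> V" and k: "k \<in> {1, 2, 3}" and \<gamma>: "\<gamma> \<in> can_forms (\<phi> y) k"
  shows "alt_form k \<gamma>"
proof -
  have "alt_form 2 (\<lambda>vs. \<phi> y (X # vs))" for X
    using alt_form_append[of "[X]" 2 "\<phi> y"] phi_alt[OF y] by (simp add: numeral_3_eq_3 numeral_2_eq_2)
  moreover have "alt_form 3 (\<lambda>vs. t * \<phi> y vs)" for t
    by (rule alt_form_cmult[OF phi_alt[OF y]])
  ultimately show ?thesis using k \<gamma> by (auto simp: can_forms_def)
qed

lemma can_forms_diff:
  assumes "y \<in> V" "k \<in> {1, 2, 3}" "\<beta> \<in> can_forms (\<phi> y) k" "\<gamma> \<in> can_forms (\<phi> y) k"
  shows "(\<lambda>vs. \<beta> vs - \<gamma> vs) \<in> can_forms (\<phi> y) k"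
proof -
  have d: "\<phi> y (X # vs) - \<phi> y (Z # vs) = \<phi> y ((X - Z) # vs)" for X Z vs
  proof (cases "length vs = 2")
    case True
    then show ?thesis
      using linear_diff[OF multilin_append[OF alt_form_multilin[OF phi_alt[OF assms(1)]], of "[]" vs]] by simp
  next
    case False
    then show ?thesis by (simp add: alt_form_length[OF phi_alt[OF assms(1)]])
  qed
  consider "k = 1" | "k = 2" | "k = 3" using assms(2) by auto
  then show ?thesis
  proof cases
    case 1
    then show ?thesis using assms by (auto simp: can_forms_def alt_form_diff)
  next
    case 2
    then obtain X Z where "\<beta> = (\<lambda>vs. \<phi> y (X # vs))" "\<gamma> = (\<lambda>vs. \<phi> y (Z # vs))"
      using assms by (auto simp: can_forms_def)
    then have "(\<lambda>vs. \<beta> vs - \<gamma> vs) = (\<lambda>vs. \<phi> y ((X - Z) # vs))" by (simp add: d)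
    then show ?thesis using 2 by (auto simp: can_forms_def)
  next
    case 3
    then obtain t s where "\<beta> = (\<lambda>vs. t * \<phi> y vs)" "\<gamma> = (\<lambda>vs. s * \<phi> y vs)"
      using assms by (auto simp: can_forms_def)
    then have "(\<lambda>vs. \<beta> vs - \<gamma> vs) = (\<lambda>vs. (t - s) * \<phi> y vs)" by (simp add: algebra_simps)
    then show ?thesis using 3 by (auto simp: can_forms_def)
  qed
qed

lemma proj_in_can_forms:
  assumes y: "y \<in> V" and k: "k \<in> {1, 2, 3}" and \<alpha>: "multilin k \<alpha>"
  shows "proj y k \<alpha> \<in> can_forms (\<phi> y) k"
proof -
  consider "k = 1" | "k = 2" | "k = 3" using k by auto
  then show ?thesis
  proof cases
    case 1
    then show ?thesis using \<alpha> by (auto simp: can_forms_def alt_form_def proj_def[abs_def] multilin_def)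
  next
    case 2
    define X where "X = (\<^bold>\<Sum>p. ((1 / 6) * (\<^bold>\<Sum>i j. phi0 p i j * \<alpha> [f y i, f y j])) *\<^sub>R f y p)"
    have "proj y k \<alpha> vs = \<phi> y (X # vs)" for vs
    proof (cases "length vs = 2")
      case True
      have lin: "linear (\<lambda>X. \<phi> y (X # vs))"
        using multilin_append[OF alt_form_multilin[OF phi_alt[OF y]], of "[]" vs] True by simp
      then show ?thesis
        by (simp add: X_def linear_sum[OF lin] linear_scale[OF lin] proj_def 2 True sum_distrib_left sum_distrib_right mult.assoc mult.left_commute mult.commute)
    next
      case False
      then show ?thesis by (simp add: proj_def 2 alt_form_length[OF phi_alt[OF y]])
    qed
    then show ?thesis using 2 by (auto simp: can_forms_def)
  next
    case 3
    define t where "t = (\<^bold>\<Sum>p i j. phi0 p i j * \<alpha> [f y p, f y i, f y j]) / 42"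
    have "proj y k \<alpha> = (\<lambda>vs. t * \<phi> y vs)"
    proof
      show "proj y k \<alpha> vs = t * \<phi> y vs" for vs
      proof (cases "length vs = 3")
        case True
        then show ?thesis using 3 by (simp only: proj_3 t_def)
      next
        case False
        then show ?thesis using 3 by (simp add: proj_def alt_form_length[OF phi_alt[OF y]])
      qed
    qed
    then show ?thesis using 3 by (auto simp: can_forms_def)
  qed
qed

lemma proj_orthogonal:
  assumes y: "y \<in> V" and k: "k \<in> {1, 2, 3}" and \<alpha>: "multilin k \<alpha>" and \<gamma>: "\<gamma> \<in> can_forms (\<phi> y) k"
  shows "form_inner (g y) k (\<lambda>vs. \<alpha> vs - proj y k \<alpha> vs) \<gamma> = 0"
proof -
  have mp: "multilin k (proj y k \<alpha>)"
    by (rule alt_form_multilin[OF can_forms_alt[OF y k proj_in_can_forms[OF y k \<alpha>]]])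
  have m1: "multilin k (\<lambda>vs. \<alpha> vs - proj y k \<alpha> vs)"
    using \<alpha> mp by (simp add: multilin_def linear_compose_sub)
  have m2: "multilin k \<gamma>" by (rule alt_form_multilin[OF can_forms_alt[OF y k \<gamma>]])
  have two: "(\<^bold>\<Sum>i j. (\<^bold>\<Sum>p. c p * phi0 p i j) * phi0 q i j) = 6 * c q" for c q
  proof -
    have "(\<^bold>\<Sum>i j. (\<^bold>\<Sum>p. c p * phi0 p i j) * phi0 q i j)
      = (\<^bold>\<Sum>i j p. c p * (phi0 p i j * phi0 q i j))"
      by (simp add: sum_distrib_right mult.assoc)
    also have "\<dots> = (\<^bold>\<Sum>p i j. c p * (phi0 p i j * phi0 q i j))"
      by (rule sum7_rotate[symmetric])
    also have "\<dots> = (\<^bold>\<Sum>p. c p * (if p = q then 6 else 0))"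
      by (simp only: sum_distrib_left[symmetric] phi0_contract_two)
    finally show ?thesis by (simp add: contract_row)
  qed
  consider "k = 1" | "k = 2" | "k = 3" using k by auto
  then show ?thesis
  proof cases
    case 1
    then show ?thesis by (simp add: form_inner_def proj_def)
  next
    case 2
    then obtain Z where Z: "\<gamma> = (\<lambda>vs. \<phi> y (Z # vs))" using \<gamma> by (auto simp: can_forms_def)
    define c where "c p = (1 / 6) * (\<^bold>\<Sum>i j. phi0 p i j * \<alpha> [f y i, f y j])" for p
    have proj: "proj y k \<alpha> [f y i, f y j] = (\<^bold>\<Sum>p. c p * phi0 p i j)" for i j
      by (simp add: proj_def 2 c_def phi_f[OF y] sum_distrib_left sum_distrib_right mult.assoc mult.left_commute mult.commute)
    have \<gamma>f: "\<gamma> [f y i, f y j] = (\<^bold>\<Sum>q. (e y q \<bullet> Z) * phi0 q i j)" for i j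
      using linear_frame_expansion[OF y multilin_append[OF alt_form_multilin[OF phi_alt[OF y]], of "[]" "[f y i, f y j]"], of Z]
      by (simp add: Z phi_f[OF y])
    have zero: "(\<^bold>\<Sum>i j. (\<alpha> [f y i, f y j] - proj y k \<alpha> [f y i, f y j]) * phi0 q i j) = 0" for q
      unfolding proj left_diff_distrib sum_subtractf two by (simp add: c_def mult.commute)
    have "(\<^bold>\<Sum>i j. (\<alpha> [f y i, f y j] - proj y k \<alpha> [f y i, f y j]) * \<gamma> [f y i, f y j])
      = (\<^bold>\<Sum>i j q. (e y q \<bullet> Z) * ((\<alpha> [f y i, f y j] - proj y k \<alpha> [f y i, f y j]) * phi0 q i j))"
      by (simp add: \<gamma>f sum_distrib_left mult.assoc mult.left_commute)
    also have "\<dots> = (\<^bold>\<Sum>q i j. (e y q \<bullet> Z) * ((\<alpha> [f y i, f y j] - proj y k \<alpha> [f y i, f y j]) * phi0 q i j))"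
      by (rule sum7_rotate[symmetric])
    also have "\<dots> = 0" by (simp only: sum_distrib_left[symmetric] zero mult_zero_right sum.neutral_const)
    finally show ?thesis
      unfolding form_inner_f[OF y m1 m2] using 2 by (simp add: numeral_2_eq_2 sum_index_lists)
  next
    case 3
    then obtain t where t: "\<gamma> = (\<lambda>vs. t * \<phi> y vs)" using \<gamma> by (auto simp: can_forms_def)
    define c where "c = (\<^bold>\<Sum>p i j. phi0 p i j * \<alpha> [f y p, f y i, f y j])"
    have proj: "proj y k \<alpha> [f y p, f y i, f y j] = c / 42 * phi0 p i j" for p i j
      by (simp add: 3 proj_3 c_def phi_f[OF y])
    have sq: "(\<^bold>\<Sum>p i j. phi0 p i j * phi0 p i j) = 42"
      by (simp add: phi0_contract_two)
    have "(\<^bold>\<Sum>p i j. (\<alpha> [f y p, f y i, f y j] - proj y k \<alpha> [f y p, f y i, f y j]) * \<gamma> [f y p, f y i, f y j])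
      = (\<^bold>\<Sum>p i j. t * (phi0 p i j * \<alpha> [f y p, f y i, f y j]) - t * c / 42 * (phi0 p i j * phi0 p i j))"
      by (simp add: proj t phi_f[OF y] algebra_simps)
    also have "\<dots> = t * c - t * c / 42 * 42"
      by (simp only: sum_subtractf sum_distrib_left[symmetric] sq c_def[symmetric])
    finally show ?thesis
      unfolding form_inner_f[OF y m1 m2] using 3 by (simp add: numeral_3_eq_3 sum_index_lists)
  qed
qed

text \<open>
  Uniqueness: the difference of two candidates is a canonical form orthogonal to itself.
\<close>
lemma can_proj_real_eq:
  assumes y: "y \<in> V" and k: "k \<in> {1, 2, 3}" and \<alpha>: "multilin k \<alpha>"
  shows "can_proj_real (g y) (\<phi> y) k \<alpha> = proj y k \<alpha>"
  unfolding can_proj_real_def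
proof (rule the_equality)
  show "proj y k \<alpha> \<in> can_forms (\<phi> y) k \<and>
      (\<forall>\<gamma>\<in>can_forms (\<phi> y) k. form_inner (g y) k (\<lambda>vs. \<alpha> vs - proj y k \<alpha> vs) \<gamma> = 0)"
    using proj_in_can_forms[OF y k \<alpha>] proj_orthogonal[OF y k \<alpha>] by blast
next
  fix \<beta> assume \<beta>: "\<beta> \<in> can_forms (\<phi> y) k \<and> (\<forall>\<gamma>\<in>can_forms (\<phi> y) k. form_inner (g y) k (\<lambda>vs. \<alpha> vs - \<beta> vs) \<gamma> = 0)"
  define \<delta> where "\<delta> = (\<lambda>vs. \<beta> vs - proj y k \<alpha> vs)"
  have \<delta>: "\<delta> \<in> can_forms (\<phi> y) k"
    unfolding \<delta>_def using can_forms_diff[OF y k] \<beta> proj_in_can_forms[OF y k \<alpha>] by blast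
  have alt: "alt_form k \<delta>" by (rule can_forms_alt[OF y k \<delta>])
  have ml: "multilin k \<delta>" by (rule alt_form_multilin[OF alt])
  have "form_inner (g y) k \<delta> \<delta> = form_inner (g y) k (\<lambda>vs. \<alpha> vs - proj y k \<alpha> vs) \<delta>
      - form_inner (g y) k (\<lambda>vs. \<alpha> vs - \<beta> vs) \<delta>"
    unfolding form_inner_def right_diff_distrib[symmetric] sum_subtractf[symmetric]
    by (simp add: \<delta>_def algebra_simps)
  also have "\<dots> = 0" using \<beta> \<delta> proj_orthogonal[OF y k \<alpha> \<delta>] by simp
  finally have "(\<Sum>I | length I = k. \<delta> (map (f y) I) * \<delta> (map (f y) I)) = 0"
    by (simp add: form_inner_f[OF y ml ml])
  then have "\<delta> (map (f y) I) = 0" if "length I = k" for I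
    using that by (subst (asm) sum_nonneg_eq_0_iff) (auto simp: finite_index_lists)
  then have "\<delta> vs = 0" for vs
    using multilin_frame_zero[OF y ml] alt_form_length[OF alt] by blast
  then show "\<beta> = proj y k \<alpha>" by (simp add: \<delta>_def fun_eq_iff)
qed

lemma can_proj_eq:
  fixes \<alpha> :: "'w::euclidean_space form"
  assumes y: "y \<in> V" and k: "k \<in> {1, 2, 3}" and \<alpha>: "\<And>b. multilin k (\<lambda>us. \<alpha> us \<bullet> b)"
  shows "can_proj (g y) (\<phi> y) k \<alpha> vs = proj y k \<alpha> vs"
proof -
  have "can_proj (g y) (\<phi> y) k \<alpha> vs = (\<Sum>b\<in>Basis. (proj y k \<alpha> vs \<bullet> b) *\<^sub>R b)"
    by (simp add: can_proj_def can_proj_real_eq[OF y k \<alpha>] proj_map[OF linear_inner_const])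
  then show ?thesis by (simp add: euclidean_representation)
qed

lemma cov_cong:
  assumes x: "x \<in> V" and eq: "\<And>y zs. y \<in> V \<Longrightarrow> length zs = length vs \<Longrightarrow> T y zs = S y zs"
  shows "cov \<Gamma> T x v vs = cov \<Gamma> S x v vs"
  using D_cong[OF open_V x, of "\<lambda>y. T y vs" "\<lambda>y. S y vs"] by (simp add: cov_def eq x)

lemma cov_cmult:
  "(\<lambda>y. T y vs) differentiable (at x) \<Longrightarrow> cov \<Gamma> (\<lambda>y zs. c * T y zs) x v vs = c * cov \<Gamma> T x v vs"
  by (simp add: cov_def D_cmult sum_distrib_left right_diff_distrib)

lemma contract_phi_differentiable:
  assumes x: "x \<in> V" and H: "C1_tensor V (n + 3) H" and len: "length zs = n"
  shows "(\<lambda>y. contract_phi H y zs) differentiable (at x)"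
proof -
  let ?ss = "\<lambda>p i j. [\<lambda>y. f y p, \<lambda>y. f y i, \<lambda>y. f y j] @ map (\<lambda>z _. z) zs"
  have map: "map (\<lambda>s. s y) (?ss p i j) = [f y p, f y i, f y j] @ zs" for y p i j
    by (simp add: o_def)
  have d: "?ss p i j ! l differentiable (at x)" if "l < n + 3" for l p i j
    using that len f_differentiable[OF x] by (auto simp: nth_append nth_Cons split: nat.split)
  have "(\<lambda>y. H y ([f y p, f y i, f y j] @ zs)) differentiable (at x)" for p i j
    using tensor_leibniz[OF open_V x H, of "?ss p i j"] len d[of _ p i j] unfolding map differentiable_def
    by auto
  then show ?thesis
    unfolding contract_phi_def
    by (intro differentiable_sum differentiable_mult differentiable_const ballI) auto
qed

text \<open>
  The projections are parallel. For \<open>k = 2\<close> and \<open>k = 3\<close> they are, up to a constant, the contraction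
  with \<open>\<phi>\<close> of a product \<open>P\<close> of \<open>\<phi>\<close> and \<open>H\<close>, in which the slots are arranged such that the contracted
  ones come first; then \<open>cov_contract_phi\<close> applies. The first argument \<open>X\<close> is the coefficient slot.
\<close>
lemma cov_proj:
  assumes x: "x \<in> V" and k: "k \<in> {1, 2, 3}" and H: "C1_tensor V (Suc k) H"
    and T: "\<And>y X vs. y \<in> V \<Longrightarrow> T y (X # vs) = proj y k (\<lambda>us. H y (X # us)) vs"
  shows "cov \<Gamma> T x v (X # vs) = proj x k (\<lambda>us. cov \<Gamma> H x v (X # us)) vs"
    and "(\<lambda>y. T y (X # vs)) differentiable (at x)"
proof -
  have ml: "linear (\<lambda>w. H y (us @ w # ws))" if "y \<in> V" "length us + length ws = k" for y us ws
    using that by (intro multilin_append[OF C1_multilin[OF H]]) auto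
  have mlp: "linear (\<lambda>w. \<phi> y (us @ w # ws))" if "y \<in> V" "length us + length ws = 2" for y us ws
    using that by (intro multilin_append[OF alt_form_multilin[OF phi_alt]]) auto
  have dH: "(\<lambda>y. H y vs) differentiable (at y)" if "y \<in> V" "length vs = Suc k" for y vs
    by (rule C1_differentiable[OF H that])
  have dphi: "(\<lambda>y. \<phi> y vs) differentiable (at y)" if "y \<in> V" "length vs = 3" for y vs
    by (rule C1_differentiable[OF C1_phi that])
  have "cov \<Gamma> T x v (X # vs) = proj x k (\<lambda>us. cov \<Gamma> H x v (X # us)) vs
     \<and> (\<lambda>y. T y (X # vs)) differentiable (at x)"
  proof (cases "length vs = k")
    case False
    have "T y zs = 0" if "y \<in> V" "length zs = length (X # vs)" for y zs
      using that False T[of y "hd zs" "tl zs"] by (cases zs) (auto simp: proj_def)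
    then show ?thesis
      using cov_cong[OF x, of "X # vs" T "\<lambda>_ _. 0" v] differentiable_cong_open[OF open_V x, of "\<lambda>y. T y (X # vs)" "\<lambda>_. 0"] False
      by (simp add: proj_def cov_def)
  next
    case True
    consider "k = 1" | "k = 2" | "k = 3" using k by auto
    then show ?thesis
    proof cases
      case 1
      have "T y zs = H y zs" if "y \<in> V" "length zs = length (X # vs)" for y zs
        using that True 1 T[of y "hd zs" "tl zs"] by (cases zs) (auto simp: proj_def)
      then show ?thesis
        using cov_cong[OF x, of "X # vs" T H v] differentiable_cong_open[OF open_V x, of "\<lambda>y. T y (X # vs)" "\<lambda>y. H y (X # vs)"]
          True 1 dH[OF x, of "X # vs"] by (simp add: proj_def)
    next
      case 2
      define P where "P y zs = \<phi> y [zs ! 0, zs ! 4, zs ! 5] * H y [zs ! 3, zs ! 1, zs ! 2]" for y zs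
      have P: "C1_tensor V (3 + 3) P"
        unfolding C1_tensor_def multilin_def
      proof (intro ballI conjI allI impI, elim conjE)
        fix y and zs :: "R7 list" and i :: nat assume y: "y \<in> V" and len: "length zs = 3 + 3" and i: "i < 3 + 3"
        obtain p a b c q r where zs: "zs = [p, a, b, c, q, r]" using len by (auto simp: eval_nat_numeral length_Suc_conv)
        have "i = 0 \<or> i = 1 \<or> i = 2 \<or> i = 3 \<or> i = 4 \<or> i = 5" using i by auto
        then show "linear (\<lambda>v. P y (zs[i := v]))"
          using ml[OF y, of "[]"] ml[OF y, of "[_]"] ml[OF y, of "[_, _]"] mlp[OF y, of "[]"] mlp[OF y, of "[_]"] mlp[OF y, of "[_, _]"] 2
          by (elim disjE) (auto simp: P_def zs eval_nat_numeral intro!: linear_cmult linear_cmult[of _ "H y _", simplified mult.commute[of "H y _"]])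
      next
        fix y and zs :: "R7 list" assume "y \<in> V" "length zs = 3 + 3"
        then show "(\<lambda>z. P z zs) differentiable (at y)"
          unfolding P_def using 2 by (intro differentiable_mult dH dphi) auto
      qed
      have covP: "cov \<Gamma> P x v [p, a, b, X, q, r] = \<phi> x [p, q, r] * cov \<Gamma> H x v [X, a, b]" for p a b X q r
      proof -
        have "D (\<lambda>y. P y [p, a, b, X, q, r]) x v
          = \<phi> x [p, q, r] * D (\<lambda>y. H y [X, a, b]) x v + D (\<lambda>y. \<phi> y [p, q, r]) x v * H x [X, a, b]"
          unfolding P_def using dH[OF x, of "[X, a, b]"] dphi[OF x, of "[p, q, r]"] 2 by (simp add: D_mult eval_nat_numeral)
        moreover have "D (\<lambda>y. \<phi> y [p, q, r]) x v = \<phi> x [\<Gamma> x v p, q, r] + \<phi> x [p, \<Gamma> x v q, r] + \<phi> x [p, q, \<Gamma> x v r]"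
          using cov_phi[OF x, of "[p, q, r]" v] by (simp add: cov_def eval_nat_numeral)
        ultimately show ?thesis
          by (simp add: cov_def P_def eval_nat_numeral algebra_simps)
      qed
      have TP: "T y zs = 1 / 6 * contract_phi P y zs" if "y \<in> V" "length zs = length (X # vs)" for y zs
      proof -
        have "length zs = 3" using that True 2 by simp
        then obtain Y a b where "zs = [Y, a, b]" by (auto simp: eval_nat_numeral length_Suc_conv)
        then show ?thesis using T[of y Y "[a, b]"] that(1) 2
          by (simp add: proj_def contract_phi_def P_def eval_nat_numeral mult.assoc)
      qed
      have d: "(\<lambda>y. contract_phi P y (X # vs)) differentiable (at x)"
        by (rule contract_phi_differentiable[OF x P]) (simp add: True 2)
      obtain a b where vs: "vs = [a, b]" using True 2 by (auto simp: eval_nat_numeral length_Suc_conv)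
      have "cov \<Gamma> T x v (X # vs) = 1 / 6 * contract_phi (\<lambda>y. cov \<Gamma> P y v) x (X # vs)"
        using cov_cong[OF x, of "X # vs" T "\<lambda>y zs. 1 / 6 * contract_phi P y zs" v] TP
          cov_cmult[where T = "contract_phi P", OF d, of "1 / 6" v] cov_contract_phi[OF x P, of "X # vs" v] True 2 by simp
      moreover have "(\<lambda>y. T y (X # vs)) differentiable (at x)"
        by (rule differentiable_cong_open[OF open_V x TP differentiable_mult[OF differentiable_const d]]) auto
      ultimately show ?thesis
        by (simp add: vs proj_def 2 contract_phi_def covP mult.assoc)
    next
      case 3
      define P where "P y zs = \<phi> y [zs ! 4, zs ! 5, zs ! 6] * H y [zs ! 3, zs ! 0, zs ! 1, zs ! 2]" for y zs
      have P: "C1_tensor V (4 + 3) P"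
        unfolding C1_tensor_def multilin_def
      proof (intro ballI conjI allI impI, elim conjE)
        fix y and zs :: "R7 list" and i :: nat assume y: "y \<in> V" and len: "length zs = 4 + 3" and i: "i < 4 + 3"
        obtain p a b c q r s where zs: "zs = [p, a, b, c, q, r, s]" using len by (auto simp: eval_nat_numeral length_Suc_conv)
        have "i = 0 \<or> i = 1 \<or> i = 2 \<or> i = 3 \<or> i = 4 \<or> i = 5 \<or> i = 6" using i by auto
        then show "linear (\<lambda>v. P y (zs[i := v]))"
          using ml[OF y, of "[]"] ml[OF y, of "[_]"] ml[OF y, of "[_, _]"] ml[OF y, of "[_, _, _]"] mlp[OF y, of "[]"] mlp[OF y, of "[_]"] mlp[OF y, of "[_, _]"] 3
          by (elim disjE) (auto simp: P_def zs eval_nat_numeral intro!: linear_cmult linear_cmult[of _ "H y _", simplified mult.commute[of "H y _"]])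
      next
        fix y and zs :: "R7 list" assume "y \<in> V" "length zs = 4 + 3"
        then show "(\<lambda>z. P z zs) differentiable (at y)"
          unfolding P_def using 3 by (intro differentiable_mult dH dphi) auto
      qed
      have covP: "cov \<Gamma> P x v [p, a, b, X, q, r, s] = \<phi> x [q, r, s] * cov \<Gamma> H x v [X, p, a, b]" for p a b X q r s
      proof -
        have "D (\<lambda>y. P y [p, a, b, X, q, r, s]) x v
          = \<phi> x [q, r, s] * D (\<lambda>y. H y [X, p, a, b]) x v + D (\<lambda>y. \<phi> y [q, r, s]) x v * H x [X, p, a, b]"
          unfolding P_def using dH[OF x, of "[X, p, a, b]"] dphi[OF x, of "[q, r, s]"] 3 by (simp add: D_mult eval_nat_numeral)
        moreover have "D (\<lambda>y. \<phi> y [q, r, s]) x v = \<phi> x [\<Gamma> x v q, r, s] + \<phi> x [q, \<Gamma> x v r, s] + \<phi> x [q, r, \<Gamma> x v s]"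
          using cov_phi[OF x, of "[q, r, s]" v] by (simp add: cov_def eval_nat_numeral)
        ultimately show ?thesis
          by (simp add: cov_def P_def eval_nat_numeral algebra_simps)
      qed
      have TP: "T y zs = 1 / 42 * contract_phi P y zs" if "y \<in> V" "length zs = length (X # vs)" for y zs
      proof -
        have "length zs = 4" using that True 3 by simp
        then obtain Y a b c where "zs = [Y, a, b, c]" by (auto simp: eval_nat_numeral length_Suc_conv)
        then show ?thesis using T[of y Y "[a, b, c]"] that(1) 3
          by (simp add: proj_def contract_phi_def P_def eval_nat_numeral mult.assoc)
      qed
      have d: "(\<lambda>y. contract_phi P y (X # vs)) differentiable (at x)"
        by (rule contract_phi_differentiable[OF x P]) (simp add: True 3)
      obtain a b c where vs: "vs = [a, b, c]" using True 3 by (auto simp: eval_nat_numeral length_Suc_conv)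
      have "cov \<Gamma> T x v (X # vs) = 1 / 42 * contract_phi (\<lambda>y. cov \<Gamma> P y v) x (X # vs)"
        using cov_cong[OF x, of "X # vs" T "\<lambda>y zs. 1 / 42 * contract_phi P y zs" v] TP
          cov_cmult[where T = "contract_phi P", OF d, of "1 / 42" v] cov_contract_phi[OF x P, of "X # vs" v] True 3 by simp
      moreover have "(\<lambda>y. T y (X # vs)) differentiable (at x)"
        by (rule differentiable_cong_open[OF open_V x TP differentiable_mult[OF differentiable_const d]]) auto
      ultimately show ?thesis
        by (simp add: vs proj_def 3 contract_phi_def covP mult.assoc)
    qed
  qed
  then show "cov \<Gamma> T x v (X # vs) = proj x k (\<lambda>us. cov \<Gamma> H x v (X # us)) vs"
    and "(\<lambda>y. T y (X # vs)) differentiable (at x)" by blast+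
qed

end

section \<open>Cochains in a chart\<close>

lemma Ck_on_cong:
  assumes "open S" "\<And>y. y \<in> S \<Longrightarrow> h y = h' y"
  shows "Ck_on n S h \<longleftrightarrow> Ck_on n S h'"
  using assms(2)
proof (induction n arbitrary: h h')
  case 0
  then show ?case by (simp cong: continuous_on_cong)
next
  case (Suc n)
  have d: "h differentiable (at x) \<longleftrightarrow> h' differentiable (at x)" if "x \<in> S" for x
    using differentiable_cong_open[OF assms(1) that] Suc.prems by metis
  have "D h y v = D h' y v" if "y \<in> S" for y v
    by (rule D_cong[OF assms(1) that]) (rule Suc.prems)
  then have "Ck_on n S (\<lambda>x. D h x v) \<longleftrightarrow> Ck_on n S (\<lambda>x. D h' x v)" for v
    by (rule Suc.IH)
  with d show ?case by auto
qed

lemma Ck_on_inner: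
  fixes h :: "R7 \<Rightarrow> 'b::real_inner"
  assumes S: "open S"
  shows "Ck_on n S h \<Longrightarrow> Ck_on n S (\<lambda>y. h y \<bullet> b)"
proof (induction n arbitrary: h)
  case 0
  then show ?case by (auto intro: continuous_on_inner)
next
  case (Suc n)
  have "D (\<lambda>y. h y \<bullet> b) y v = D h y v \<bullet> b" if "y \<in> S" for y v
    by (rule D_eqI) (use Suc.prems that in \<open>auto intro!: has_derivative_inner_left D_has_derivative\<close>)
  then have "Ck_on n S (\<lambda>y. D (\<lambda>y. h y \<bullet> b) y v) \<longleftrightarrow> Ck_on n S (\<lambda>y. D h y v \<bullet> b)" for v
    by (intro Ck_on_cong[OF S])
  moreover have "Ck_on n S (\<lambda>y. D h y v \<bullet> b)" for v
    using Suc by auto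
  ultimately show ?case using Suc.prems by auto
qed

context metric_frame
begin

lemma linear_g_apply: "x \<in> V \<Longrightarrow> linear (\<lambda>A :: real^7^7. g x X (A *v Z))"
  by (rule linearI)
    (simp_all add: matrix_vector_mult_add_rdistrib scaleR_matrix_vector_assoc[symmetric]
      linear_add[OF linear_g_right] linear_scale[OF linear_g_right])

lemma matrix_multilin:
  fixes \<alpha> :: "(real^7^7) form"
  assumes x: "x \<in> V" and ml: "\<And>X Z. multilin n (\<lambda>us. g x X (\<alpha> us *v Z))"
  shows "multilin n (\<lambda>us. \<alpha> us \<bullet> b)"
  unfolding multilin_def
proof (intro allI impI, elim conjE)
  fix vs :: "R7 list" and i assume i: "length vs = n" "i < n"
  have lin: "linear (\<lambda>v. g x X (\<alpha> (vs[i := v]) *v Z))" for X Z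
    by (rule multilin_update[OF ml i])
  have "linear (\<lambda>v. \<alpha> (vs[i := v]))"
  proof (rule linearI)
    fix u v :: R7 and c :: real
    show "\<alpha> (vs[i := u + v]) = \<alpha> (vs[i := u]) + \<alpha> (vs[i := v])"
      by (rule matrix_eq_by_metric[OF x])
        (simp add: linear_add[OF lin] linear_add[OF linear_g_apply[OF x]])
    show "\<alpha> (vs[i := c *\<^sub>R u]) = c *\<^sub>R \<alpha> (vs[i := u])"
      by (rule matrix_eq_by_metric[OF x])
        (simp add: linear_scale[OF lin] linear_scale[OF linear_g_apply[OF x]])
  qed
  then show "linear (\<lambda>v. \<alpha> (vs[i := v]) \<bullet> b)"
    using linear_compose[OF _ linear_inner_const, of "\<lambda>v. \<alpha> (vs[i := v])" b] by (simp add: o_def)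
qed

lemma conn_covector_inner: "x \<in> V \<Longrightarrow> conn_covector g x v w \<bullet> X = - (w \<bullet> \<Gamma> x v X)"
  by (simp add: conn_covector_def transpose_matrix_vector dot_lmul_matrix matrix_apply linear_\<Gamma>_right)

text \<open>
  The vector on which the coefficient is evaluated becomes the first slot.
\<close>
definition lower :: "(R7 \<Rightarrow> R7 form) \<Rightarrow> R7 \<Rightarrow> real form" where
  "lower n y ws = n y (tl ws) \<bullet> hd ws"

lemma lower_Cons [simp]: "lower n y (X # us) = n y us \<bullet> X"
  by (simp add: lower_def)

lemma D_inner:
  assumes "n differentiable (at x)"
  shows "D (\<lambda>y. n y \<bullet> X) x v = D n x v \<bullet> (X :: R7)"
  by (rule D_eqI) (intro has_derivative_inner_left D_has_derivative assms)

lemma nabla_form_inner: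
  assumes x: "x \<in> V" and n: "\<And>X. (\<lambda>y. n y vs \<bullet> X) differentiable (at x)"
  shows "nabla_form g (conn_covector g) n x v vs \<bullet> X = cov \<Gamma> (lower n) x v (X # vs)"
proof -
  have "(\<lambda>y. n y vs) differentiable (at x)"
    unfolding differentiable_componentwise_within[of "\<lambda>y. n y vs"] using n by blast
  then have "D (\<lambda>y. n y vs \<bullet> X) x v = D (\<lambda>y. n y vs) x v \<bullet> X" by (rule D_inner)
  moreover have "(\<Sum>i<Suc (length vs). lower n x ((X # vs)[i := \<Gamma> x v ((X # vs) ! i)]))
    = n x vs \<bullet> \<Gamma> x v X + (\<Sum>i<length vs. n x (vs[i := \<Gamma> x v (vs ! i)]) \<bullet> X)"
    by (subst sum.lessThan_Suc_shift) simp
  ultimately show ?thesis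
    by (simp add: nabla_form_def coeff_deriv_def cov_def inner_diff_left inner_add_left inner_sum_left
        conn_covector_inner[OF x])
qed

text \<open>
  The operator \<open>\<K>\<close> in a single chart.
\<close>
definition skew :: "(R7 \<Rightarrow> R7 form) \<Rightarrow> R7 \<Rightarrow> (real^7^7) form" where
  "skew n x vs = sharp (g x) (\<lambda>X Z. nabla_form g (conn_covector g) n x Z vs \<bullet> X
                        - nabla_form g (conn_covector g) n x X vs \<bullet> Z)"

definition curv_ins :: "(R7 \<Rightarrow> R7 form) \<Rightarrow> R7 \<Rightarrow> (real^7^7) form" where
  "curv_ins n x vs = (\<^bold>\<Sum>j. let e = onb (g x) j in
        wedge_one (\<lambda>A t. t *\<^sub>R A) (\<lambda>X. riemann g x e X) (\<lambda>us. n x us \<bullet> e) vs)"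

text \<open>
  The Bianchi identity and the pair symmetry. Reading from right to left, this turns the action of
  the curvature on a coefficient slot, skew-symmetrised in \<open>X\<close> and \<open>Z\<close>, into a curvature insertion.
\<close>
lemma curvature_rearranged:
  assumes x: "x \<in> V"
  shows "g x X (curv \<Gamma> x u v Z) = g x (curv \<Gamma> x X v Z - curv \<Gamma> x Z v X) u"
proof -
  have "curv \<Gamma> x Z u X + curv \<Gamma> x u X Z + curv \<Gamma> x X Z u = 0" by (rule curv_bianchi[OF x])
  then have b: "g x (curv \<Gamma> x Z u X) v + g x (curv \<Gamma> x u X Z) v + g x (curv \<Gamma> x X Z u) v = 0"
    by (metis linear_add[OF linear_g_left[OF x]] linear_0[OF linear_g_left[OF x]])
  have neg: "g x (curv \<Gamma> x a b c) d = - g x (curv \<Gamma> x b a c) d" for a b c d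
    by (subst curv_swap) (rule linear_neg[OF linear_g_left[OF x]])
  show ?thesis
    using b neg[of u X Z v] neg[of X Z u v] curvature_pair_symmetry[OF x, of X v Z u]
      curvature_pair_symmetry[OF x, of Z v X u] curvature_pair_symmetry[OF x, of u v Z X]
    by (simp add: linear_diff[OF linear_g_left[OF x]] g_commute[OF x, of X])
qed

lemma curv_ins_apply:
  assumes x: "x \<in> V" and len: "length us = Suc k"
  shows "g x X (curv_ins n x us *v Z)
    = wedge_sum k (\<lambda>w us. n x us \<bullet> (curv \<Gamma> x X w Z - curv \<Gamma> x Z w X)) us"
proof -
  let ?E = "onb (g x)"
  let ?W = "\<lambda>w. curv \<Gamma> x X w Z - curv \<Gamma> x Z w X"
  have "curv_ins n x us = (\<^bold>\<Sum>j. \<Sum>i<Suc k. (-1) ^ i *\<^sub>R (n x (remove_nth i us) \<bullet> ?E j) *\<^sub>R riemann g x (?E j) (us ! i))"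
    by (simp only: curv_ins_def wedge_one_def Let_def len)
  then have "g x X (curv_ins n x us *v Z)
    = (\<^bold>\<Sum>j. \<Sum>i<Suc k. (-1) ^ i * ((n x (remove_nth i us) \<bullet> ?E j) * g x (?W (us ! i)) (?E j)))"
    by (simp only: linear_sum[OF linear_g_apply[OF x]] linear_scale[OF linear_g_apply[OF x]]
        riemann_mult[OF x] curvature_rearranged[OF x] real_scaleR_def)
  also have "\<dots> = (\<Sum>i<Suc k. \<^bold>\<Sum>j. (-1) ^ i * ((n x (remove_nth i us) \<bullet> ?E j) * g x (?W (us ! i)) (?E j)))"
    by (rule sum.swap)
  also have "\<dots> = (\<Sum>i<Suc k. (-1) ^ i * (\<^bold>\<Sum>j. g x (?W (us ! i)) (?E j) *\<^sub>R (n x (remove_nth i us) \<bullet> ?E j)))"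
    by (simp only: sum_distrib_left real_scaleR_def mult.commute[of "_ \<bullet> _"])
  also have "\<dots> = (\<Sum>i<Suc k. (-1) ^ i * (n x (remove_nth i us) \<bullet> ?W (us ! i)))"
    using onb_expansion[OF x bounded_linear.linear[OF bounded_linear_inner_right]] by simp
  finally show ?thesis by (simp only: wedge_sum_def)
qed

lemma curvature_swap_first:
  assumes x: "x \<in> V"
  shows "curv \<Gamma> x Z a b - curv \<Gamma> x Z b a = - curv \<Gamma> x a b Z"
proof -
  have "curv \<Gamma> x Z a b - curv \<Gamma> x Z b a + curv \<Gamma> x a b Z = 0"
    using curv_bianchi[OF x, of Z a b] curv_swap[of x Z b a] by (simp add: algebra_simps)
  then show ?thesis by (simp only: eq_neg_iff_add_eq_0)
qed

end

locale cochain_chart = torsion_free_frame +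
  fixes k :: nat and m :: "R7 \<Rightarrow> R7 form"
  assumes m_alt: "y \<in> V \<Longrightarrow> alt_form k (m y)"
    and m_C2: "Ck_on 2 V (\<lambda>y. m y vs \<bullet> X)"
begin

abbreviation "M \<equiv> lower m"
abbreviation "M' \<equiv> nab \<Gamma> M"

lemma m_inner_alt: "y \<in> V \<Longrightarrow> alt_form k (\<lambda>us. m y us \<bullet> X)"
  using m_alt[of y] unfolding alt_form_def
  by (auto intro: linear_compose[OF _ linear_inner_const, unfolded o_def])

lemma C2_M: "C2_tensor V (Suc k) M"
  unfolding C2_tensor_def multilin_def
proof (intro conjI ballI allI impI, elim conjE)
  fix y and vs :: "R7 list" and i assume y: "y \<in> V" and len: "length vs = Suc k" and i: "i < Suc k"
  obtain X us where vs: "vs = X # us" "length us = k" using len by (cases vs) auto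
  show "linear (\<lambda>v. M y (vs[i := v]))"
    using i vs multilin_update[OF alt_form_multilin[OF m_inner_alt[OF y]]]
    by (cases i) (auto intro: bounded_linear.linear[OF bounded_linear_inner_right])
next
  fix vs :: "R7 list"
  show "Ck_on 2 V (\<lambda>z. M z vs)" by (simp add: lower_def m_C2)
qed

lemma C1_nabM: "C1_tensor V (Suc (Suc k)) M'"
  by (rule C1_nab[OF C2_M])

lemma m_differentiable: "y \<in> V \<Longrightarrow> (\<lambda>z. m z vs \<bullet> X) differentiable (at y)"
  using m_C2[of vs X] by (simp add: numeral_2_eq_2)

lemma nabM_alt:
  assumes x: "x \<in> V"
  shows "alt_form k (\<lambda>us. M' x (Z # X # us))"
proof -
  have eq: "M' x (Z # X # us) = D (\<lambda>y. m y us \<bullet> X) x Z - m x us \<bullet> \<Gamma> x Z X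
      - (\<Sum>l<length us. m x (us[l := \<Gamma> x Z (us ! l)]) \<bullet> X)" for us
    by (simp only: nab_Cons cov_def list.size add_Suc_right add_0_right sum.lessThan_Suc_shift) simp
  show ?thesis
    unfolding alt_form_def
  proof (intro conjI allI impI)
    fix us :: "R7 list" assume len: "length us \<noteq> k"
    then have zero: "m y us' = 0" if "y \<in> V" "length us' = length us" for y us'
      using that by (intro alt_form_length[OF m_alt]) auto
    have "D (\<lambda>y. m y us \<bullet> X) x Z = D (\<lambda>y. 0) x Z"
      by (rule D_cong[OF open_V x]) (simp add: zero)
    then show "M' x (Z # X # us) = 0" unfolding eq by (simp add: zero x)
  next
    fix us :: "R7 list" and i assume "length us = k \<and> i < k"
    then show "linear (\<lambda>v. M' x (Z # X # us[i := v]))"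
      using multilin_update[OF C1_multilin[OF C1_nabM x], of "Z # X # us" "Suc (Suc i)"] by simp
  next
    fix us :: "R7 list" and i j assume ij: "length us = k \<and> i < j \<and> j < k \<and> us ! i = us ! j"
    then have zero: "m y us = 0" if "y \<in> V" for y
      using alt_form_repeat[OF m_alt[OF that], of us i j] by simp
    have "D (\<lambda>y. m y us \<bullet> X) x Z = D (\<lambda>y. 0) x Z"
      by (rule D_cong[OF open_V x]) (simp add: zero)
    moreover have "(\<Sum>l<k. m x (us[l := \<Gamma> x Z (us ! l)]) \<bullet> X) = 0"
      using ij alt_form_derivation_repeat[OF m_inner_alt[OF x], of us i j "\<Gamma> x Z" X] by simp
    ultimately show "M' x (Z # X # us) = 0" unfolding eq using ij by (simp add: zero x)
  qed
qed

text \<open>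
  The exterior covariant derivative of \<open>m\<close> with the coefficient slot first.
\<close>
definition Dm :: "R7 \<Rightarrow> real form" where
  "Dm y ws = wedge_sum k (\<lambda>w us. M' y (w # hd ws # us)) (tl ws)"

lemma Dm_Cons: "Dm y (X # us) = wedge_sum k (\<lambda>w us. M' y (w # X # us)) us"
  by (simp add: Dm_def)

lemma nabM_linear:
  assumes "y \<in> V" "length us = k"
  shows "linear (\<lambda>w. M' y (w # X # us))" "linear (\<lambda>X. M' y (w # X # us))"
  using multilin_append[OF C1_multilin[OF C1_nabM assms(1)], of "[]" "X # us"]
    multilin_append[OF C1_multilin[OF C1_nabM assms(1)], of "[w]" us] assms(2) by simp_all

lemma C1_Dm: "C1_tensor V (Suc (Suc k)) Dm"
  unfolding C1_tensor_def multilin_def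
proof (intro ballI conjI allI impI, elim conjE)
  fix y and vs :: "R7 list" and i assume y: "y \<in> V" and len: "length vs = Suc (Suc k)" and i: "i < Suc (Suc k)"
  obtain X us where vs: "vs = X # us" "length us = Suc k" using len by (cases vs) auto
  show "linear (\<lambda>v. Dm y (vs[i := v]))"
  proof (cases i)
    case 0
    show ?thesis
      unfolding vs 0 list_update.simps nat.case Dm_Cons wedge_sum_def
      by (intro linear_compose_sum ballI linear_cmult nabM_linear[OF y]) (simp add: vs length_remove_nth)
  next
    case (Suc j)
    have "multilin (Suc k) (wedge_sum k (\<lambda>w us. M' y (w # X # us)))"
      by (intro multilin_wedge_sum nabM_linear[OF y] alt_form_multilin[OF nabM_alt[OF y]])
    from multilin_update[OF this vs(2), of j] show ?thesis
      using i by (simp add: vs Suc Dm_Cons)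
  qed
next
  fix y and vs :: "R7 list" assume y: "y \<in> V" and len: "length vs = Suc (Suc k)"
  obtain X us where vs: "vs = X # us" "length us = Suc k" using len by (cases vs) auto
  show "(\<lambda>z. Dm z vs) differentiable (at y)"
    unfolding vs Dm_Cons wedge_sum_def
    by (intro differentiable_sum differentiable_mult differentiable_const C1_differentiable[OF C1_nabM y] ballI)
      (auto simp: vs length_remove_nth)
qed

lemma cov_Dm:
  assumes x: "x \<in> V" and len: "length us = Suc k"
  shows "cov \<Gamma> Dm x v (X # us) = wedge_sum k (\<lambda>w us. nab \<Gamma> M' x (v # w # X # us)) us"
proof -
  let ?L = "\<Gamma> x v"
  have "((\<lambda>y. Dm y (X # us)) has_derivative
      (\<lambda>v. \<Sum>i<Suc k. (-1) ^ i * D (\<lambda>y. M' y (us ! i # X # remove_nth i us)) x v)) (at x)"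
    unfolding Dm_Cons wedge_sum_def
    by (intro has_derivative_sum has_derivative_mult_right D_has_derivative C1_differentiable[OF C1_nabM x])
      (auto simp: len length_remove_nth)
  then have 1: "D (\<lambda>y. Dm y (X # us)) x v = wedge_sum k (\<lambda>w us. D (\<lambda>y. M' y (w # X # us)) x v) us"
    by (simp add: D_eqI wedge_sum_def)
  have 2: "(\<Sum>i<Suc (Suc k). Dm x ((X # us)[i := ?L ((X # us) ! i)]))
    = wedge_sum k (\<lambda>w us. M' x (w # ?L X # us)) us
     + wedge_sum k (\<lambda>w us. M' x (?L w # X # us) + (\<Sum>l<k. M' x (w # X # us[l := ?L (us ! l)]))) us"
    unfolding wedge_sum_derivation[OF len, where B = "\<lambda>w us. M' x (w # X # us)" and L = ?L, symmetric]
    by (subst sum.lessThan_Suc_shift) (simp add: Dm_Cons del: sum.lessThan_Suc)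
  have 3: "nab \<Gamma> M' x (v # w # X # us') = D (\<lambda>y. M' y (w # X # us')) x v
     - (M' x (w # ?L X # us') + (M' x (?L w # X # us') + (\<Sum>l<k. M' x (w # X # us'[l := ?L (us' ! l)]))))"
    if "length us' = k" for w us'
    unfolding nab_Cons[of _ M'] cov_def[of _ M'] list.size that add_Suc_right add_0_right sum.lessThan_Suc_shift
    by simp
  have "cov \<Gamma> Dm x v (X # us) = wedge_sum k (\<lambda>w us'. D (\<lambda>y. M' y (w # X # us')) x v
     - (M' x (w # ?L X # us') + (M' x (?L w # X # us') + (\<Sum>l<k. M' x (w # X # us'[l := ?L (us' ! l)]))))) us"
    unfolding cov_def[of _ Dm] list.size len add_Suc_right add_0_right 1 2 wedge_sum_diff wedge_sum_add ..
  then show ?thesis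
    using wedge_sum_cong[OF len 3] by simp
qed

lemma ext_cov_deriv_m:
  assumes y: "y \<in> V" and len: "length us = Suc k"
  shows "ext_cov_deriv (conn_covector g) m y us \<bullet> X = Dm y (X # us)"
proof -
  have "coeff_deriv (conn_covector g) m y v us' \<bullet> X = M' y (v # X # us') + (\<Sum>l<k. m y (us'[l := \<Gamma> y v (us' ! l)]) \<bullet> X)"
    if "length us' = k" for v us'
    using nabla_form_inner[where n = m and vs = us' and v = v and X = X, OF y m_differentiable[OF y]] that
    by (simp add: nabla_form_def inner_diff_left inner_sum_left)
  then have "ext_cov_deriv (conn_covector g) m y us \<bullet> X
    = (\<Sum>i<Suc k. (-1) ^ i * (M' y (us ! i # X # remove_nth i us)
        + (\<Sum>l<k. m y ((remove_nth i us)[l := \<Gamma> y (us ! i) (remove_nth i us ! l)]) \<bullet> X)))"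
    unfolding ext_cov_deriv_def inner_sum_left len
    by (intro sum.cong) (auto simp: length_remove_nth len)
  also have "\<dots> = Dm y (X # us)
     + (\<Sum>i<Suc k. (-1) ^ i *\<^sub>R (\<Sum>l<k. m y ((remove_nth i us)[l := \<Gamma> y (us ! i) (remove_nth i us ! l)]) \<bullet> X))"
    by (simp only: Dm_Cons wedge_sum_def distrib_left sum.distrib real_scaleR_def)
  also have "(\<Sum>i<Suc k. (-1) ^ i *\<^sub>R (\<Sum>l<k. m y ((remove_nth i us)[l := \<Gamma> y (us ! i) (remove_nth i us ! l)]) \<bullet> X)) = 0"
    by (rule torsion_terms_cancel[OF m_inner_alt[OF y] \<Gamma>_commute[OF y] len])
  finally show ?thesis by simp
qed

definition d0m :: "R7 \<Rightarrow> R7 form" where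
  "d0m y = can_proj (g y) (\<phi> y) (Suc k) (ext_cov_deriv (conn_covector g) m y)"

lemma lower_d0m:
  assumes y: "y \<in> V" and k: "Suc k \<in> {1, 2, 3}"
  shows "lower d0m y (X # vs) = proj y (Suc k) (\<lambda>us. Dm y (X # us)) vs"
proof -
  have ml: "multilin (Suc k) (\<lambda>us. ext_cov_deriv (conn_covector g) m y us \<bullet> b)" for b
  proof -
    have "multilin (Suc k) (\<lambda>us. Dm y (b # us))"
      unfolding Dm_Cons
      by (intro multilin_wedge_sum nabM_linear[OF y] alt_form_multilin[OF nabM_alt[OF y]])
    then show ?thesis by (simp add: multilin_def ext_cov_deriv_m[OF y])
  qed
  have "lower d0m y (X # vs) = proj y (Suc k) (ext_cov_deriv (conn_covector g) m y) vs \<bullet> X"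
    by (simp add: d0m_def can_proj_eq[OF y k ml])
  also have "\<dots> = proj y (Suc k) (\<lambda>us. ext_cov_deriv (conn_covector g) m y us \<bullet> X) vs"
    by (rule proj_map[OF linear_inner_const])
  also have "\<dots> = proj y (Suc k) (\<lambda>us. Dm y (X # us)) vs"
    by (rule proj_cong) (rule ext_cov_deriv_m[OF y])
  finally show ?thesis .
qed

text \<open>
  Since the projections are parallel, \<open>\<K>\<close> may be applied before projecting.
\<close>
lemma skew_d0m_apply:
  assumes x: "x \<in> V" and k: "Suc k \<in> {1, 2, 3}"
  shows "g x X (skew d0m x vs *v Z) = proj x (Suc k) (\<lambda>us. cov \<Gamma> Dm x Z (X # us) - cov \<Gamma> Dm x X (Z # us)) vs"
proof -
  have cov: "nabla_form g (conn_covector g) d0m x v vs \<bullet> X = proj x (Suc k) (\<lambda>us. cov \<Gamma> Dm x v (X # us)) vs" for v X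
    using nabla_form_inner[OF x, where n = d0m and vs = vs and v = v and X = X] cov_proj[OF x k C1_Dm, of "lower d0m"] lower_d0m[OF _ k] by simp
  have ml: "multilin (Suc (Suc (Suc k))) (nab \<Gamma> Dm x)" by (rule multilin_nab[OF x C1_Dm])
  have lin: "linear (\<lambda>v. cov \<Gamma> Dm x v (X # us))" "linear (\<lambda>X. cov \<Gamma> Dm x v (X # us))" if "length us = Suc k" for v X us
    using multilin_append[OF ml, of "[]" "X # us"] multilin_append[OF ml, of "[v]" us] that by simp_all
  have "g x X (skew d0m x vs *v Z) = nabla_form g (conn_covector g) d0m x Z vs \<bullet> X - nabla_form g (conn_covector g) d0m x X vs \<bullet> Z"
    unfolding skew_def
    by (rule sharp_mult(2)[OF x]; unfold cov; intro linear_compose_sub linear_proj lin)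
  then show ?thesis by (simp only: cov proj_diff)
qed

lemma skew_m:
  assumes y: "y \<in> V"
  shows "skew m y us = sharp (g y) (\<lambda>X Z. M' y (Z # X # us) - M' y (X # Z # us))"
  unfolding skew_def by (simp add: nabla_form_inner[OF y m_differentiable[OF y]])

lemma skew_m_apply:
  assumes y: "y \<in> V" and len: "length us = k"
  shows "g y X (skew m y us *v Z) = M' y (Z # X # us) - M' y (X # Z # us)"
  unfolding skew_m[OF y]
  by (rule sharp_mult(2)[OF y]; intro linear_compose_sub nabM_linear[OF y len])

lemma skew_m_differentiable:
  assumes x: "x \<in> V" and len: "length us = k"
  shows "(\<lambda>y. skew m y us) differentiable (at x)"
proof (rule differentiable_cong_open[OF open_V x skew_m])
  have d: "(\<lambda>y. M' y (vs[j := f y i])) differentiable (at x)" if "length vs = Suc (Suc k)" "j < Suc (Suc k)" for vs i j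
    using tensor_leibniz_update[OF open_V x C1_nabM that f_differentiable[OF x]] unfolding differentiable_def by blast
  show "(\<lambda>y. sharp (g y) (\<lambda>X Z. M' y (Z # X # us) - M' y (X # Z # us))) differentiable (at x)"
  proof (rule sharp_differentiable[OF x])
    fix i Z
    show "(\<lambda>y. M' y (Z # f y i # us) - M' y (f y i # Z # us)) differentiable (at x)"
      using d[of "Z # 0 # us" 1 i] d[of "0 # Z # us" 0 i] len by (intro differentiable_diff) simp_all
  qed (intro linear_compose_sub nabM_linear len; assumption)+
qed

text \<open>
  Lowering an index commutes with covariant differentiation (\<open>coeff_deriv_End\<close>), and the Christoffel
  terms of the form slots cancel.
\<close>
lemma dE_apply:
  assumes x: "x \<in> V" and len: "length us = Suc k"
  shows "g x X (ext_cov_deriv (conn_End g) (skew m) x us *v Z)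
    = wedge_sum k (\<lambda>w us. nab \<Gamma> M' x (w # Z # X # us) - nab \<Gamma> M' x (w # X # Z # us)) us"
proof -
  let ?A = "\<lambda>us. M' x (Z # X # us) - M' x (X # Z # us)"
  have coeff: "g x X (coeff_deriv (conn_End g) (skew m) x w us' *v Z)
     = (nab \<Gamma> M' x (w # Z # X # us') - nab \<Gamma> M' x (w # X # Z # us'))
      + (\<Sum>l<k. ?A (us'[l := \<Gamma> x w (us' ! l)]))" if len': "length us' = k" for w us'
  proof -
    have "D (\<lambda>y. g y X (skew m y us' *v Z)) x w = D (\<lambda>y. M' y (Z # X # us') - M' y (X # Z # us')) x w"
      by (rule D_cong[OF open_V x]) (rule skew_m_apply[OF _ len'])
    also have "\<dots> = D (\<lambda>y. M' y (Z # X # us')) x w - D (\<lambda>y. M' y (X # Z # us')) x w"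
      by (intro D_diff C1_differentiable[OF C1_nabM x]) (simp_all add: len')
    finally have "g x X (coeff_deriv (conn_End g) (skew m) x w us' *v Z)
      = D (\<lambda>y. M' y (Z # X # us')) x w - D (\<lambda>y. M' y (X # Z # us')) x w
       - (M' x (Z # \<Gamma> x w X # us') - M' x (\<Gamma> x w X # Z # us'))
       - (M' x (\<Gamma> x w Z # X # us') - M' x (X # \<Gamma> x w Z # us'))"
      unfolding coeff_deriv_def coeff_deriv_End[OF x skew_m_differentiable[OF x len']]
      by (simp add: skew_m_apply[OF x len'])
    moreover have "nab \<Gamma> M' x (w # a # b # us') = D (\<lambda>y. M' y (a # b # us')) x w
     - (M' x (\<Gamma> x w a # b # us') + (M' x (a # \<Gamma> x w b # us') + (\<Sum>l<k. M' x (a # b # us'[l := \<Gamma> x w (us' ! l)]))))" for a b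
      unfolding nab_Cons[of _ M'] cov_def[of _ M'] list.size len' add_Suc_right add_0_right sum.lessThan_Suc_shift
      by simp
    ultimately show ?thesis by (simp add: sum_subtractf)
  qed
  have "g x X (ext_cov_deriv (conn_End g) (skew m) x us *v Z)
    = (\<Sum>i<Suc k. (-1) ^ i * g x X (coeff_deriv (conn_End g) (skew m) x (us ! i) (remove_nth i us) *v Z))"
    unfolding ext_cov_deriv_def len
    by (simp only: linear_sum[OF linear_g_apply[OF x]] linear_scale[OF linear_g_apply[OF x]] real_scaleR_def)
  also have "\<dots> = (\<Sum>i<Suc k. (-1) ^ i * ((nab \<Gamma> M' x (us ! i # Z # X # remove_nth i us) - nab \<Gamma> M' x (us ! i # X # Z # remove_nth i us))
      + (\<Sum>l<k. ?A ((remove_nth i us)[l := \<Gamma> x (us ! i) (remove_nth i us ! l)]))))"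
    by (intro sum.cong refl) (auto simp: coeff length_remove_nth len)
  also have "\<dots> = wedge_sum k (\<lambda>w us. nab \<Gamma> M' x (w # Z # X # us) - nab \<Gamma> M' x (w # X # Z # us)) us
     + (\<Sum>i<Suc k. (-1) ^ i *\<^sub>R (\<Sum>l<k. ?A ((remove_nth i us)[l := \<Gamma> x (us ! i) (remove_nth i us ! l)])))"
    by (simp only: wedge_sum_def distrib_left sum.distrib real_scaleR_def)
  also have "(\<Sum>i<Suc k. (-1) ^ i *\<^sub>R (\<Sum>l<k. ?A ((remove_nth i us)[l := \<Gamma> x (us ! i) (remove_nth i us ! l)]))) = 0"
    by (rule torsion_terms_cancel[OF alt_form_diff[OF nabM_alt[OF x] nabM_alt[OF x]] \<Gamma>_commute[OF x] len])
  finally show ?thesis by simp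
qed

text \<open>
  The terms of the Ricci identity in which the curvature acts on the form slots.
\<close>
definition residual :: "R7 \<Rightarrow> R7 \<Rightarrow> R7 \<Rightarrow> real form" where
  "residual x Z X = wedge_sum k (\<lambda>w us. \<Sum>l<k. m x (us[l := curv \<Gamma> x Z w (us ! l)]) \<bullet> X)"

lemma curvature_killed:
  fixes \<mu> :: "R7 \<Rightarrow> real"
  assumes x: "x \<in> V" and \<mu>: "linear \<mu>"
  shows "(\<^bold>\<Sum>i j. phi0 i j p * \<mu> (curv \<Gamma> x (f x i) (f x j) Z)) = 0"
  using arg_cong[OF curvature_form_part[OF x, of p Z], of \<mu>]
  by (simp add: linear_sum[OF \<mu>] linear_scale[OF \<mu>] linear_0[OF \<mu>])

text \<open>
  By the Bianchi identity, \<open>R(Z, v\<^sub>i) v\<^sub>j - R(Z, v\<^sub>j) v\<^sub>i = - R(v\<^sub>i, v\<^sub>j) Z\<close>. So \<open>v\<^sub>i\<close> and \<open>v\<^sub>j\<close> only enter through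
  the curvature, whose form indices lie in \<open>\<Lambda>\<^sup>2\<^sub>1\<^sub>4\<close> and have zero contraction with \<open>\<phi>\<close>.
\<close>
lemma residual_killed:
  assumes x: "x \<in> V" and k: "Suc k \<in> {1, 2, 3}"
  shows "proj x (Suc k) (residual x Z X) vs = 0"
proof -
  have lin: "linear (\<lambda>v. m x (us @ v # ws) \<bullet> X)" if "Suc (length us + length ws) = k" for us ws
    using multilin_append[OF alt_form_multilin[OF m_inner_alt[OF x]] that] .
  have rot: "phi0 p i j = phi0 i j p" for p i j by (metis phi0_rotate)
  consider "k = 0" | "k = 1" | "k = 2" using k by auto
  then show ?thesis
  proof cases
    case 1
    have "residual x Z X = (\<lambda>_. 0)"
      unfolding residual_def wedge_sum_def using 1 by simp
    then show ?thesis by (simp add: proj_def)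
  next
    case 2
    have pr: "proj x (Suc k) \<beta> vs = (if length vs = 2 then (1 / 6) * (\<^bold>\<Sum>p i. \<Sum>j\<in>UNIV.
        phi0 p i j * \<phi> x (f x p # vs) * \<beta> [f x i, f x j]) else 0)" for \<beta> :: "real form"
      using 2 by (simp add: proj_def)
    have l: "linear (\<lambda>v. m x [v] \<bullet> X)" using lin[of "[]" "[]"] 2 by simp
    have "residual x Z X [a, b] = - (m x [curv \<Gamma> x a b Z] \<bullet> X)" for a b
      unfolding residual_def
      using linear_diff[OF l, of "curv \<Gamma> x Z a b" "curv \<Gamma> x Z b a"] linear_neg[OF l, of "curv \<Gamma> x a b Z"]
        curvature_swap_first[OF x, of Z a b]
      by (simp add: 2 wedge_sum_def remove_nth_def)
    moreover have "(\<^bold>\<Sum>i j. phi0 p i j * c * (m x [curv \<Gamma> x (f x i) (f x j) Z] \<bullet> X)) = 0" for p c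
    proof -
      have "(\<^bold>\<Sum>i j. phi0 p i j * c * (m x [curv \<Gamma> x (f x i) (f x j) Z] \<bullet> X))
        = c * (\<^bold>\<Sum>i j. phi0 i j p * (m x [curv \<Gamma> x (f x i) (f x j) Z] \<bullet> X))"
        by (simp add: sum_distrib_left rot[of p] mult.assoc mult.left_commute)
      then show ?thesis by (simp add: curvature_killed[OF x l])
    qed
    ultimately show ?thesis by (simp add: pr sum_negf)
  next
    case 3
    define \<nu> where "\<nu> c v = m x [v, c] \<bullet> X" for c v
    have l: "linear (\<nu> c)" for c
      using lin[of "[]" "[c]"] 3 by (simp add: \<nu>_def[abs_def])
    have swap: "\<nu> (curv \<Gamma> x Z p q) c = - \<nu> c (curv \<Gamma> x Z p q)" for c p q
      using alt_form_swap[OF m_inner_alt[OF x], of "[]" "[]" c "curv \<Gamma> x Z p q" X] 3 by (simp add: \<nu>_def)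
    have res: "residual x Z X [a, b, c] = - \<nu> c (curv \<Gamma> x a b Z) + \<nu> b (curv \<Gamma> x a c Z) - \<nu> a (curv \<Gamma> x b c Z)" for a b c
    proof -
      have *: "\<nu> d (curv \<Gamma> x p q Z) = \<nu> d (curv \<Gamma> x Z q p) - \<nu> d (curv \<Gamma> x Z p q)" for d p q
        using curvature_swap_first[OF x, of Z q p] curv_swap[of x p q Z] linear_diff[OF l, of d "curv \<Gamma> x Z q p" "curv \<Gamma> x Z p q"]
        by simp
      show ?thesis
        unfolding residual_def * using 3
        by (simp add: wedge_sum_def remove_nth_def eval_nat_numeral \<nu>_def[symmetric] swap)
    qed
    \<comment> \<open>In each of the three terms the curvature meets a different pair of indices of \<open>\<phi>\<close>.\<close>
    have s1: "(\<^bold>\<Sum>p i j. phi0 p i j * \<nu> (f x j) (curv \<Gamma> x (f x p) (f x i) Z)) = 0"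
    proof -
      have "(\<^bold>\<Sum>p i j. phi0 p i j * \<nu> (f x j) (curv \<Gamma> x (f x p) (f x i) Z))
        = (\<^bold>\<Sum>j p i. phi0 p i j * \<nu> (f x j) (curv \<Gamma> x (f x p) (f x i) Z))"
        by (rule sum7_rotate[symmetric])
      then show ?thesis by (simp add: curvature_killed[OF x l])
    qed
    have s2: "(\<^bold>\<Sum>p i j. phi0 p i j * \<nu> (f x i) (curv \<Gamma> x (f x p) (f x j) Z)) = 0"
    proof -
      have neg: "phi0 p i j = - phi0 p j i" for p i j by (metis phi0_rotate phi0_swap)
      have "(\<^bold>\<Sum>p i j. phi0 p i j * \<nu> (f x i) (curv \<Gamma> x (f x p) (f x j) Z))
        = (\<^bold>\<Sum>i p j. phi0 p i j * \<nu> (f x i) (curv \<Gamma> x (f x p) (f x j) Z))"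
        by (rule sum.swap)
      also have "\<dots> = (\<^bold>\<Sum>i. - (\<^bold>\<Sum>p j. phi0 p j i * \<nu> (f x i) (curv \<Gamma> x (f x p) (f x j) Z)))"
        unfolding sum_negf[symmetric] by (intro sum.cong refl) (subst neg, simp)
      finally show ?thesis by (simp add: curvature_killed[OF x l])
    qed
    have s3: "(\<^bold>\<Sum>p i j. phi0 p i j * \<nu> (f x p) (curv \<Gamma> x (f x i) (f x j) Z)) = 0"
      by (subst rot) (simp add: curvature_killed[OF x l])
    have "(\<^bold>\<Sum>p i j. phi0 p i j * residual x Z X [f x p, f x i, f x j])
      = - (\<^bold>\<Sum>p i j. phi0 p i j * \<nu> (f x j) (curv \<Gamma> x (f x p) (f x i) Z))
       + (\<^bold>\<Sum>p i j. phi0 p i j * \<nu> (f x i) (curv \<Gamma> x (f x p) (f x j) Z))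
       - (\<^bold>\<Sum>p i j. phi0 p i j * \<nu> (f x p) (curv \<Gamma> x (f x i) (f x j) Z))"
      unfolding sum.distrib[symmetric] sum_subtractf[symmetric] sum_negf[symmetric]
      by (intro sum.cong refl) (simp add: res algebra_simps)
    then have z: "(\<^bold>\<Sum>p i j. phi0 p i j * residual x Z X [f x p, f x i, f x j]) = 0"
      by (simp add: s1 s2 s3)
    have pr: "proj x (Suc k) \<beta> vs = (if length vs = 3 then (\<^bold>\<Sum>p i. \<Sum>j\<in>UNIV.
        phi0 p i j * \<beta> [f x p, f x i, f x j]) / 42 * \<phi> x vs else 0)" for \<beta> :: "real form"
      using 3 proj_3[of vs x \<beta>] by (cases "length vs = 3") (simp_all add: proj_def eval_nat_numeral)
    show ?thesis by (simp add: pr z)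
  qed
qed

text \<open>
  After lowering indices, the two terms on the right are projections of alternating sums of second
  covariant derivatives of \<open>M\<close>, with the form argument \<open>w\<close> differentiated first or last. By the
  Ricci identity their difference is the curvature insertion \<open>?C\<close> and two residual terms.
\<close>
theorem local_identity:
  assumes x: "x \<in> V" and k: "Suc k \<in> {1, 2, 3}"
  shows "can_proj (g x) (\<phi> x) (Suc k) (curv_ins m x) vs
    = skew d0m x vs - can_proj (g x) (\<phi> x) (Suc k) (ext_cov_deriv (conn_End g) (skew m) x) vs"
proof (rule matrix_eq_by_metric[OF x])
  fix X Z
  let ?P = "\<lambda>\<alpha>. proj x (Suc k) \<alpha> vs"
  let ?C = "\<lambda>w us. m x us \<bullet> (curv \<Gamma> x X w Z - curv \<Gamma> x Z w X)"
  let ?N = "nab \<Gamma> M' x"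
  have linC: "linear (\<lambda>w. m x us \<bullet> (curv \<Gamma> x X w Z - curv \<Gamma> x Z w X))" for us X Z
  proof -
    have "linear (\<lambda>w. curv \<Gamma> x X w Z - curv \<Gamma> x Z w X)"
    proof -
      have "curv \<Gamma> x X w Z - curv \<Gamma> x Z w X = curv \<Gamma> x w Z X - curv \<Gamma> x w X Z" for w
        using curv_swap[of x X w Z] curv_swap[of x Z w X] by simp
      then show ?thesis
        by (simp only: linear_compose_sub linear_curv_left[OF x])
    qed
    then show ?thesis
      using linear_compose[OF _ bounded_linear.linear[OF bounded_linear_inner_right[of "m x us"]]] by (simp add: o_def)
  qed
  have mlC: "multilin (Suc k) (\<lambda>us. g x X (curv_ins m x us *v Z))" for X Z
  proof -
    have "multilin (Suc k) (wedge_sum k (\<lambda>w us. m x us \<bullet> (curv \<Gamma> x X w Z - curv \<Gamma> x Z w X)))"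
      by (intro multilin_wedge_sum linC alt_form_multilin[OF m_inner_alt[OF x]])
    then show ?thesis by (simp add: multilin_def curv_ins_apply[OF x])
  qed
  have mlN: "multilin (Suc (Suc (Suc k))) ?N" by (rule multilin_nab[OF x C1_nabM])
  have mlE: "multilin (Suc k) (\<lambda>us. g x X (ext_cov_deriv (conn_End g) (skew m) x us *v Z))" for X Z
  proof -
    have "multilin k (\<lambda>us. ?N (w # Z # X # us) - ?N (w # X # Z # us))" for w
      unfolding multilin_def
    proof (intro allI impI, elim conjE, intro linear_compose_sub)
      fix us :: "R7 list" and i assume "length us = k" "i < k"
      then show "linear (\<lambda>v. ?N (w # Z # X # us[i := v]))" "linear (\<lambda>v. ?N (w # X # Z # us[i := v]))"
        using multilin_update[OF mlN, of "w # Z # X # us" "Suc (Suc (Suc i))"]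
          multilin_update[OF mlN, of "w # X # Z # us" "Suc (Suc (Suc i))"] by simp_all
    qed
    moreover have "linear (\<lambda>w. ?N (w # Z # X # us) - ?N (w # X # Z # us))" if "length us = k" for us
      using multilin_append[OF mlN, of "[]" "Z # X # us"] multilin_append[OF mlN, of "[]" "X # Z # us"] that
      by (intro linear_compose_sub) simp_all
    ultimately have "multilin (Suc k) (wedge_sum k (\<lambda>w us. ?N (w # Z # X # us) - ?N (w # X # Z # us)))"
      by (intro multilin_wedge_sum)
    then show ?thesis by (simp add: multilin_def dE_apply[OF x])
  qed
  have F: "g x X (can_proj (g x) (\<phi> x) (Suc k) (curv_ins m x) vs *v Z) = ?P (wedge_sum k ?C)"
    unfolding can_proj_eq[where \<alpha> = "curv_ins m x", OF x k matrix_multilin[OF x mlC]] proj_map[OF linear_g_apply[OF x]]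
    by (rule proj_cong) (rule curv_ins_apply[OF x])
  have E: "g x X (can_proj (g x) (\<phi> x) (Suc k) (ext_cov_deriv (conn_End g) (skew m) x) vs *v Z)
    = ?P (wedge_sum k (\<lambda>w us. ?N (w # Z # X # us) - ?N (w # X # Z # us)))"
    unfolding can_proj_eq[where \<alpha> = "ext_cov_deriv (conn_End g) (skew m) x", OF x k matrix_multilin[OF x mlE]] proj_map[OF linear_g_apply[OF x]]
    by (rule proj_cong) (rule dE_apply[OF x])
  have ricci: "?N (Z # w # X # us) - ?N (w # Z # X # us)
    = - (m x us \<bullet> curv \<Gamma> x Z w X) - (\<Sum>l<k. m x (us[l := curv \<Gamma> x Z w (us ! l)]) \<bullet> X)"
    if "length us = k" for w us X Z
    using ricci_identity[OF x C2_M, of "X # us" Z w] that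
    unfolding sum.lessThan_Suc_shift by simp
  have "?P (\<lambda>us. cov \<Gamma> Dm x Z (X # us) - cov \<Gamma> Dm x X (Z # us))
      - ?P (wedge_sum k (\<lambda>w us. ?N (w # Z # X # us) - ?N (w # X # Z # us)))
    = ?P (\<lambda>us. wedge_sum k ?C us - residual x Z X us + residual x X Z us)"
    unfolding proj_diff[symmetric]
  proof (rule proj_cong)
    fix us :: "R7 list" assume len: "length us = Suc k"
    have "cov \<Gamma> Dm x Z (X # us) - cov \<Gamma> Dm x X (Z # us)
        - wedge_sum k (\<lambda>w us. ?N (w # Z # X # us) - ?N (w # X # Z # us)) us
      = wedge_sum k (\<lambda>w us. ?N (Z # w # X # us) - ?N (X # w # Z # us) - (?N (w # Z # X # us) - ?N (w # X # Z # us))) us"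
      by (simp only: cov_Dm[OF x len] wedge_sum_diff)
    also have "\<dots> = wedge_sum k (\<lambda>w us. ?C w us - (\<Sum>l<k. m x (us[l := curv \<Gamma> x Z w (us ! l)]) \<bullet> X)
       + (\<Sum>l<k. m x (us[l := curv \<Gamma> x X w (us ! l)]) \<bullet> Z)) us"
    proof (rule wedge_sum_cong[OF len])
      fix w and us :: "R7 list" assume "length us = k"
      from ricci[OF this, of Z w X] ricci[OF this, of X w Z]
      show "?N (Z # w # X # us) - ?N (X # w # Z # us) - (?N (w # Z # X # us) - ?N (w # X # Z # us))
        = ?C w us - (\<Sum>l<k. m x (us[l := curv \<Gamma> x Z w (us ! l)]) \<bullet> X) + (\<Sum>l<k. m x (us[l := curv \<Gamma> x X w (us ! l)]) \<bullet> Z)"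
        unfolding inner_diff_right by linarith
    qed
    finally show "cov \<Gamma> Dm x Z (X # us) - cov \<Gamma> Dm x X (Z # us)
        - wedge_sum k (\<lambda>w us. ?N (w # Z # X # us) - ?N (w # X # Z # us)) us
      = wedge_sum k ?C us - residual x Z X us + residual x X Z us"
      by (simp only: wedge_sum_add wedge_sum_diff residual_def)
  qed
  also have "\<dots> = ?P (wedge_sum k ?C)"
    by (simp only: proj_add proj_diff residual_killed[OF x k] diff_0_right add_0_right)
  finally show "g x X (can_proj (g x) (\<phi> x) (Suc k) (curv_ins m x) vs *v Z)
    = g x X ((skew d0m x vs - can_proj (g x) (\<phi> x) (Suc k) (ext_cov_deriv (conn_End g) (skew m) x) vs) *v Z)"
    unfolding matrix_vector_mult_diff_rdistrib linear_diff[OF linear_g_right[OF x]] E F skew_d0m_apply[OF x k]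
    by simp
qed

end

lemma can_proj_zero:
  "can_proj g \<phi> 4 \<alpha> vs = 0"
proof -
  have "can_proj_real g \<phi> 4 \<beta> = (\<lambda>_. 0)" for \<beta>
    unfolding can_proj_real_def by (rule the_equality) (auto simp: can_forms_def form_inner_def)
  then show ?thesis by (simp add: can_proj_def)
qed

theorem proposition4p1:
  fixes Y :: "'y topology" and \<A> :: "'y chart set"
    and \<phi> vol :: "('y, real form) field" and g :: "('y, bilin) field"
    and k :: nat and m :: "('y, R7 form) field"
  assumes "smooth_manifold Y \<A>"
    and "G2_structure \<A> \<phi> g vol"
    and "torsion_free \<A> \<phi> g vol"
    and "k \<le> 3"
    and "m \<in> G0_cochains \<A> \<phi> k"
  shows "\<forall>c\<in>\<A>. \<forall>x\<in>chart_image c. \<forall>vs.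
    f_can \<phi> g k m c x vs
      = K_can g (Suc k) (d0 \<phi> g k m) c x vs - dE \<phi> g k (K_can g k m) c x vs"
proof (intro ballI allI)
  fix c x and vs :: "R7 list" assume c: "c \<in> \<A>" and x: "x \<in> chart_image c"
  show "f_can \<phi> g k m c x vs
      = K_can g (Suc k) (d0 \<phi> g k m) c x vs - dE \<phi> g k (K_can g k m) c x vs"
  proof (cases "k = 3")
    case True
    then show ?thesis by (simp add: f_can_def K_can_def dE_def can_proj_zero)
  next
    case False
    then have k: "k \<le> 2" and k': "Suc k \<in> {1, 2, 3}" using assms(4) by auto
    have G2: "form_field pull_scalar \<A> 3 \<phi>" "riemannian_metric \<A> g" "form_field pull_scalar \<A> 7 vol"
      using assms(2) by (auto simp: G2_structure_def)
    have m: "form_field pull_covector \<A> k m" using assms(5) by (simp add: G0_cochains_def)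
    \<comment> \<open>All operators are local, so the chart may be restricted to a domain with an adapted coframe.\<close>
    have "\<exists>V e. open V \<and> x \<in> V \<and> V \<subseteq> chart_image c \<and> (\<forall>i. smooth_on V (\<lambda>y. e y i)) \<and>
        (\<forall>y\<in>V. (\<forall>u v. g c y u v = (\<Sum>i\<in>UNIV. (e y i \<bullet> u) * (e y i \<bullet> v))) \<and>
               vol c y = wedge_covectors [e y 1, e y 2, e y 3, e y 4, e y 5, e y 6, e y 7] \<and>
               \<phi> c y = standard_three_form (e y))"
      using assms(2) c x by (simp add: G2_structure_def)
    then obtain V e where V: "open V" "x \<in> V" "V \<subseteq> chart_image c"
      and e: "\<And>i. smooth_on V (\<lambda>y. e y i)"
      and frame: "\<And>y. y \<in> V \<Longrightarrow> (\<forall>u v. g c y u v = (\<Sum>i\<in>UNIV. (e y i \<bullet> u) * (e y i \<bullet> v))) \<and>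
               vol c y = wedge_covectors [e y 1, e y 2, e y 3, e y 4, e y 5, e y 6, e y 7] \<and>
               \<phi> c y = standard_three_form (e y)"
      by blast
    have C: "Ck_on n V h" if "smooth_on (chart_image c) h" for n and h :: "R7 \<Rightarrow> 'b::real_normed_vector"
      by (rule Ck_on_mono[OF _ V(3)]) (use that in \<open>simp add: smooth_on_def\<close>)
    have tf: "ext_cov_deriv conn_trivial (\<phi> c) y = (\<lambda>_. 0)"
      "ext_cov_deriv conn_trivial (\<lambda>z. hodge_star (g c z) (vol c z) 3 (\<phi> c z)) y = (\<lambda>_. 0)" if "y \<in> V" for y
      using assms(3) c that V(3) unfolding torsion_free_def Let_def by blast+
    interpret cochain_chart V "g c" e "\<phi> c" "vol c" k "m c"
    proof
      fix y u v assume y: "y \<in> V"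
      then have y': "y \<in> chart_image c" using V(3) by blast
      show "g c y u v = (\<Sum>i\<in>UNIV. (e y i \<bullet> u) * (e y i \<bullet> v))" using frame[OF y] by blast
      show "v \<noteq> 0 \<Longrightarrow> 0 < g c y v v" using G2(2) c y' unfolding riemannian_metric_def by blast
      show "(\<lambda>z. e z i) differentiable (at y)" for i
        using e[of i] y unfolding smooth_on_def by (auto dest: spec[of _ 1])
      show "alt_form 3 (\<phi> c y)" using G2(1) c y' unfolding form_field_def by blast
      show "alt_form 7 (vol c y)" using G2(3) c y' unfolding form_field_def by blast
      show "alt_form k (m c y)" using m c y' unfolding form_field_def by blast
      show "\<phi> c y = standard_three_form (e y)" using frame[OF y] by blast
      show "vol c y = wedge_covectors [e y 1, e y 2, e y 3, e y 4, e y 5, e y 6, e y 7]" using frame[OF y] by blast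
      show "ext_cov_deriv conn_trivial (\<phi> c) y = (\<lambda>_. 0)" by (rule tf(1)[OF y])
      show "ext_cov_deriv conn_trivial (\<lambda>z. hodge_star (g c z) (vol c z) 3 (\<phi> c z)) y = (\<lambda>_. 0)" by (rule tf(2)[OF y])
    next
      fix u v
      show "Ck_on 2 V (\<lambda>z. g c z u v)" using G2(2) c by (intro C) (auto simp: riemannian_metric_def)
    next
      fix us :: "R7 list" and X
      show "Ck_on 2 V (\<lambda>y. \<phi> c y us)" using G2(1) c by (intro C) (auto simp: form_field_def)
      show "Ck_on 2 V (\<lambda>y. vol c y us)" using G2(3) c by (intro C) (auto simp: form_field_def)
      show "Ck_on 2 V (\<lambda>y. m c y us \<bullet> X)" using m c by (intro Ck_on_inner[OF V(1)] C) (auto simp: form_field_def)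
    qed (use V in auto)
    have "skew_deriv g m c = skew (m c)"
      by (simp add: skew_deriv_def skew_def fun_eq_iff)
    moreover have "skew_deriv g (d0 \<phi> g k m) c = skew d0m"
    proof -
      have "d0 \<phi> g k m c = d0m" by (simp add: d0m_def d0_def fun_eq_iff)
      then show ?thesis by (intro ext) (simp only: skew_deriv_def skew_def)
    qed
    moreover have "curv_insert g m c = curv_ins (m c)"
      by (simp add: curv_insert_def curv_ins_def fun_eq_iff)
    ultimately show ?thesis
      using local_identity[OF V(2) k', of vs] k
      by (simp add: f_can_def K_can_def dE_def)
  qed
qed

end
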